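(* Let $E\subset\mathbb{R}^N$ be open, $T>0$, $E_T=E\times(0,T)$, $\gamma>0$, and let $u\in[DG](E_T;\gamma)\cap L^\infty_{\mathrm{loc}}(E_T)$, where $[DG](E_T;\gamma)$ is the singular parabolic DeGiorgi class. Let $(x_o,t_o)\in E_T$. Then $u$ is continuous at $(x_o,t_o)$ if and only if $$\limsup_{\rho\searrow0}\ \frac{\rho}{|Q_\rho|}\int_{t_o-\rho}^{t_o}\|Du(\cdot,t)\|(B_\rho(x_o))\,dt=0 .$$
   Context: Notation. $B_\rho(x_o)$ is the open ball of radius $\rho$ about $x_o$ in $\mathbb{R}^N$, $B_\rho=B_\rho(0)$. For $\theta>0$, $Q_\rho(\theta)=B_\rho\times(-\theta\rho,0]$, $Q_\rho=Q_\rho(1)$, and $[(x_o,t_o)+Q_\rho(\theta)]=B_\rho(x_o)\times(t_o-\theta\rho,t_o]$. $|Q_\rho|$ is Lebesgue measure in $\mathbb{R}^{N+1}$. $\|Dv\|(A)$ is the total variation of the distributional gradient of $v$ on the open set $A$. $L^1(0,T;BV(E))$ is the set of maps $v:[0,T]\to BV(E)$ with $v\in L^1(E_T)$, $t\mapsto\|Dv(t)\|(E)\in L^1(0,T)$, and $t\mapsto\langle Dv(t),\varphi\rangle=-\int_E v(t)\,\mathrm{div}\,\varphi\,dx$ measurable for all $\varphi\in[C^1_o(E)]^N$; $L^1_{\mathrm{loc}}(0,T;BV_{\mathrm{loc}}(E))$ is the local version (over all $E'\times(t_1,t_2)$ with $E'$ open and compactly contained in $E$, $[t_1,t_2]\subset(0,T)$).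 Cutoff functions. $\mathcal{C}([(x_o,t_o)+Q_\rho(\theta)])$ is the class of non-negative, piecewise smooth functions $\zeta$ defined in $[(x_o,t_o)+Q_\rho(\theta)]$, vanishing outside $B_\rho(x_o)$ (in the space variable), with $\zeta_t\ge0$ and $|D\zeta|+\zeta_t\in L^\infty([(x_o,t_o)+Q_\rho(\theta)])$. Truncations. $(u-k)_\pm=\max\{\pm(u-k),0\}$. DeGiorgi classes. $[DG]^\pm(E_T;\gamma)$ is the collection of all measurable $u\in C_{\mathrm{loc}}((0,T);L^2_{\mathrm{loc}}(E))\cap L^1_{\mathrm{loc}}(0,T;BV_{\mathrm{loc}}(E))$ satisfying $$\sup_{t_o-\theta\rho\le t\le t_o}\int_{B_\rho(x_o)}(u-k)_\pm^2\zeta(x,t)\,dx+\int_{t_o-\theta\rho}^{t_o}\|D((u-k)_\pm\zeta)(t)\|(B_\rho(x_o))\,dt$$ $$\le\gamma\iint_{[(x_o,t_o)+Q_\rho(\theta)]}\big[(u-k)_\pm|D\zeta|+(u-k)_\pm^2|\zeta_t|\big]dx\,dt+\int_{B_\rho(x_o)}(u-k)_\pm^2\zeta(x,t_o-\theta\rho)\,dx$$ for all $[(x_o,t_o)+Q_\rho(\theta)]\subset E_T$, all $k\in\mathbb{R}$ and all $\zeta\in\mathcal{C}([(x_o,t_o)+Q_\rho(\theta)])$. Finally $[DG](E_T;\gamma)=[DG]^+(E_T;\gamma)\cap[DG]^-(E_T;\gamma)$. Continuity at a point of the a.e.-defined function $u$ means that the essential oscillation of $u$ over neighborhoods of $(x_o,t_o)$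 tends to $0$ as the neighborhoods shrink to the point (equivalently, some representative of $u$ is continuous there). *)

theory Defs
  imports "HOL-Analysis.Analysis" "HOL-Probability.Essential_Supremum"
begin

text \<open>
  Throughout, the space \<open>\<real>\<^sup>N\<close> is an arbitrary Euclidean space \<^typ>\<open>'a::euclidean_space\<close> with
  \<open>N = DIM('a)\<close>. Space-time points are pairs \<open>(x, t)\<close> of type \<^typ>\<open>'a \<times> real\<close>.
\<close>

section \<open>Smooth functions and functions of bounded variation\<close>

text \<open>For open \<open>U\<close> this is membership in \<open>C\<^sup>k(U)\<close>: all partial derivatives up to order \<open>k\<close> exist
  and are continuous.\<close>

primrec Ck_on :: "nat \<Rightarrow> 'a::euclidean_space set \<Rightarrow> ('a \<Rightarrow> 'b::real_normed_vector) \<Rightarrow> bool" where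
  "Ck_on 0 U f \<longleftrightarrow> continuous_on U f"
| "Ck_on (Suc k) U f \<longleftrightarrow>
     (\<forall>x\<in>U. f differentiable (at x)) \<and>
     (\<forall>b\<in>Basis. Ck_on k U (\<lambda>x. frechet_derivative f (at x) b))"

definition smooth_on :: "'a::euclidean_space set \<Rightarrow> ('a \<Rightarrow> 'b::real_normed_vector) \<Rightarrow> bool" where
  "smooth_on U f \<longleftrightarrow> (\<forall>k. Ck_on k U f)"

definition gradient :: "('a::euclidean_space \<Rightarrow> real) \<Rightarrow> 'a \<Rightarrow> 'a" where
  "gradient f x = (\<Sum>b\<in>Basis. frechet_derivative f (at x) b *\<^sub>R b)"

definition divergence :: "('a::euclidean_space \<Rightarrow> 'a) \<Rightarrow> 'a \<Rightarrow> real" where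
  "divergence \<phi> x = (\<Sum>b\<in>Basis. frechet_derivative \<phi> (at x) b \<bullet> b)"

text \<open>\<open>[C\<^sup>1\<^sub>o(A)]\<^sup>N\<close>; the fields are extended by zero to the whole space.\<close>

definition test_fields :: "'a::euclidean_space set \<Rightarrow> ('a \<Rightarrow> 'a) set" where
  "test_fields A = {\<phi>. Ck_on 1 UNIV \<phi> \<and> (\<exists>K. compact K \<and> K \<subseteq> A \<and> (\<forall>x. x \<notin> K \<longrightarrow> \<phi> x = 0))}"

text \<open>\<open>\<parallel>Dv\<parallel>(A)\<close> for open \<open>A\<close> and \<open>v\<close> locally integrable in \<open>A\<close>. Since \<open>\<phi> = 0\<close> is admissible, the
  truncation of negative values by \<^const>\<open>ennreal\<close> does not affect the supremum.\<close>

definition total_variation :: "('a::euclidean_space \<Rightarrow> real) \<Rightarrow> 'a set \<Rightarrow> ennreal" where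
  "total_variation v A =
     (SUP \<phi>\<in>{\<phi>\<in>test_fields A. \<forall>x. norm (\<phi> x) \<le> 1}.
        ennreal (integral\<^sup>L (lebesgue_on A) (\<lambda>x. v x * divergence \<phi> x)))"

definition BV :: "'a::euclidean_space set \<Rightarrow> ('a \<Rightarrow> real) set" where
  "BV A = {v. integrable (lebesgue_on A) v \<and> total_variation v A < \<infinity>}"

section \<open>Function spaces on space-time\<close>

definition compactly_contained :: "'a::topological_space set \<Rightarrow> 'a set \<Rightarrow> bool" where
  "compactly_contained E' E \<longleftrightarrow> compact (closure E') \<and> closure E' \<subseteq> E"

definition L1_BV :: "real \<Rightarrow> real \<Rightarrow> 'a::euclidean_space set \<Rightarrow> (real \<Rightarrow> 'a \<Rightarrow> real) set" where
  "L1_BV t1 t2 E = {v.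
     (\<forall>t\<in>{t1..t2}. v t \<in> BV E) \<and>
     integrable (lebesgue_on (E \<times> {t1<..<t2})) (\<lambda>(x, t). v t x) \<and>
     (\<lambda>t. total_variation (v t) E) \<in> borel_measurable (lebesgue_on {t1<..<t2}) \<and>
     (\<integral>\<^sup>+ t. total_variation (v t) E \<partial>lebesgue_on {t1<..<t2}) < \<infinity> \<and>
     (\<forall>\<phi>\<in>test_fields E.
        (\<lambda>t. - integral\<^sup>L (lebesgue_on E) (\<lambda>x. v t x * divergence \<phi> x))
          \<in> borel_measurable (lebesgue_on {t1<..<t2}))}"

text \<open>As usual for spaces of Lebesgue type, the local space is understood modulo null sets: locally,
  \<open>u\<close> agrees for almost every time, almost everywhere in space, with a map in \<^const>\<open>L1_BV\<close>.\<close>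

definition L1_BV_loc :: "real \<Rightarrow> 'a::euclidean_space set \<Rightarrow> ('a \<times> real \<Rightarrow> real) set" where
  "L1_BV_loc T E = {u. \<forall>E' t1 t2. open E' \<and> compactly_contained E' E \<and> 0 < t1 \<and> t1 < t2 \<and> t2 < T \<longrightarrow>
     (\<exists>v\<in>L1_BV t1 t2 E'.
        AE t in lebesgue_on {t1..t2}. AE x in lebesgue_on E'. v t x = u (x, t))}"

definition L2 :: "'a::euclidean_space set \<Rightarrow> ('a \<Rightarrow> real) set" where
  "L2 A = {f. f \<in> borel_measurable (lebesgue_on A) \<and> integrable (lebesgue_on A) (\<lambda>x. (f x)\<^sup>2)}"

definition C_L2_loc :: "real \<Rightarrow> 'a::euclidean_space set \<Rightarrow> ('a \<times> real \<Rightarrow> real) set" where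
  "C_L2_loc T E = {u. \<forall>E'. open E' \<and> compactly_contained E' E \<longrightarrow>
     (\<forall>t\<in>{0<..<T}. (\<lambda>x. u (x, t)) \<in> L2 E') \<and>
     (\<forall>s\<in>{0<..<T}.
        ((\<lambda>t. integral\<^sup>L (lebesgue_on E') (\<lambda>x. (u (x, t) - u (x, s))\<^sup>2)) \<longlongrightarrow> 0) (at s))}"

definition Linf :: "'a::euclidean_space set \<Rightarrow> ('a \<Rightarrow> real) set" where
  "Linf A = {f. f \<in> borel_measurable (lebesgue_on A) \<and> (\<exists>M. AE z in lebesgue_on A. \<bar>f z\<bar> \<le> M)}"

definition Linf_loc :: "'a::euclidean_space set \<Rightarrow> ('a \<Rightarrow> real) set" where
  "Linf_loc A = {f. \<forall>K. compact K \<and> K \<subseteq> A \<longrightarrow> f \<in> Linf K}"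

section \<open>Cylinders and cutoff functions\<close>

text \<open>The backward cylinder \<open>[(x\<^sub>o, t\<^sub>o) + Q\<^sub>\<rho>(\<theta>)]\<close>.\<close>

definition cylinder :: "'a::euclidean_space \<Rightarrow> real \<Rightarrow> real \<Rightarrow> real \<Rightarrow> ('a \<times> real) set" where
  "cylinder xo to \<theta> \<rho> = ball xo \<rho> \<times> {to - \<theta> * \<rho><..to}"

text \<open>\<open>S\<close> is covered by finitely many closed pieces, on each of which \<open>f\<close> is the restriction of a
  \<open>C\<^sup>\<infinity>\<close> function defined near that piece, and \<open>f\<close> is continuous across the interfaces. Such an \<open>f\<close>
  is locally Lipschitz in the interior of \<open>S\<close>, so its classical derivatives exist almost everywhere
  there.\<close>

definition piecewise_smooth_on :: "'a::euclidean_space set \<Rightarrow> ('a \<Rightarrow> real) \<Rightarrow> bool" where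
  "piecewise_smooth_on S f \<longleftrightarrow>
     continuous_on S f \<and>
     (\<exists>P. finite P \<and> S \<subseteq> \<Union>P \<and>
       (\<forall>C\<in>P. closed C \<and>
         (\<exists>U g. open U \<and> C \<inter> S \<subseteq> U \<and> smooth_on U g \<and> (\<forall>z\<in>C \<inter> S. f z = g z))))"

definition space_gradient :: "('a::euclidean_space \<times> real \<Rightarrow> real) \<Rightarrow> 'a \<times> real \<Rightarrow> 'a" where
  "space_gradient \<zeta> z = gradient (\<lambda>x. \<zeta> (x, snd z)) (fst z)"

definition time_deriv :: "('a::euclidean_space \<times> real \<Rightarrow> real) \<Rightarrow> 'a \<times> real \<Rightarrow> real" where
  "time_deriv \<zeta> z = deriv (\<lambda>t. \<zeta> (fst z, t)) (snd z)"

text \<open>A cutoff function is extended by zero outside the ball, and its value at the initial time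
  \<open>t\<^sub>o - \<theta>\<rho>\<close>, which enters the energy inequality, is the continuous extension. The conditions on
  the derivatives are imposed almost everywhere, as \<open>\<zeta>\<close> need not be differentiable on the interfaces.\<close>

definition cutoffs :: "'a::euclidean_space \<Rightarrow> real \<Rightarrow> real \<Rightarrow> real \<Rightarrow> ('a \<times> real \<Rightarrow> real) set" where
  "cutoffs xo to \<theta> \<rho> = {\<zeta>.
     continuous_on (UNIV \<times> {to - \<theta> * \<rho>..to}) \<zeta> \<and>
     (\<forall>x. \<forall>t\<in>{to - \<theta> * \<rho>..to}. 0 \<le> \<zeta> (x, t)) \<and>
     (\<forall>x. \<forall>t\<in>{to - \<theta> * \<rho>..to}. x \<notin> ball xo \<rho> \<longrightarrow> \<zeta> (x, t) = 0) \<and>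
     piecewise_smooth_on (cylinder xo to \<theta> \<rho>) \<zeta> \<and>
     (AE z in lebesgue_on (cylinder xo to \<theta> \<rho>). 0 \<le> time_deriv \<zeta> z) \<and>
     (\<lambda>z. norm (space_gradient \<zeta> z) + time_deriv \<zeta> z) \<in> Linf (cylinder xo to \<theta> \<rho>)}"

section \<open>The singular parabolic DeGiorgi classes\<close>

definition trunc_pos :: "real \<Rightarrow> real \<Rightarrow> real" where
  "trunc_pos k r = max (r - k) 0"

definition trunc_neg :: "real \<Rightarrow> real \<Rightarrow> real" where
  "trunc_neg k r = max (- (r - k)) 0"

text \<open>The energy inequality for the truncated function \<open>w = (u - k)\<^sub>\<plusminus>\<close>. All terms are non-negative
  and may be infinite.\<close>

definition energy_ineq ::
  "real \<Rightarrow> ('a::euclidean_space \<times> real \<Rightarrow> real) \<Rightarrow> 'a \<Rightarrow> real \<Rightarrow> real \<Rightarrow> real \<Rightarrow> ('a \<times> real \<Rightarrow> real) \<Rightarrow> bool"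
where
  "energy_ineq \<gamma> w xo to \<theta> \<rho> \<zeta> \<longleftrightarrow>
     (SUP t\<in>{to - \<theta> * \<rho>..to}.
        \<integral>\<^sup>+ x. ennreal ((w (x, t))\<^sup>2 * \<zeta> (x, t)) \<partial>lebesgue_on (ball xo \<rho>))
     + (\<integral>\<^sup>+ t. total_variation (\<lambda>x. w (x, t) * \<zeta> (x, t)) (ball xo \<rho>)
          \<partial>lebesgue_on {to - \<theta> * \<rho>..to})
     \<le> ennreal \<gamma> *
        (\<integral>\<^sup>+ z. ennreal (w z * norm (space_gradient \<zeta> z) + (w z)\<^sup>2 * \<bar>time_deriv \<zeta> z\<bar>)
          \<partial>lebesgue_on (cylinder xo to \<theta> \<rho>))
     + (\<integral>\<^sup>+ x. ennreal ((w (x, to - \<theta> * \<rho>))\<^sup>2 * \<zeta> (x, to - \<theta> * \<rho>)) \<partial>lebesgue_on (ball xo \<rho>))"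

text \<open>The condition \<open>0 < t\<^sub>o - \<theta>\<rho>\<close> only excludes cylinders whose initial time is \<open>0\<close>, where \<open>u\<close>
  is not defined.\<close>

definition DG_trunc ::
  "(real \<Rightarrow> real \<Rightarrow> real) \<Rightarrow> 'a::euclidean_space set \<Rightarrow> real \<Rightarrow> real \<Rightarrow> ('a \<times> real \<Rightarrow> real) set" where
  "DG_trunc trunc E T \<gamma> = {u.
     u \<in> borel_measurable (lebesgue_on (E \<times> {0<..<T})) \<and>
     u \<in> C_L2_loc T E \<inter> L1_BV_loc T E \<and>
     (\<forall>xo to \<theta> \<rho>. 0 < \<theta> \<and> 0 < \<rho> \<and> cylinder xo to \<theta> \<rho> \<subseteq> E \<times> {0<..<T} \<and> 0 < to - \<theta> * \<rho> \<longrightarrow>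
       (\<forall>k. \<forall>\<zeta>\<in>cutoffs xo to \<theta> \<rho>. energy_ineq \<gamma> (\<lambda>z. trunc k (u z)) xo to \<theta> \<rho> \<zeta>))}"

definition DG_plus :: "'a::euclidean_space set \<Rightarrow> real \<Rightarrow> real \<Rightarrow> ('a \<times> real \<Rightarrow> real) set" where
  "DG_plus = DG_trunc trunc_pos"

definition DG_minus :: "'a::euclidean_space set \<Rightarrow> real \<Rightarrow> real \<Rightarrow> ('a \<times> real \<Rightarrow> real) set" where
  "DG_minus = DG_trunc trunc_neg"

definition DG :: "'a::euclidean_space set \<Rightarrow> real \<Rightarrow> real \<Rightarrow> ('a \<times> real \<Rightarrow> real) set" where
  "DG E T \<gamma> = DG_plus E T \<gamma> \<inter> DG_minus E T \<gamma>"

section \<open>Continuity at a point of a function defined almost everywhere\<close>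

definition ess_osc :: "('a::euclidean_space \<Rightarrow> real) \<Rightarrow> 'a set \<Rightarrow> ereal" where
  "ess_osc u A =
     esssup (lebesgue_on A) (\<lambda>z. ereal (u z)) + esssup (lebesgue_on A) (\<lambda>z. - ereal (u z))"

definition ess_continuous_at :: "('a::euclidean_space \<Rightarrow> real) \<Rightarrow> 'a \<Rightarrow> bool" where
  "ess_continuous_at u z \<longleftrightarrow> ((\<lambda>r. ess_osc u (ball z r)) \<longlongrightarrow> 0) (at_right 0)"

end

theory Submission
  imports Defs "HOL-Real_Asymp.Real_Asymp"
begin

text \<open>
  Necessity is the energy inequality for \<open>(u - k)\<^sub>+\<close> with \<open>k\<close> the essential infimum of \<open>u\<close> near the
  point: it bounds the total variation of \<open>u\<close> by its oscillation.

  For sufficiency, smallness of the total variation yields a time \<open>s\<close> slightly before \<open>t\<^sub>o\<close>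
  at which, by Poincare's inequality, \<open>u(s)\<close> is \<open>L\<^sup>1\<close>-close to a constant \<open>c\<close> on \<open>B\<^sub>\<rho>\<close>. On the forward
  cylinder \<open>B\<^sub>\<rho> \<times> (s, s + \<theta>\<rho>]\<close>, which contains \<open>t\<^sub>o\<close> in its interior, De Giorgi's iteration gives
  \<open>u \<le> c + 2\<epsilon>\<close> provided that \<open>{u > c + \<epsilon>}\<close> has relative measure at most a multiple of \<open>\<theta>\<^sup>N\<close> (the loss
  comes from the cutoff in time). The energy inequality with a cutoff independent of time only shows
  that this measure is \<open>O(\<theta>)\<close> up to the initial error, but each repetition on a smaller ball and at a
  higher level gains a factor \<open>\<theta>\<close>, and \<open>N + 1\<close> repetitions suffice. The lower bound is the same
  statement for \<open>-u\<close>.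
\<close>

section \<open>Continuously differentiable test functions\<close>

text \<open>The total variation is a supremum over test fields, and nothing is assumed about its
  measurability in time for slices of truncations. Its time integral is therefore handled as a lower
  integral: only monotonicity, restriction to a set and one half of the scaling rule are used, never
  additivity.

  The quantitative facts about BV all come by duality from one estimate: on a ball, the L1 norm of
  F(x + e) - F(x) is at most |e| times the variation on a larger ball. Averaged over small e it
  yields both the isoperimetric gain and the Poincare inequality.

  The order of choices is the delicate point. On a slab of height \<theta>\<rho> the energy constant
  is of order 1/(\<theta>\<rho>), which forces averaging balls of radius comparable to
  \<theta>\<rho>; their volume is the source of the threshold \<theta>^N. A gain of \<theta>^(N+1)
  leaves one factor \<theta> to beat all constants. So \<theta> depends only on \<gamma>, the bound
  of u, \<epsilon> and N; then come the tolerated initial error \<delta>, the variation bound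
  \<eta>, and last the radius \<rho>.\<close>

definition has_C1_gradient :: "('a::euclidean_space \<Rightarrow> real) \<Rightarrow> ('a \<Rightarrow> 'a) \<Rightarrow> bool" where
  "has_C1_gradient f G \<longleftrightarrow>
     continuous_on UNIV G \<and> (\<forall>x. (f has_derivative (\<lambda>h. G x \<bullet> h)) (at x))"

lemma has_C1_gradient_continuous:
  "has_C1_gradient f G \<Longrightarrow> continuous_on UNIV f"
  unfolding has_C1_gradient_def
  by (meson continuous_at_imp_continuous_on has_derivative_continuous)

lemma has_C1_gradient_mult:
  assumes "has_C1_gradient f F" "has_C1_gradient g G"
  shows "has_C1_gradient (\<lambda>x. f x * g x) (\<lambda>x. f x *\<^sub>R G x + g x *\<^sub>R F x)"
  using assms has_C1_gradient_continuous[OF assms(1)] has_C1_gradient_continuous[OF assms(2)]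
  unfolding has_C1_gradient_def
  by (auto intro!: continuous_intros derivative_eq_intros simp: algebra_simps)

lemma has_C1_gradient_compose:
  assumes f: "has_C1_gradient f F" and S: "\<And>y. (S has_real_derivative S' y) (at y)"
    and S': "continuous_on UNIV S'"
  shows "has_C1_gradient (\<lambda>x. S (f x)) (\<lambda>x. S' (f x) *\<^sub>R F x)"
  unfolding has_C1_gradient_def
proof (intro conjI allI)
  have "continuous_on UNIV (\<lambda>x. S' (f x))"
    using continuous_on_compose2[OF S' has_C1_gradient_continuous[OF f]] by simp
  then show "continuous_on UNIV (\<lambda>x. S' (f x) *\<^sub>R F x)"
    using f unfolding has_C1_gradient_def by (auto intro!: continuous_intros)
  fix x
  have "(f has_derivative (\<lambda>h. F x \<bullet> h)) (at x)"
    using f unfolding has_C1_gradient_def by blast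
  from has_derivative_compose[OF this S[of "f x", unfolded has_field_derivative_def]]
  show "((\<lambda>x. S (f x)) has_derivative (\<lambda>h. (S' (f x) *\<^sub>R F x) \<bullet> h)) (at x)"
    by (simp add: mult.commute)
qed

text \<open>The derivative in a fixed direction \<open>b\<close> is again a polynomial in the base
  point, so smoothness of every order follows by iterating this one statement.\<close>

lemma real_polynomial_function_derivative:
  assumes "real_polynomial_function (p :: 'a::euclidean_space \<Rightarrow> real)"
  shows "\<exists>D. (\<forall>x. (p has_derivative D x) (at x)) \<and> (\<forall>b. real_polynomial_function (\<lambda>x. D x b))"
  using assms
proof induction
  case (linear f)
  then show ?case
    by (intro exI[of _ "\<lambda>x. f"]) (auto intro: bounded_linear_imp_has_derivative)
next
  case (const c)
  then show ?case by (intro exI[of _ "\<lambda>x h. 0"]) auto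
next
  case (add f g)
  then obtain F G where
    "\<forall>x. (f has_derivative F x) (at x)" "\<forall>b. real_polynomial_function (\<lambda>x. F x b)"
    "\<forall>x. (g has_derivative G x) (at x)" "\<forall>b. real_polynomial_function (\<lambda>x. G x b)" by blast
  then show ?case
    by (intro exI[of _ "\<lambda>x h. F x h + G x h"]) (auto intro!: derivative_intros)
next
  case (mult f g)
  then obtain F G where
    "\<forall>x. (f has_derivative F x) (at x)" "\<forall>b. real_polynomial_function (\<lambda>x. F x b)"
    "\<forall>x. (g has_derivative G x) (at x)" "\<forall>b. real_polynomial_function (\<lambda>x. G x b)" by blast
  then show ?case using mult.hyps
    by (intro exI[of _ "\<lambda>x h. f x * G x h + F x h * g x"]) (auto intro!: derivative_intros real_polynomial_function.intros(3,4))
qed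

lemma has_C1_gradient_polynomial:
  assumes "real_polynomial_function (p :: 'a::euclidean_space \<Rightarrow> real)"
  shows "\<exists>G. has_C1_gradient p G"
proof -
  obtain D where D: "\<And>x. (p has_derivative D x) (at x)" "\<And>b. real_polynomial_function (\<lambda>x. D x b)"
    using real_polynomial_function_derivative[OF assms] by blast
  define G where "G = (\<lambda>x. \<Sum>b\<in>Basis. D x b *\<^sub>R b)"
  have "continuous_on UNIV (\<lambda>x. D x b)" for b
    using D(2) continuous_on_polymonial_function real_polynomial_function_eq by blast
  then have "continuous_on UNIV G"
    unfolding G_def by (auto intro!: continuous_intros)
  moreover have "D x = (\<lambda>h. G x \<bullet> h)" for x
  proof
    fix h
    interpret bounded_linear "D x" using D(1) has_derivative_bounded_linear by blast
    have "D x h = D x (\<Sum>b\<in>Basis. (h \<bullet> b) *\<^sub>R b)" by (simp add: euclidean_representation)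
    also have "\<dots> = G x \<bullet> h"
      unfolding G_def by (simp add: sum scaleR inner_sum_left inner_sum_right inner_commute mult.commute)
    finally show "D x h = G x \<bullet> h" .
  qed
  ultimately show ?thesis using D(1) unfolding has_C1_gradient_def by metis
qed

lemma Ck_on_polynomial:
  assumes "real_polynomial_function (p :: 'a::euclidean_space \<Rightarrow> real)"
  shows "Ck_on k U p"
  using assms
proof (induction k arbitrary: p)
  case 0
  then show ?case
    using continuous_on_polymonial_function real_polynomial_function_eq by (auto intro: continuous_on_subset)
next
  case (Suc k)
  obtain D where D: "\<And>x. (p has_derivative D x) (at x)" "\<And>b. real_polynomial_function (\<lambda>x. D x b)"
    using real_polynomial_function_derivative[OF Suc.prems] by blast
  have "frechet_derivative p (at x) = D x" for x
    using D(1) frechet_derivative_at by metis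
  then show ?case using Suc.IH D by (auto simp: differentiable_def)
qed

text \<open>Squaring removes the kink of the positive part. This turns truncated polynomials into
  compactly supported C1 cutoffs.\<close>

lemma has_derivative_max0_square:
  "((\<lambda>y::real. (max 0 y)\<^sup>2) has_real_derivative 2 * max 0 y) (at y)"
proof -
  consider "y < 0" | "y > 0" | "y = 0" by linarith
  then show ?thesis
  proof cases
    case 1
    have "((\<lambda>y::real. 0) has_real_derivative 2 * max 0 y) (at y)" using 1 by auto
    then show ?thesis
      by (rule DERIV_cong_ev[THEN iffD1, rotated -1, OF _ refl _ refl])
        (use 1 in \<open>auto intro!: eventually_nhds_in_open[of "{..<0}" y, THEN eventually_mono]\<close>)
  next
    case 2
    have "((\<lambda>y::real. y\<^sup>2) has_real_derivative 2 * max 0 y) (at y)"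
      using 2 by (auto intro!: derivative_eq_intros)
    then show ?thesis
      by (rule DERIV_cong_ev[THEN iffD1, rotated -1, OF _ refl _ refl])
        (use 2 in \<open>auto intro!: eventually_nhds_in_open[of "{0<..}" y, THEN eventually_mono]\<close>)
  next
    case 3
    have "((\<lambda>h. ((max 0 (0 + h))\<^sup>2 - (max 0 0)\<^sup>2) / h) \<longlongrightarrow> 0) (at (0::real))"
    proof (rule Lim_null_comparison)
      show "\<forall>\<^sub>F h in at (0::real). norm (((max 0 (0 + h))\<^sup>2 - (max 0 0)\<^sup>2) / h) \<le> \<bar>h\<bar>"
        by (rule eventually_mono[OF eventually_True]) (auto simp: max_def power2_eq_square)
      show "((\<lambda>h. \<bar>h\<bar>) \<longlongrightarrow> 0) (at (0::real))"
        by (auto intro!: tendsto_eq_intros)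
    qed
    then show ?thesis unfolding DERIV_def using 3 by simp
  qed
qed

text \<open>Fields of constant direction turn the divergence into a directional derivative; through
  them the total variation controls translates.\<close>

lemma test_field_direction:
  assumes f: "has_C1_gradient f G" and K: "compact K" "K \<subseteq> A" "\<And>x. x \<notin> K \<Longrightarrow> f x = 0"
  shows "(\<lambda>x. f x *\<^sub>R e) \<in> test_fields A" "divergence (\<lambda>x. f x *\<^sub>R e) x = G x \<bullet> e"
proof -
  have D: "((\<lambda>x. f x *\<^sub>R e) has_derivative (\<lambda>h. (G x \<bullet> h) *\<^sub>R e)) (at x)" for x
    using f unfolding has_C1_gradient_def by (auto intro!: derivative_intros)
  then have F: "frechet_derivative (\<lambda>x. f x *\<^sub>R e) (at x) = (\<lambda>h. (G x \<bullet> h) *\<^sub>R e)" for x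
    using frechet_derivative_at by metis
  have "continuous_on UNIV (\<lambda>x. (G x \<bullet> b) *\<^sub>R e)" for b
    using f unfolding has_C1_gradient_def by (auto intro!: continuous_intros)
  then show "(\<lambda>x. f x *\<^sub>R e) \<in> test_fields A"
    unfolding test_fields_def using D F K by (auto simp: differentiable_def)
  show "divergence (\<lambda>x. f x *\<^sub>R e) x = G x \<bullet> e"
    unfolding divergence_def F euclidean_inner[of "G x" e] by (simp add: inner_commute)
qed

lemma has_C1_gradient_translate:
  assumes "has_C1_gradient f G"
  shows "has_C1_gradient (\<lambda>x. f (x - e)) (\<lambda>x. G (x - e))"
  unfolding has_C1_gradient_def
proof (intro conjI allI)
  show "continuous_on UNIV (\<lambda>x. G (x - e))"
    using assms unfolding has_C1_gradient_def
    by (auto intro!: continuous_on_compose2[of UNIV G UNIV] continuous_intros)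
  fix x
  have "((\<lambda>x. x - e) has_derivative (\<lambda>h. h)) (at x)" by (auto intro!: derivative_eq_intros)
  from has_derivative_compose[OF this, of f "\<lambda>h. G (x - e) \<bullet> h"] assms
  show "((\<lambda>x. f (x - e)) has_derivative (\<bullet>) (G (x - e))) (at x)"
    unfolding has_C1_gradient_def by auto
qed

lemma has_C1_gradient_zero_outside:
  assumes f: "has_C1_gradient f G" and K: "compact K" "\<And>x. x \<notin> K \<Longrightarrow> f x = 0" and x: "x \<notin> K"
  shows "G x = 0"
proof -
  have "open (- K)" using K compact_imp_closed by blast
  have "((\<lambda>x. 0) has_derivative (\<lambda>h. G x \<bullet> h)) (at x)"
    by (rule has_derivative_transform_within_open[of f _ x UNIV "-K"])
      (use f K x \<open>open (- K)\<close> in \<open>auto simp: has_C1_gradient_def\<close>)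
  then have "(\<lambda>h. G x \<bullet> h) = (\<lambda>h. 0)"
    using has_derivative_unique has_derivative_const by blast
  then have "G x \<bullet> G x = 0" by metis
  then show ?thesis by simp
qed

lemma has_C1_gradient_bounded:
  assumes f: "has_C1_gradient f G" and K: "compact K" "\<And>x. x \<notin> K \<Longrightarrow> f x = 0"
  obtains B where "0 \<le> B" "\<And>x. norm (G x) \<le> B" "\<And>x y. \<bar>f x - f y\<bar> \<le> B * norm (x - y)"
proof -
  have "compact (G ` K)"
    using f K unfolding has_C1_gradient_def
    by (meson compact_continuous_image continuous_on_subset subset_UNIV)
  then obtain B0 where B0: "\<And>x. x \<in> K \<Longrightarrow> norm (G x) \<le> B0"
    using compact_imp_bounded[of "G ` K"] by (auto simp: bounded_iff)
  define B where "B = max B0 0"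
  have B: "norm (G x) \<le> B" for x
    using has_C1_gradient_zero_outside[OF f K] B0 unfolding B_def
    by (cases "x \<in> K") (auto intro: max.coboundedI1)
  moreover have "\<bar>f x - f y\<bar> \<le> B * norm (x - y)" for x y
  proof -
    have "norm (f x - f y) \<le> B * norm (x - y)"
    proof (rule differentiable_bound[of UNIV f "\<lambda>x h. G x \<bullet> h"])
      fix z
      show "onorm ((\<bullet>) (G z)) \<le> B"
      proof (rule onorm_bound)
        show "0 \<le> B" by (simp add: B_def)
        fix y
        have "norm (G z \<bullet> y) \<le> norm (G z) * norm y"
          using Cauchy_Schwarz_ineq2 by simp
        also have "\<dots> \<le> B * norm y" by (intro mult_right_mono B) simp
        finally show "norm (G z \<bullet> y) \<le> B * norm y" .
      qed
    qed (use f in \<open>auto simp: has_C1_gradient_def\<close>)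
    then show ?thesis by simp
  qed
  ultimately show thesis using that[of B] B_def by auto
qed

lemma C1_compact_support_bounded:
  assumes f: "has_C1_gradient f G" and K: "compact K" "\<And>x. x \<notin> K \<Longrightarrow> f x = 0"
  obtains M where "\<And>x. \<bar>f x\<bar> \<le> M"
proof -
  have "compact (f ` K)"
    using K has_C1_gradient_continuous[OF f]
    by (meson compact_continuous_image continuous_on_subset subset_UNIV)
  then obtain M where M: "\<And>x. x \<in> K \<Longrightarrow> \<bar>f x\<bar> \<le> M"
    using compact_imp_bounded[of "f ` K"] by (auto simp: bounded_iff)
  show thesis
  proof (rule that[of "max M 0"])
    show "\<bar>f x\<bar> \<le> max M 0" for x
      using M[of x] K(2)[of x] by (cases "x \<in> K") auto
  qed
qed

lemma integrable_mult_bounded_continuous: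
  fixes F :: "'a::euclidean_space \<Rightarrow> real"
  assumes "integrable lborel F" and "continuous_on UNIV f" and "\<And>x. \<bar>f x\<bar> \<le> M"
  shows "integrable lborel (\<lambda>x. F x * f x)"
proof (rule Bochner_Integration.integrable_bound[of _ "\<lambda>x. F x * M"])
  show "integrable lborel (\<lambda>x. F x * M)" using assms by simp
  have [measurable]: "f \<in> borel_measurable borel" using assms borel_measurable_continuous_onI by blast
  have [measurable]: "F \<in> borel_measurable borel" using assms by simp
  show "(\<lambda>x. F x * f x) \<in> borel_measurable lborel" by simp
  show "AE x in lborel. norm (F x * f x) \<le> norm (F x * M)"
    unfolding real_norm_def abs_mult
    by (intro AE_I2 mult_left_mono order_trans[OF assms(3) abs_ge_self]) simp
qed

text \<open>\<open>F\<close> is merely integrable, so the derivative falls on the moving factor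
  \<open>f\<close>. Its difference quotients are bounded by the Lipschitz constant times
  \<open>norm e\<close>, and dominated convergence applies along any null sequence.\<close>

lemma translated_integral_has_derivative:
  fixes F :: "'a::euclidean_space \<Rightarrow> real"
  assumes F: "integrable lborel F"
    and f: "has_C1_gradient f G" and K: "compact K" "\<And>x. x \<notin> K \<Longrightarrow> f x = 0"
  shows "((\<lambda>s. \<integral>x. F x * f (x - s *\<^sub>R e) \<partial>lborel) has_real_derivative
           - (\<integral>x. F x * (G (x - s *\<^sub>R e) \<bullet> e) \<partial>lborel)) (at s)"
proof -
  obtain B where B: "0 \<le> B" "\<And>x. norm (G x) \<le> B" "\<And>x y. \<bar>f x - f y\<bar> \<le> B * norm (x - y)"
    using has_C1_gradient_bounded[OF f K] by blast
  obtain M where M: "\<And>x. \<bar>f x\<bar> \<le> M" using C1_compact_support_bounded[OF f K] by blast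
  have int: "integrable lborel (\<lambda>x. F x * f (x - t *\<^sub>R e))" for t
    by (rule integrable_mult_bounded_continuous[OF F _ M])
      (rule has_C1_gradient_continuous[OF has_C1_gradient_translate[OF f]])
  have [measurable]: "F \<in> borel_measurable borel" using F by simp
  have [measurable]: "f \<in> borel_measurable borel" "G \<in> borel_measurable borel"
    using has_C1_gradient_continuous[OF f] f borel_measurable_continuous_onI
    unfolding has_C1_gradient_def by blast+
  show ?thesis unfolding DERIV_def tendsto_at_iff_sequentially comp_def
  proof (intro allI impI)
    fix X :: "nat \<Rightarrow> real" assume X: "\<forall>i. X i \<in> UNIV - {0}" "X \<longlonglongrightarrow> 0"
    have "(\<lambda>i. \<integral>x. F x * ((f (x - (s + X i) *\<^sub>R e) - f (x - s *\<^sub>R e)) / X i) \<partial>lborel)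
        \<longlonglongrightarrow> (\<integral>x. - (F x * (G (x - s *\<^sub>R e) \<bullet> e)) \<partial>lborel)"
    proof (rule integral_dominated_convergence[where w="\<lambda>x. \<bar>F x\<bar> * (B * norm e)"])
      show "integrable lborel (\<lambda>x. \<bar>F x\<bar> * (B * norm e))" using F by simp
      show "AE x in lborel. (\<lambda>i. F x * ((f (x - (s + X i) *\<^sub>R e) - f (x - s *\<^sub>R e)) / X i))
              \<longlonglongrightarrow> - (F x * (G (x - s *\<^sub>R e) \<bullet> e))"
      proof (rule AE_I2)
        fix x
        have "((\<lambda>t. x - t *\<^sub>R e) has_derivative (\<lambda>h. - (h *\<^sub>R e))) (at s)"
          by (auto intro!: derivative_eq_intros)
        from has_derivative_compose[OF this, of f "\<lambda>h. G (x - s *\<^sub>R e) \<bullet> h"] f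
        have "((\<lambda>t. f (x - t *\<^sub>R e)) has_derivative (\<lambda>h. - (G (x - s *\<^sub>R e) \<bullet> e) * h)) (at s)"
          unfolding has_C1_gradient_def by (auto simp: mult.commute)
        then have "((\<lambda>t. f (x - t *\<^sub>R e)) has_real_derivative - (G (x - s *\<^sub>R e) \<bullet> e)) (at s)"
          unfolding has_field_derivative_def by (rule has_derivative_eq_rhs) auto
        then have "(\<lambda>i. (f (x - (s + X i) *\<^sub>R e) - f (x - s *\<^sub>R e)) / X i)
             \<longlonglongrightarrow> - (G (x - s *\<^sub>R e) \<bullet> e)"
          using X unfolding DERIV_def tendsto_at_iff_sequentially comp_def by blast
        from tendsto_mult_left[OF this, of "F x"]
        show "(\<lambda>i. F x * ((f (x - (s + X i) *\<^sub>R e) - f (x - s *\<^sub>R e)) / X i))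
              \<longlonglongrightarrow> - (F x * (G (x - s *\<^sub>R e) \<bullet> e))" by simp
      qed
      fix i
      show "AE x in lborel. norm (F x * ((f (x - (s + X i) *\<^sub>R e) - f (x - s *\<^sub>R e)) / X i))
          \<le> \<bar>F x\<bar> * (B * norm e)"
      proof (rule AE_I2)
        fix x
        have "\<bar>f (x - (s + X i) *\<^sub>R e) - f (x - s *\<^sub>R e)\<bar> \<le> B * norm (- (X i *\<^sub>R e))"
          using B(3)[of "x - (s + X i) *\<^sub>R e" "x - s *\<^sub>R e"] by (simp add: algebra_simps)
        then have "\<bar>(f (x - (s + X i) *\<^sub>R e) - f (x - s *\<^sub>R e)) / X i\<bar> \<le> B * norm e"
          using X(1) by (simp add: field_simps)
        then show "norm (F x * ((f (x - (s + X i) *\<^sub>R e) - f (x - s *\<^sub>R e)) / X i))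
          \<le> \<bar>F x\<bar> * (B * norm e)"
          unfolding real_norm_def abs_mult by (intro mult_left_mono) auto
      qed
    qed simp_all
    moreover have "((\<integral>x. F x * f (x - (s + X i) *\<^sub>R e) \<partial>lborel) - (\<integral>x. F x * f (x - s *\<^sub>R e) \<partial>lborel)) / X i
      = (\<integral>x. F x * ((f (x - (s + X i) *\<^sub>R e) - f (x - s *\<^sub>R e)) / X i) \<partial>lborel)" for i
    proof -
      have "(\<integral>x. F x * ((f (x - (s + X i) *\<^sub>R e) - f (x - s *\<^sub>R e)) / X i) \<partial>lborel)
        = (\<integral>x. (F x * f (x - (s + X i) *\<^sub>R e) - F x * f (x - s *\<^sub>R e)) / X i \<partial>lborel)"
        by (simp add: algebra_simps)
      also have "\<dots> = ((\<integral>x. F x * f (x - (s + X i) *\<^sub>R e) \<partial>lborel) - (\<integral>x. F x * f (x - s *\<^sub>R e) \<partial>lborel)) / X i"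
        using int by simp
      finally show ?thesis ..
    qed
    ultimately have "(\<lambda>i. ((\<integral>x. F x * f (x - (s + X i) *\<^sub>R e) \<partial>lborel) -
        (\<integral>x. F x * f (x - s *\<^sub>R e) \<partial>lborel)) / X i) \<longlonglongrightarrow>
       (\<integral>x. - (F x * (G (x - s *\<^sub>R e) \<bullet> e)) \<partial>lborel)"
      by (simp only:)
    then show "(\<lambda>i. ((\<integral>x. F x * f (x - (s + X i) *\<^sub>R e) \<partial>lborel) -
        (\<integral>x. F x * f (x - s *\<^sub>R e) \<partial>lborel)) / X i) \<longlonglongrightarrow>
       - (\<integral>x. F x * (G (x - s *\<^sub>R e) \<bullet> e) \<partial>lborel)" by simp
  qed
qed

text \<open>A finite bound on the variation, stated as a real inequality for a function on the whole
  space with Borel measure. This keeps extended reals and restricted measures out of the translation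
  arguments.\<close>

definition TV_bounded :: "('a::euclidean_space \<Rightarrow> real) \<Rightarrow> 'a set \<Rightarrow> real \<Rightarrow> bool" where
  "TV_bounded F A V \<longleftrightarrow>
     (\<forall>\<phi>\<in>test_fields A. (\<forall>x. norm (\<phi> x) \<le> 1) \<longrightarrow> (\<integral>x. F x * divergence \<phi> x \<partial>lborel) \<le> V)"

text \<open>The mean value theorem in \<open>s\<close>: up to sign, the derivative of the integral
  of \<open>F x * f (x - s *\<^sub>R e)\<close> is \<open>norm e\<close> times the integral of
  \<open>F\<close> against the divergence of \<open>f (x - s *\<^sub>R e)\<close> times a unit
  vector. The condition \<open>r + norm e \<le> R\<close> keeps the moved support inside the larger
  ball.\<close>

lemma TV_bounded_translate:
  fixes F :: "'a::euclidean_space \<Rightarrow> real"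
  assumes F: "integrable lborel F" and TV: "TV_bounded F (ball x0 R) V"
    and e: "r + norm e \<le> R"
    and f: "has_C1_gradient f G" and K: "compact K" "\<And>x. x \<notin> K \<Longrightarrow> f x = 0" "K \<subseteq> ball x0 r"
    and f1: "\<And>x. \<bar>f x\<bar> \<le> 1"
  shows "\<bar>(\<integral>x. F x * f (x - e) \<partial>lborel) - (\<integral>x. F x * f x \<partial>lborel)\<bar> \<le> norm e * V"
proof (cases "e = 0")
  case False
  let ?D = "\<lambda>s. (\<integral>x. F x * (G (x - s *\<^sub>R e) \<bullet> e) \<partial>lborel)"
  have "\<exists>z. 0 < z \<and> z < 1 \<and> (\<integral>x. F x * f (x - 1 *\<^sub>R e) \<partial>lborel) - (\<integral>x. F x * f (x - 0 *\<^sub>R e) \<partial>lborel)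
      = (1 - 0) * - ?D z"
    by (rule MVT2) (use translated_integral_has_derivative[OF F f K(1,2)] in auto)
  then obtain s where s: "0 < s" "s < 1"
     "(\<integral>x. F x * f (x - e) \<partial>lborel) - (\<integral>x. F x * f x \<partial>lborel) = - ?D s" by auto
  have fs: "has_C1_gradient (\<lambda>x. f (x - s *\<^sub>R e)) (\<lambda>x. G (x - s *\<^sub>R e))"
    by (rule has_C1_gradient_translate[OF f])
  define K' where "K' = (\<lambda>x. s *\<^sub>R e + x) ` K"
  have K': "compact K'" unfolding K'_def using K(1) by (rule compact_translation)
  have K'0: "f (x - s *\<^sub>R e) = 0" if "x \<notin> K'" for x
  proof (rule K(2), rule notI)
    assume "x - s *\<^sub>R e \<in> K"
    then have "s *\<^sub>R e + (x - s *\<^sub>R e) \<in> K'" unfolding K'_def by blast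
    then show False using that by simp
  qed
  have K'R: "K' \<subseteq> ball x0 R"
  proof
    fix y assume "y \<in> K'"
    then obtain x where x: "x \<in> K" "y = s *\<^sub>R e + x" unfolding K'_def by blast
    have "dist x0 y \<le> dist x0 x + dist x y" by (rule dist_triangle)
    also have "dist x y = s * norm e" using x s by (simp add: dist_norm)
    also have "\<dots> \<le> norm e" using s by (simp add: mult_left_le_one_le)
    finally show "y \<in> ball x0 R" using x(1) K(3) e by (force simp: subset_eq)
  qed
  have *: "(\<integral>x. F x * (G (x - s *\<^sub>R e) \<bullet> d) \<partial>lborel) \<le> V" if "norm d = 1" for d
  proof -
    have "(\<lambda>x. f (x - s *\<^sub>R e) *\<^sub>R d) \<in> test_fields (ball x0 R)"
      and dv: "\<And>x. divergence (\<lambda>x. f (x - s *\<^sub>R e) *\<^sub>R d) x = G (x - s *\<^sub>R e) \<bullet> d"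
      using test_field_direction[OF fs K' K'R K'0] by auto
    moreover have "\<forall>x. norm (f (x - s *\<^sub>R e) *\<^sub>R d) \<le> 1" using f1 that by simp
    ultimately show ?thesis using TV unfolding TV_bounded_def by (metis (no_types, lifting) Bochner_Integration.integral_cong)
  qed
  have "?D s = norm e * (\<integral>x. F x * (G (x - s *\<^sub>R e) \<bullet> (e /\<^sub>R norm e)) \<partial>lborel)"
    using False by (subst Bochner_Integration.integral_mult_right_zero[symmetric]) (simp add: field_simps)
  then have "?D s \<le> norm e * V"
    using *[of "e /\<^sub>R norm e"] False by (simp add: mult_left_mono)
  \<comment> \<open>\<open>TV_bounded\<close> bounds integrals only from above, so the opposite unit
    vector supplies the other sign.\<close>
  moreover have "- ?D s = norm e * (\<integral>x. F x * (G (x - s *\<^sub>R e) \<bullet> (- (e /\<^sub>R norm e))) \<partial>lborel)"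
    using False by (subst Bochner_Integration.integral_mult_right_zero[symmetric])
       (simp add: field_simps flip: Bochner_Integration.integral_minus)
  then have "- ?D s \<le> norm e * V"
    using mult_left_mono[OF *[of "- (e /\<^sub>R norm e)"] norm_ge_zero[of e]] False by simp
  ultimately show ?thesis using s(3) by linarith
qed simp

lemma lborel_integral_translate:
  fixes g :: "'a::euclidean_space \<Rightarrow> real"
  assumes "g \<in> borel_measurable borel"
  shows "(\<integral>x. g (x + e) \<partial>lborel) = (\<integral>x. g x \<partial>lborel)"
proof -
  have "(\<integral>x. g x \<partial>lborel) = (\<integral>x. g x \<partial>distr lborel borel ((+) e))"
    by (simp add: lborel_distr_plus)
  also have "\<dots> = (\<integral>x. g (e + x) \<partial>lborel)"
    by (rule integral_distr) (use assms in auto)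
  finally show ?thesis by (simp add: add.commute)
qed

lemma integrable_lborel_translate:
  fixes g :: "'a::euclidean_space \<Rightarrow> real"
  assumes "integrable lborel g"
  shows "integrable lborel (\<lambda>x. g (x + e))"
proof -
  have "integrable (distr lborel borel ((+) e)) g" by (simp add: lborel_distr_plus assms)
  then have "integrable lborel (\<lambda>x. g (e + x))"
    by (subst (asm) integrable_distr_eq) (use assms in auto)
  then show ?thesis by (simp add: add.commute)
qed

lemma real_polynomial_function_norm_square:
  "real_polynomial_function (\<lambda>x::'a::euclidean_space. (norm (x - x0))\<^sup>2)"
proof -
  have "(norm (x - x0))\<^sup>2 = (\<Sum>b\<in>Basis. (x \<bullet> b + - (x0 \<bullet> b))\<^sup>2)" for x
    by (subst power2_norm_eq_inner, subst euclidean_inner) (simp add: inner_diff_left power2_eq_square)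
  moreover have "real_polynomial_function (\<lambda>x. x \<bullet> b + - (x0 \<bullet> b))" for b
    by (rule real_polynomial_function.intros(3))
      (rule real_polynomial_function.intros(1)[OF bounded_linear_inner_left] real_polynomial_function.intros(2))+
  ultimately show ?thesis
    by (simp add: real_polynomial_function_sum real_polynomial_function_power)
qed

section \<open>Translates of functions of bounded variation\<close>

text \<open>Smooth functions \<open>\<psi>\<^sub>n\<close> with compact support in the ball and values in \<open>[-1, 1]\<close> that converge to
  the sign of \<open>D\<close>: if the polynomials \<open>p\<^sub>n\<close> converge to \<open>D\<close> almost everywhere, then
  \<open>arctan (n m\<^sub>n\<^sup>2 p\<^sub>n)\<close> converges to \<open>\<pi>/2 sgn D\<close>, where \<open>m\<^sub>n\<close> is a cutoff.\<close>

lemma L1_norm_ball_le_by_test_functions: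
  fixes D :: "'a::euclidean_space \<Rightarrow> real"
  assumes D: "integrable lborel D" and r: "0 < r"
    and le: "\<And>f G K. has_C1_gradient f G \<Longrightarrow> compact K \<Longrightarrow> K \<subseteq> ball x0 r \<Longrightarrow> (\<And>x. x \<notin> K \<Longrightarrow> f x = 0) \<Longrightarrow>
       (\<And>x. \<bar>f x\<bar> \<le> 1) \<Longrightarrow> (\<integral>x. D x * f x \<partial>lborel) \<le> c"
  shows "(\<integral>x. indicator (ball x0 r) x * \<bar>D x\<bar> \<partial>lborel) \<le> c"
proof -
  have Dm[measurable]: "D \<in> borel_measurable borel" using D by simp
  have "D \<in> borel_measurable lebesgue" by (simp add: measurable_completion)
  then have "D measurable_on UNIV" by (rule lebesgue_measurable_imp_measurable_on) simp
  then obtain Z g where Z: "negligible Z" and g: "\<And>n. continuous_on UNIV (g n)"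
    and gD: "\<And>x. x \<notin> Z \<Longrightarrow> (\<lambda>n. g n x) \<longlonglongrightarrow> D x"
    unfolding measurable_on_def by auto
  \<comment> \<open>Polynomials give C1 functions without mollification. An error below
    \<open>1 / Suc n\<close> on the closed ball preserves the pointwise limit there.\<close>
  have "\<exists>p. real_polynomial_function p \<and> (\<forall>x\<in>cball x0 r. \<bar>g n x - p x\<bar> < 1 / Suc n)" for n
    by (rule Stone_Weierstrass_real_polynomial_function[of "cball x0 r" "g n" "1 / Suc n"])
      (use g[of n] in \<open>auto intro: continuous_on_subset\<close>)
  then obtain p where p: "\<And>n. real_polynomial_function (p n)"
    and pg: "\<And>n x. x \<in> cball x0 r \<Longrightarrow> \<bar>g n x - p n x\<bar> < 1 / Suc n" by metis
  \<comment> \<open>Radii strictly below \<open>r\<close> that increase to \<open>r\<close>: each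
    support is a closed ball inside the open ball, yet every point of the open ball is eventually
    covered.\<close>
  define \<rho> where "\<rho> n = r * (1 - 1 / real (n + 2))" for n
  define m where "m n x = (\<rho> n)\<^sup>2 - (norm (x - x0))\<^sup>2" for n x
  \<comment> \<open>The squared positive part is C1 and eventually positive at each point of the
    open ball, and the factor \<open>n\<close> drives the argument of arctan to plus or minus
    infinity wherever \<open>D\<close> is nonzero. Points with \<open>D x = 0\<close> contribute
    nothing to the integral.\<close>
  define a where "a n x = real n * ((max 0 (m n x))\<^sup>2 * p n x)" for n x
  define \<psi> where "\<psi> n x = 2 / pi * arctan (a n x)" for n x
  have \<rho>: "0 \<le> \<rho> n" "\<rho> n < r" for n
    unfolding \<rho>_def using r by (auto simp: field_simps)
  have lim\<rho>: "\<rho> \<longlonglongrightarrow> r"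
    unfolding \<rho>_def by real_asymp
  have "\<exists>G. has_C1_gradient (\<psi> n) G" for n
  proof -
    have "real_polynomial_function (m n)"
      unfolding m_def by (intro real_polynomial_function_diff real_polynomial_function.intros(2)
          real_polynomial_function_norm_square)
    then obtain M where "has_C1_gradient (m n) M" using has_C1_gradient_polynomial by blast
    then have 1: "has_C1_gradient (\<lambda>x. (max 0 (m n x))\<^sup>2) (\<lambda>x. (2 * max 0 (m n x)) *\<^sub>R M x)"
      by (rule has_C1_gradient_compose[OF _ has_derivative_max0_square]) (auto intro!: continuous_intros)
    obtain P where "has_C1_gradient (p n) P" using has_C1_gradient_polynomial[OF p] by metis
    note Q = has_C1_gradient_mult[OF 1 this]
    have S: "((\<lambda>y. 2 / pi * arctan (real n * y)) has_real_derivative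
       (2 / pi * (inverse (1 + (real n * y)\<^sup>2) * real n))) (at y)" for y
      by (auto intro!: derivative_eq_intros)
    have "1 + (real n * y)\<^sup>2 \<noteq> 0" for y
      using zero_le_power2[of "real n * y"] by linarith
    then have "continuous_on UNIV (\<lambda>y. 2 / pi * (inverse (1 + (real n * y)\<^sup>2) * real n))"
      by (auto intro!: continuous_intros)
    from has_C1_gradient_compose[OF Q S this]
    have G: "has_C1_gradient (\<psi> n) (\<lambda>x. (2 / pi * (inverse (1 + (real n * ((max 0 (m n x))\<^sup>2 * p n x))\<^sup>2) * real n)) *\<^sub>R
       ((max 0 (m n x))\<^sup>2 *\<^sub>R P x + p n x *\<^sub>R (2 * max 0 (m n x)) *\<^sub>R M x))"
      by (simp only: \<psi>_def[abs_def] a_def)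
    show ?thesis by (rule exI) (rule G)
  qed
  then obtain \<Gamma> where "\<forall>n. has_C1_gradient (\<psi> n) (\<Gamma> n)"
    using choice[of "\<lambda>n G. has_C1_gradient (\<psi> n) G"] by blast
  then have \<Gamma>: "has_C1_gradient (\<psi> n) (\<Gamma> n)" for n by blast
  have \<psi>0: "\<psi> n x = 0" if "x \<notin> cball x0 (\<rho> n)" for n x
  proof -
    have "\<rho> n < norm (x - x0)" using that by (simp add: dist_norm norm_minus_commute)
    then have "m n x \<le> 0" unfolding m_def using \<rho>(1)[of n] by (simp add: power_mono)
    then show ?thesis unfolding \<psi>_def a_def by simp
  qed
  have \<psi>1: "\<bar>\<psi> n x\<bar> \<le> 1" for n x
  proof -
    have "\<bar>arctan (a n x)\<bar> \<le> pi / 2"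
      using arctan_bounded[of "a n x"] by (auto simp: abs_le_iff intro: less_imp_le)
    then show ?thesis unfolding \<psi>_def abs_mult by (simp add: field_simps)
  qed
  have le\<psi>: "(\<integral>x. D x * \<psi> n x \<partial>lborel) \<le> c" for n
    by (rule le[OF \<Gamma> compact_cball _ \<psi>0 \<psi>1]) (auto intro: le_less_trans[OF _ \<rho>(2)])
  have "(\<lambda>n. \<integral>x. D x * \<psi> n x \<partial>lborel) \<longlonglongrightarrow> (\<integral>x. indicator (ball x0 r) x * \<bar>D x\<bar> \<partial>lborel)"
  proof (rule integral_dominated_convergence[where w="\<lambda>x. \<bar>D x\<bar>"])
    show "integrable lborel (\<lambda>x. \<bar>D x\<bar>)" using D by simp
    show "(\<lambda>x. D x * \<psi> n x) \<in> borel_measurable lborel" for n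
      using borel_measurable_continuous_onI[OF has_C1_gradient_continuous[OF \<Gamma>[of n]]] by simp
    show "AE x in lborel. norm (D x * \<psi> n x) \<le> \<bar>D x\<bar>" for n
      using \<psi>1[of n] by (intro AE_I2) (simp add: abs_mult mult_left_le)
    have "Z \<in> null_sets lebesgue" using Z negligible_iff_null_sets by blast
    then have "AE x in lebesgue. x \<notin> Z" by (rule AE_not_in)
    then have "AE x in lborel. x \<notin> Z" by (simp add: AE_completion_iff)
    then show "AE x in lborel. (\<lambda>n. D x * \<psi> n x) \<longlonglongrightarrow> indicator (ball x0 r) x * \<bar>D x\<bar>"
    proof eventually_elim
      fix x assume "x \<notin> Z"
      show "(\<lambda>n. D x * \<psi> n x) \<longlonglongrightarrow> indicator (ball x0 r) x * \<bar>D x\<bar>"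
      proof (cases "x \<in> ball x0 r")
        case False
        then have "\<psi> n x = 0" for n using \<rho>(2)[of n] by (intro \<psi>0) auto
        then show ?thesis using False by simp
      next
        case True
        have mlim: "(\<lambda>n. (max 0 (m n x))\<^sup>2) \<longlonglongrightarrow> (max 0 (r\<^sup>2 - (norm (x - x0))\<^sup>2))\<^sup>2"
          unfolding m_def by (intro tendsto_intros lim\<rho>)
        have mpos: "(max 0 (r\<^sup>2 - (norm (x - x0))\<^sup>2))\<^sup>2 > 0"
          using power_strict_mono[of "norm (x - x0)" r 2] True
          by (simp add: dist_norm norm_minus_commute)
        have "(\<lambda>n. g n x - p n x) \<longlonglongrightarrow> 0"
        proof (rule Lim_null_comparison)
          have "\<bar>g n x - p n x\<bar> \<le> 1 / real (Suc n)" for n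
            using pg[of x n] True by simp
          then show "\<forall>\<^sub>F n in sequentially. norm (g n x - p n x) \<le> 1 / real (Suc n)"
            by (simp only: real_norm_def eventually_True)
          show "(\<lambda>n. 1 / real (Suc n)) \<longlonglongrightarrow> 0" by real_asymp
        qed
        from tendsto_diff[OF gD[OF \<open>x \<notin> Z\<close>] this]
        have plim: "(\<lambda>n. p n x) \<longlonglongrightarrow> D x" by simp
        have prod: "(\<lambda>n. (max 0 (m n x))\<^sup>2 * p n x) \<longlonglongrightarrow> (max 0 (r\<^sup>2 - (norm (x - x0))\<^sup>2))\<^sup>2 * D x"
          by (intro tendsto_intros mlim plim)
        consider "D x = 0" | "D x > 0" | "D x < 0" by linarith
        then show ?thesis
        proof cases
          case 2
          have "(max 0 (r\<^sup>2 - (norm (x - x0))\<^sup>2))\<^sup>2 * D x > 0"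
            by (rule mult_pos_pos[OF mpos 2])
          from filterlim_tendsto_pos_mult_at_top[OF prod this filterlim_real_sequentially]
          have "filterlim (\<lambda>n. a n x) at_top sequentially"
            by (simp only: a_def mult.commute)
          then have "(\<lambda>n. arctan (a n x)) \<longlonglongrightarrow> (pi / 2)"
            by (rule filterlim_compose[OF tendsto_arctan_at_top])
          from tendsto_mult_left[OF this, of "D x * (2 / pi)"]
          have "(\<lambda>n. D x * \<psi> n x) \<longlonglongrightarrow> D x * (2 / pi) * (pi / 2)"
            by (simp only: \<psi>_def mult.assoc)
          moreover have "D x * (2 / pi) * (pi / 2) = indicator (ball x0 r) x * \<bar>D x\<bar>"
            using 2 True by simp
          ultimately show ?thesis by (simp only:)
        next
          case 3
          have "(max 0 (r\<^sup>2 - (norm (x - x0))\<^sup>2))\<^sup>2 * D x < 0"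
            by (rule mult_pos_neg[OF mpos 3])
          from filterlim_tendsto_neg_mult_at_bot[OF prod this filterlim_real_sequentially]
          have "filterlim (\<lambda>n. a n x) at_bot sequentially"
            by (simp only: a_def mult.commute)
          then have "(\<lambda>n. arctan (a n x)) \<longlonglongrightarrow> (- (pi / 2))"
            by (rule filterlim_compose[OF tendsto_arctan_at_bot])
          from tendsto_mult_left[OF this, of "D x * (2 / pi)"]
          have "(\<lambda>n. D x * \<psi> n x) \<longlonglongrightarrow> D x * (2 / pi) * (- (pi / 2))"
            by (simp only: \<psi>_def mult.assoc)
          moreover have "D x * (2 / pi) * (- (pi / 2)) = indicator (ball x0 r) x * \<bar>D x\<bar>"
            using 3 True by simp
          ultimately show ?thesis by (simp only:)
        qed simp
      qed
    qed
  qed (intro borel_measurable_times borel_measurable_indicator borel_measurable_abs; simp add: Dm)+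
  then show ?thesis by (rule LIMSEQ_le_const2) (intro exI allI impI le\<psi>)
qed

text \<open>The L1 norm on the ball is reached by pairing with test functions bounded by 1, and a
  change of variables moves the translation from \<open>F\<close> to the test function.\<close>

lemma TV_bounded_translate_L1:
  fixes F :: "'a::euclidean_space \<Rightarrow> real"
  assumes F: "integrable lborel F" and TV: "TV_bounded F (ball x0 R) V"
    and r: "0 < r" and e: "r + norm e \<le> R"
  shows "(\<integral>\<^sup>+x. indicator (ball x0 r) x * ennreal \<bar>F (x + e) - F x\<bar> \<partial>lborel) \<le> ennreal (norm e * V)"
proof -
  define D where "D x = F (x + e) - F x" for x
  have D: "integrable lborel D" unfolding D_def
    using F integrable_lborel_translate[OF F] by simp
  have [measurable]: "F \<in> borel_measurable borel" "D \<in> borel_measurable borel" using F D by simp_all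
  have "(\<integral>x. indicator (ball x0 r) x * \<bar>D x\<bar> \<partial>lborel) \<le> norm e * V"
  proof (rule L1_norm_ball_le_by_test_functions[OF D r])
    fix f :: "'a \<Rightarrow> real" and G K
    assume f: "has_C1_gradient f G" and K: "compact K" "K \<subseteq> ball x0 r" "\<And>x. x \<notin> K \<Longrightarrow> f x = 0"
      and f1: "\<And>x. \<bar>f x\<bar> \<le> 1"
    have [measurable]: "f \<in> borel_measurable borel"
      by (rule borel_measurable_continuous_onI[OF has_C1_gradient_continuous[OF f]])
    have i1: "integrable lborel (\<lambda>x. F x * f (x - e))" "integrable lborel (\<lambda>x. F x * f x)"
      "integrable lborel (\<lambda>x. F (x + e) * f x)"
      by (rule integrable_mult_bounded_continuous[where M=1],
          rule F integrable_lborel_translate[OF F],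
          rule has_C1_gradient_continuous[OF f] has_C1_gradient_continuous[OF has_C1_gradient_translate[OF f]],
          rule f1)+
    have "(\<integral>x. D x * f x \<partial>lborel) = (\<integral>x. F (x + e) * f x \<partial>lborel) - (\<integral>x. F x * f x \<partial>lborel)"
      unfolding D_def using i1 by (simp add: left_diff_distrib)
    also have "(\<integral>x. F (x + e) * f x \<partial>lborel) = (\<integral>x. F x * f (x - e) \<partial>lborel)"
      using lborel_integral_translate[of "\<lambda>x. F x * f (x - e)" e] by simp
    also have "\<dots> - (\<integral>x. F x * f x \<partial>lborel) \<le> norm e * V"
      using TV_bounded_translate[OF F TV e f K(1) K(3) K(2) f1] by (rule order_trans[OF abs_ge_self])
    finally show "(\<integral>x. D x * f x \<partial>lborel) \<le> norm e * V" .
  qed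
  then have "ennreal (\<integral>x. indicator (ball x0 r) x * \<bar>D x\<bar> \<partial>lborel) \<le> ennreal (norm e * V)"
    by (rule ennreal_leI)
  moreover have "(\<integral>\<^sup>+x. ennreal (indicator (ball x0 r) x * \<bar>D x\<bar>) \<partial>lborel)
      = ennreal (\<integral>x. indicator (ball x0 r) x * \<bar>D x\<bar> \<partial>lborel)"
    using integrable_real_mult_indicator[of "ball x0 r" lborel "\<lambda>x. \<bar>D x\<bar>"] D
    by (intro nn_integral_eq_integral) (auto simp: mult.commute)
  moreover have "(\<integral>\<^sup>+x. indicator (ball x0 r) x * ennreal \<bar>F (x + e) - F x\<bar> \<partial>lborel)
      = (\<integral>\<^sup>+x. ennreal (indicator (ball x0 r) x * \<bar>D x\<bar>) \<partial>lborel)"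
    unfolding D_def by (intro nn_integral_cong) (simp split: split_indicator)
  ultimately show ?thesis by (simp only:)
qed

section \<open>Averages over translations: superlevel sets and the Poincare inequality\<close>

lemma nn_integral_lborel_translate:
  fixes g :: "'a::euclidean_space \<Rightarrow> ennreal"
  assumes "g \<in> borel_measurable borel"
  shows "(\<integral>\<^sup>+x. g (e + x) \<partial>lborel) = (\<integral>\<^sup>+x. g x \<partial>lborel)"
proof -
  have "(\<integral>\<^sup>+x. g x \<partial>lborel) = (\<integral>\<^sup>+x. g x \<partial>distr lborel borel ((+) e))"
    by (simp add: lborel_distr_plus)
  also have "\<dots> = (\<integral>\<^sup>+x. g (e + x) \<partial>lborel)"
    by (rule nn_integral_distr) (use assms in auto)
  finally show ?thesis by simp
qed

text \<open>Fubini: for fixed \<open>h\<close> the integral over \<open>x\<close> is at most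
  \<open>norm h * V \<le> p * V\<close>, and the vectors \<open>h\<close> fill a ball of radius
  \<open>p\<close>.\<close>

lemma TV_bounded_average:
  fixes F :: "'a::euclidean_space \<Rightarrow> real"
  assumes F: "integrable lborel F" and TV: "TV_bounded F (ball x0 R) V" and V: "0 \<le> V"
    and r: "0 < r" and p: "0 < p" and rp: "r + p \<le> R"
  shows "(\<integral>\<^sup>+x. indicator (ball x0 r) x *
            (\<integral>\<^sup>+h. indicator (ball 0 p) h * ennreal \<bar>F (x + h) - F x\<bar> \<partial>lborel) \<partial>lborel)
          \<le> ennreal (unit_ball_vol (real DIM('a)) * p ^ DIM('a) * (p * V))"
proof -
  have [measurable]: "F \<in> borel_measurable borel" using F by simp
  have [measurable]: "ball c s \<in> sets borel" for c :: 'a and s by simp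
  have "(\<integral>\<^sup>+x. indicator (ball x0 r) x *
            (\<integral>\<^sup>+h. indicator (ball 0 p) h * ennreal \<bar>F (x + h) - F x\<bar> \<partial>lborel) \<partial>lborel)
      = (\<integral>\<^sup>+x. (\<integral>\<^sup>+h. indicator (ball x0 r) x * (indicator (ball 0 p) h * ennreal \<bar>F (x + h) - F x\<bar>) \<partial>lborel) \<partial>lborel)"
    by (intro nn_integral_cong nn_integral_cmult[symmetric]) measurable
  also have "\<dots> = (\<integral>\<^sup>+h. (\<integral>\<^sup>+x. indicator (ball x0 r) x * (indicator (ball 0 p) h * ennreal \<bar>F (x + h) - F x\<bar>) \<partial>lborel) \<partial>lborel)"
    by (intro lborel_pair.Fubini') measurable
  also have "\<dots> \<le> (\<integral>\<^sup>+h. ennreal (p * V) * indicator (ball (0::'a) p) h \<partial>lborel)"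
  proof (rule nn_integral_mono)
    fix h :: 'a
    show "(\<integral>\<^sup>+x. indicator (ball x0 r) x * (indicator (ball 0 p) h * ennreal \<bar>F (x + h) - F x\<bar>) \<partial>lborel)
        \<le> ennreal (p * V) * indicator (ball 0 p) h"
    proof (cases "h \<in> ball 0 p")
      case True
      then have h: "norm h < p" by simp
      have "(\<integral>\<^sup>+x. indicator (ball x0 r) x * ennreal \<bar>F (x + h) - F x\<bar> \<partial>lborel) \<le> ennreal (norm h * V)"
        by (rule TV_bounded_translate_L1[OF F TV r]) (use h rp in linarith)
      also have "\<dots> \<le> ennreal (p * V)" using h V by (intro ennreal_leI mult_right_mono) auto
      finally show ?thesis using True by simp
    qed simp
  qed
  also have "\<dots> = ennreal (p * V) * emeasure lborel (ball (0::'a) p)"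
    by (subst nn_integral_cmult_indicator) auto
  also have "\<dots> = ennreal (unit_ball_vol (real DIM('a)) * p ^ DIM('a) * (p * V))"
    using p V by (subst emeasure_ball) (auto simp flip: ennreal_mult simp: mult.commute)
  finally show ?thesis .
qed

lemma ennreal_diff_le_of_le_add:
  assumes "ennreal A \<le> I + b" "b \<le> ennreal B" "0 \<le> B"
  shows "ennreal (A - B) \<le> I"
proof (cases I)
  case (real i)
  have "ennreal A \<le> ennreal (i + B)"
    using order_trans[OF assms(1) add_left_mono[OF assms(2)]] real assms(3) by (simp add: ennreal_plus)
  then have "A \<le> i + B \<or> A \<le> 0" using real assms(3) by (simp only: ennreal_le_iff2) auto
  then show ?thesis using real assms(3) by (auto simp: ennreal_le_iff2)
qed simp

text \<open>An isoperimetric gain: if \<open>\<lambda>\<close> is large compared with the mean of \<open>F\<close> over balls of radius \<open>p\<close>,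
  then \<open>F\<close> differs by order \<open>\<lambda>\<close> from its translates by vectors of length at most \<open>p\<close>, on average,
  wherever \<open>F > \<lambda>\<close>. This replaces the Sobolev embedding of \<open>BV\<close>.\<close>

lemma TV_bounded_superlevel:
  fixes F :: "'a::euclidean_space \<Rightarrow> real"
  defines "\<kappa> \<equiv> unit_ball_vol (real DIM('a))"
  assumes F: "integrable lborel F" and TV: "TV_bounded F (ball x0 R) V" and V: "0 \<le> V"
    and r: "0 < r" and p: "0 < p" and rp: "r + p \<le> R" and l: "0 < l"
    and F0: "\<And>x. 0 \<le> F x"
    and small: "(\<integral>\<^sup>+x. indicator (ball x0 R) x * ennreal ((F x)\<^sup>2) \<partial>lborel) \<le> ennreal (l\<^sup>2 * \<kappa> * p ^ DIM('a) / 2)"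
  shows "ennreal (l / 4) * emeasure lborel {x \<in> ball x0 r. l < F x} \<le> ennreal (p * V)"
proof -
  have [measurable]: "F \<in> borel_measurable borel" using F by simp
  have [measurable]: "ball c s \<in> sets borel" for c :: 'a and s by simp
  have \<kappa>: "0 < \<kappa>" unfolding \<kappa>_def by simp
  define P where "P = \<kappa> * p ^ DIM('a)"
  have P: "0 < P" unfolding P_def using \<kappa> p by simp
  have emP: "emeasure lborel (ball (0::'a) p) = ennreal P"
    unfolding P_def \<kappa>_def using p by (simp add: emeasure_ball)
  define I where "I x = (\<integral>\<^sup>+h. indicator (ball 0 p) h * ennreal \<bar>F (x + h) - F x\<bar> \<partial>lborel)" for x
  have I: "ennreal (l / 4 * P) \<le> I x" if x: "x \<in> ball x0 r" "l < F x" for x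
  proof -
    have "ennreal (3 * l / 4 * P) = (\<integral>\<^sup>+h. ennreal (3 * l / 4) * indicator (ball (0::'a) p) h \<partial>lborel)"
      using l P by (subst nn_integral_cmult_indicator) (auto simp: emP simp flip: ennreal_mult)
    also have "\<dots> \<le> (\<integral>\<^sup>+h. indicator (ball 0 p) h * ennreal \<bar>F (x + h) - F x\<bar> +
          indicator (ball 0 p) h * ennreal ((F (x + h))\<^sup>2 / l) \<partial>lborel)"
    proof (rule nn_integral_mono)
      fix h
      \<comment> \<open>Completing the square bounds \<open>F (x + h)\<close> by its square over
        \<open>l\<close> plus \<open>l / 4\<close>, so \<open>F x > l\<close> forces either a
        difference of order \<open>l\<close> or a large square. The square is what the energy
        inequality controls.\<close>
      have "0 \<le> (F (x + h) - l / 2)\<^sup>2 / l" using l by simp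
      also have "\<dots> = (F (x + h))\<^sup>2 / l - F (x + h) + l / 4"
        using l by (simp add: power2_eq_square field_simps)
      finally have "3 * l / 4 \<le> \<bar>F (x + h) - F x\<bar> + (F (x + h))\<^sup>2 / l"
        using x(2) by linarith
      then have "ennreal (3 * l / 4) \<le> ennreal (\<bar>F (x + h) - F x\<bar> + (F (x + h))\<^sup>2 / l)"
        by (rule ennreal_leI)
      also have "\<dots> = ennreal \<bar>F (x + h) - F x\<bar> + ennreal ((F (x + h))\<^sup>2 / l)"
        by (rule ennreal_plus) (use l in auto)
      finally have "ennreal (3 * l / 4) \<le> ennreal \<bar>F (x + h) - F x\<bar> + ennreal ((F (x + h))\<^sup>2 / l)" .
      then show "ennreal (3 * l / 4) * indicator (ball 0 p) h \<le> indicator (ball 0 p) h * ennreal \<bar>F (x + h) - F x\<bar> +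
          indicator (ball 0 p) h * ennreal ((F (x + h))\<^sup>2 / l)"
        by (simp split: split_indicator)
    qed
    also have "\<dots> = I x + (\<integral>\<^sup>+h. indicator (ball 0 p) h * ennreal ((F (x + h))\<^sup>2 / l) \<partial>lborel)"
      unfolding I_def by (rule nn_integral_add) measurable
    finally have 1: "ennreal (3 * l / 4 * P) \<le> I x + (\<integral>\<^sup>+h. indicator (ball 0 p) h * ennreal ((F (x + h))\<^sup>2 / l) \<partial>lborel)" .
    \<comment> \<open>The squares account for at most \<open>l * P / 2\<close> by the hypothesis
      \<open>small\<close>, which leaves \<open>l / 4 * P\<close> out of
      \<open>3 * l / 4 * P\<close> for the differences.\<close>
    have "(\<integral>\<^sup>+h. indicator (ball 0 p) h * ennreal ((F (x + h))\<^sup>2 / l) \<partial>lborel)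
       \<le> (\<integral>\<^sup>+h. ennreal (1 / l) * (indicator (ball x0 R) (x + h) * ennreal ((F (x + h))\<^sup>2)) \<partial>lborel)"
    proof (rule nn_integral_mono)
      fix h
      have "x + h \<in> ball x0 R" if "h \<in> ball 0 p"
      proof -
        have "dist x0 (x + h) \<le> dist x0 x + dist x (x + h)" by (rule dist_triangle)
        then show ?thesis using that x(1) rp by (auto simp: dist_norm)
      qed
      then show "indicator (ball 0 p) h * ennreal ((F (x + h))\<^sup>2 / l) \<le> ennreal (1 / l) * (indicator (ball x0 R) (x + h) * ennreal ((F (x + h))\<^sup>2))"
        using l by (auto split: split_indicator simp flip: ennreal_mult)
    qed
    also have "\<dots> = (\<integral>\<^sup>+h. ennreal (1 / l) * (indicator (ball x0 R) h * ennreal ((F h)\<^sup>2)) \<partial>lborel)"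
      by (rule nn_integral_lborel_translate) measurable
    also have "\<dots> = ennreal (1 / l) * (\<integral>\<^sup>+h. (indicator (ball x0 R) h * ennreal ((F h)\<^sup>2)) \<partial>lborel)"
      by (rule nn_integral_cmult) measurable
    also have "\<dots> \<le> ennreal (1 / l) * ennreal (l\<^sup>2 * \<kappa> * p ^ DIM('a) / 2)"
      by (rule mult_left_mono[OF small]) simp
    also have "\<dots> = ennreal (l * P / 2)"
      unfolding P_def using l by (subst ennreal_mult'[symmetric]) (auto simp: power2_eq_square)
    finally have "ennreal (3 * l / 4 * P - l * P / 2) \<le> I x"
      by (rule ennreal_diff_le_of_le_add[OF 1]) (use l P in simp)
    then show ?thesis by (simp add: algebra_simps)
  qed
  define S where "S = {x \<in> ball x0 r. l < F x}"
  have S[measurable]: "S \<in> sets borel" unfolding S_def by measurable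
  have "ennreal (l / 4 * P) * emeasure lborel S = (\<integral>\<^sup>+x. ennreal (l / 4 * P) * indicator S x \<partial>lborel)"
    by (subst nn_integral_cmult_indicator) auto
  also have "\<dots> \<le> (\<integral>\<^sup>+x. indicator (ball x0 r) x * I x \<partial>lborel)"
    by (rule nn_integral_mono) (use I in \<open>auto simp: S_def split: split_indicator\<close>)
  also have "\<dots> \<le> ennreal (P * (p * V))"
    unfolding I_def P_def \<kappa>_def by (rule TV_bounded_average[OF F TV V r p rp])
  finally have *: "ennreal (l / 4 * P) * emeasure lborel S \<le> ennreal (P * (p * V))" .
  then show ?thesis
  proof (cases "emeasure lborel S")
    case (real s)
    have "ennreal (l / 4 * P * s) = ennreal (l / 4 * P) * ennreal s"
      by (rule ennreal_mult) (use real l P in auto)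
    also have "\<dots> \<le> ennreal (P * (p * V))" using * real by (simp only:)
    finally have "l / 4 * P * s \<le> P * (p * V)" using P p V by (subst (asm) ennreal_le_iff) auto
    then have "P * (l / 4 * s) \<le> P * (p * V)" by (simp only: mult_ac)
    then have "l / 4 * s \<le> p * V" using P by (rule mult_left_le_imp_le)
    then have "ennreal (l / 4 * s) \<le> ennreal (p * V)" by (rule ennreal_leI)
    also have "ennreal (l / 4 * s) = ennreal (l / 4) * emeasure lborel S"
      unfolding real by (rule ennreal_mult) (use real l in auto)
    finally show ?thesis unfolding S_def .
  next
    case top
    have "ennreal (l / 4 * P) * emeasure lborel S = top"
      unfolding top ennreal_mult_eq_top_iff using l P by simp
    then show ?thesis using * by (simp add: top_unique)
  qed
qed

text \<open>The comparison value is that of \<open>F\<close> at a good point instead of the mean. If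
  no admissible point were good, integrating over \<open>x\<close> would violate the averaged
  translation bound with \<open>p = 2 * \<rho>\<close>; the constant is twice what that bound gives,
  so the contradiction is strict. The predicate \<open>Q\<close> lets the point avoid a null
  set.\<close>

lemma TV_bounded_Poincare:
  fixes F :: "'a::euclidean_space \<Rightarrow> real"
  assumes F: "integrable lborel F" and TV: "TV_bounded F (ball x0 (4 * \<rho>)) V" and V: "0 < V"
    and \<rho>: "0 < \<rho>" and Q: "AE x in lborel. x \<in> ball x0 \<rho> \<longrightarrow> Q x"
  shows "\<exists>x\<in>ball x0 \<rho>. Q x \<and>
    (\<integral>\<^sup>+y. indicator (ball x0 \<rho>) y * ennreal \<bar>F y - F x\<bar> \<partial>lborel) \<le> ennreal (2 ^ (DIM('a) + 2) * \<rho> * V)"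
proof (rule ccontr)
  assume neg: "\<not> ?thesis"
  have [measurable]: "F \<in> borel_measurable borel" using F by simp
  have [measurable]: "ball c s \<in> sets borel" for c :: 'a and s by simp
  define \<kappa> where "\<kappa> = unit_ball_vol (real DIM('a))"
  have \<kappa>: "0 < \<kappa>" unfolding \<kappa>_def by simp
  define c where "c = 2 ^ (DIM('a) + 2) * \<rho> * V"
  have c: "0 < c" unfolding c_def using \<rho> V by simp
  have "ennreal (c * (\<kappa> * \<rho> ^ DIM('a))) = (\<integral>\<^sup>+x. ennreal c * indicator (ball x0 \<rho>) x \<partial>lborel)"
    using \<rho> c \<kappa> by (subst nn_integral_cmult_indicator) (auto simp: emeasure_ball ennreal_mult \<kappa>_def)
  also have "\<dots> \<le> (\<integral>\<^sup>+x. indicator (ball x0 \<rho>) x *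
            (\<integral>\<^sup>+h. indicator (ball 0 (2 * \<rho>)) h * ennreal \<bar>F (x + h) - F x\<bar> \<partial>lborel) \<partial>lborel)"
  proof (rule nn_integral_mono_AE)
    show "AE x in lborel. ennreal c * indicator (ball x0 \<rho>) x \<le> indicator (ball x0 \<rho>) x *
            (\<integral>\<^sup>+h. indicator (ball 0 (2 * \<rho>)) h * ennreal \<bar>F (x + h) - F x\<bar> \<partial>lborel)"
      using Q
    proof eventually_elim
      fix x assume Qx: "x \<in> ball x0 \<rho> \<longrightarrow> Q x"
      show "ennreal c * indicator (ball x0 \<rho>) x \<le> indicator (ball x0 \<rho>) x *
            (\<integral>\<^sup>+h. indicator (ball 0 (2 * \<rho>)) h * ennreal \<bar>F (x + h) - F x\<bar> \<partial>lborel)"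
      proof (cases "x \<in> ball x0 \<rho>")
        case True
        then have "ennreal c \<le> (\<integral>\<^sup>+y. indicator (ball x0 \<rho>) y * ennreal \<bar>F y - F x\<bar> \<partial>lborel)"
          using neg Qx unfolding c_def by (auto simp: not_le intro: less_imp_le)
        also have "\<dots> = (\<integral>\<^sup>+h. indicator (ball x0 \<rho>) (x + h) * ennreal \<bar>F (x + h) - F x\<bar> \<partial>lborel)"
          by (rule nn_integral_lborel_translate[symmetric]) measurable
        also have "\<dots> \<le> (\<integral>\<^sup>+h. indicator (ball 0 (2 * \<rho>)) h * ennreal \<bar>F (x + h) - F x\<bar> \<partial>lborel)"
        proof (rule nn_integral_mono)
          fix h
          have "h \<in> ball 0 (2 * \<rho>)" if "x + h \<in> ball x0 \<rho>"
          proof -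
            have "dist x (x + h) \<le> dist x x0 + dist x0 (x + h)" by (rule dist_triangle)
            then show ?thesis using that True by (simp add: dist_norm norm_minus_commute)
          qed
          then show "indicator (ball x0 \<rho>) (x + h) * ennreal \<bar>F (x + h) - F x\<bar>
             \<le> indicator (ball 0 (2 * \<rho>)) h * ennreal \<bar>F (x + h) - F x\<bar>"
            by (auto split: split_indicator)
        qed
        finally show ?thesis using True by simp
      qed simp
    qed
  qed
  also have "\<dots> \<le> ennreal (\<kappa> * (2 * \<rho>) ^ DIM('a) * (2 * \<rho> * V))"
    unfolding \<kappa>_def by (rule TV_bounded_average[OF F TV]) (use V \<rho> in auto)
  finally have "c * (\<kappa> * \<rho> ^ DIM('a)) \<le> \<kappa> * (2 * \<rho>) ^ DIM('a) * (2 * \<rho> * V)"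
    using \<kappa> \<rho> V by (simp add: ennreal_le_iff)
  also have "\<dots> = (c * (\<kappa> * \<rho> ^ DIM('a))) / 2"
    unfolding c_def by (simp add: power_mult_distrib)
  finally show False using c \<kappa> \<rho> by (simp add: field_simps)
qed

section \<open>From Borel functions on the whole space to Lebesgue measurable functions on a
  ball\<close>

lemma lebesgue_measurable_extend_zero:
  fixes f :: "'a::euclidean_space \<Rightarrow> real"
  assumes "A \<in> sets borel" and "f \<in> borel_measurable (lebesgue_on A)"
  shows "(\<lambda>x. if x \<in> A then f x else 0) \<in> borel_measurable lebesgue"
  by (rule borel_measurable_if_I[OF assms(2)]) (use assms(1) in simp)

lemma lebesgue_on_borel_representative:
  fixes f :: "'a::euclidean_space \<Rightarrow> real"
  assumes A: "A \<in> sets borel" and f: "f \<in> borel_measurable (lebesgue_on A)"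
  obtains F where "F \<in> borel_measurable borel" "AE x in lborel. F x = indicator A x * f x"
proof -
  have "(\<lambda>x. if x \<in> A then f x else 0) \<in> borel_measurable lebesgue"
    by (rule lebesgue_measurable_extend_zero[OF A f])
  from completion_ex_borel_measurable_real[OF this] obtain F where
    F: "F \<in> borel_measurable lborel" "AE x in lborel. (if x \<in> A then f x else 0) = F x" ..
  have F': "AE x in lborel. F x = indicator A x * f x"
    using F(2) by eventually_elim (simp split: split_indicator if_splits)
  show thesis by (rule that[OF _ F']) (use F(1) in simp)
qed

lemma test_field_divergence:
  assumes \<phi>: "\<phi> \<in> test_fields A"
  obtains K where "compact K" "K \<subseteq> A" "\<And>x. x \<notin> K \<Longrightarrow> \<phi> x = 0" "\<And>x. x \<notin> K \<Longrightarrow> divergence \<phi> x = 0"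
    "continuous_on UNIV (divergence \<phi>)"
proof -
  obtain K where K: "compact K" "K \<subseteq> A" "\<And>x. x \<notin> K \<Longrightarrow> \<phi> x = 0"
    and d: "\<And>x. \<phi> differentiable (at x)"
    and c: "\<And>b. b \<in> Basis \<Longrightarrow> continuous_on UNIV (\<lambda>x. frechet_derivative \<phi> (at x) b)"
    using \<phi> unfolding test_fields_def by auto
  have "divergence \<phi> x = 0" if x: "x \<notin> K" for x
  proof -
    have "(\<phi> has_derivative frechet_derivative \<phi> (at x)) (at x)"
      using d frechet_derivative_works by metis
    then have "((\<lambda>x. 0) has_derivative frechet_derivative \<phi> (at x)) (at x)"
      by (rule has_derivative_transform_within_open[of \<phi> _ x UNIV "- K"])
        (use K x in \<open>auto simp: open_Compl compact_imp_closed\<close>)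
    then have "frechet_derivative \<phi> (at x) = (\<lambda>h. 0)"
      by (rule has_derivative_unique) (rule has_derivative_const)
    then show ?thesis by (simp add: divergence_def)
  qed
  moreover have "continuous_on UNIV (divergence \<phi>)"
    unfolding divergence_def[abs_def] by (intro continuous_intros c)
  ultimately show thesis using that K by blast
qed

lemma lebesgue_on_integral_eq_lborel:
  fixes f g :: "'a::euclidean_space \<Rightarrow> real"
  assumes A: "A \<in> sets borel" and F: "F \<in> borel_measurable borel" "AE x in lborel. F x = indicator A x * f x"
    and g: "g \<in> borel_measurable borel" "\<And>x. x \<notin> A \<Longrightarrow> g x = 0"
    and f: "f \<in> borel_measurable (lebesgue_on A)"
  shows "integral\<^sup>L (lebesgue_on A) (\<lambda>x. f x * g x) = (\<integral>x. F x * g x \<partial>lborel)"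
proof -
  have "integral\<^sup>L (lebesgue_on A) (\<lambda>x. f x * g x) = (\<integral>x. indicator A x *\<^sub>R (f x * g x) \<partial>lebesgue)"
    by (rule integral_restrict_space) (use A in auto)
  also have "\<dots> = (\<integral>x. F x * g x \<partial>lebesgue)"
  proof (rule integral_cong_AE)
    have "(\<lambda>x. if x \<in> A then f x else 0) \<in> borel_measurable lebesgue"
      by (rule lebesgue_measurable_extend_zero[OF A f])
    moreover have "g \<in> borel_measurable lebesgue" using g(1) by (simp add: measurable_completion)
    ultimately have "(\<lambda>x. (if x \<in> A then f x else 0) * g x) \<in> borel_measurable lebesgue" by simp
    then show "(\<lambda>x. indicator A x *\<^sub>R (f x * g x)) \<in> borel_measurable lebesgue"
      by (rule measurable_cong[THEN iffD1, rotated]) auto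
    show "(\<lambda>x. F x * g x) \<in> borel_measurable lebesgue"
      using F(1) g(1) by (simp add: measurable_completion)
    have "AE x in lebesgue. F x = indicator A x * f x" using F(2) by (rule AE_completion)
    then show "AE x in lebesgue. indicator A x *\<^sub>R (f x * g x) = F x * g x"
      by eventually_elim simp
  qed
  also have "\<dots> = (\<integral>x. F x * g x \<partial>lborel)"
    by (rule integral_completion) (use F(1) g(1) in simp)
  finally show ?thesis .
qed

lemma TV_bounded_representative:
  fixes f :: "'a::euclidean_space \<Rightarrow> real"
  assumes A: "open A" and F: "F \<in> borel_measurable borel" "AE x in lborel. F x = indicator A x * f x"
    and f: "f \<in> borel_measurable (lebesgue_on A)"
    and tv: "total_variation f A \<le> ennreal V" and V: "0 \<le> V"
  shows "TV_bounded F A V"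
  unfolding TV_bounded_def
proof (intro ballI impI)
  fix \<phi> assume \<phi>: "\<phi> \<in> test_fields A" and n: "\<forall>x. norm (\<phi> x) \<le> 1"
  obtain K where K: "compact K" "K \<subseteq> A" "\<And>x. x \<notin> K \<Longrightarrow> \<phi> x = 0" "\<And>x. x \<notin> K \<Longrightarrow> divergence \<phi> x = 0"
    "continuous_on UNIV (divergence \<phi>)"
    using test_field_divergence[OF \<phi>] by metis
  have "ennreal (integral\<^sup>L (lebesgue_on A) (\<lambda>x. f x * divergence \<phi> x)) \<le> total_variation f A"
    unfolding total_variation_def by (rule SUP_upper) (use \<phi> n in auto)
  also have "\<dots> \<le> ennreal V" by (rule tv)
  also have "integral\<^sup>L (lebesgue_on A) (\<lambda>x. f x * divergence \<phi> x) = (\<integral>x. F x * divergence \<phi> x \<partial>lborel)"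
    by (rule lebesgue_on_integral_eq_lborel[OF _ F _ _ f])
      (use A K in \<open>auto intro: borel_measurable_continuous_onI\<close>)
  finally show "(\<integral>x. F x * divergence \<phi> x \<partial>lborel) \<le> V"
    using V by (simp only: ennreal_le_iff)
qed

text \<open>The integrand \<open>g\<close> may be arbitrary, since passing to the completion does
  not change nonnegative integrals even of nonmeasurable functions.\<close>

lemma nn_integral_lebesgue_on_eq_lborel:
  fixes f :: "'a::euclidean_space \<Rightarrow> real"
  assumes A: "A \<in> sets borel" and F: "AE x in lborel. F x = indicator A x * f x"
  shows "(\<integral>\<^sup>+x. ennreal (g x (f x)) \<partial>lebesgue_on A) = (\<integral>\<^sup>+x. indicator A x * ennreal (g x (F x)) \<partial>lborel)"
proof -
  have "(\<integral>\<^sup>+x. ennreal (g x (f x)) \<partial>lebesgue_on A) = (\<integral>\<^sup>+x. ennreal (g x (f x)) * indicator A x \<partial>lebesgue)"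
    by (rule nn_integral_restrict_space) (use A in auto)
  also have "\<dots> = (\<integral>\<^sup>+x. ennreal (g x (f x)) * indicator A x \<partial>lborel)"
    by (rule nn_integral_completion)
  also have "\<dots> = (\<integral>\<^sup>+x. indicator A x * ennreal (g x (F x)) \<partial>lborel)"
    by (rule nn_integral_cong_AE) (use F in \<open>eventually_elim, auto split: split_indicator\<close>)
  finally show ?thesis .
qed

text \<open>Integrability follows from |y| \<le> 1 + y^2 because the ball has finite
  measure.\<close>

lemma integrable_of_square_integrable_ball:
  fixes F :: "'a::euclidean_space \<Rightarrow> real"
  assumes "F \<in> borel_measurable borel" and R: "AE x in lborel. x \<notin> ball x0 R \<longrightarrow> F x = 0"
    and "(\<integral>\<^sup>+x. indicator (ball x0 R) x * ennreal ((F x)\<^sup>2) \<partial>lborel) < \<infinity>"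
  shows "integrable lborel F"
proof (rule integrableI_bounded)
  have [measurable]: "F \<in> borel_measurable borel" "ball x0 R \<in> sets borel" using assms by auto
  show "F \<in> borel_measurable lborel" by simp
  have "(\<integral>\<^sup>+x. ennreal (norm (F x)) \<partial>lborel)
     \<le> (\<integral>\<^sup>+x. indicator (ball x0 R) x + indicator (ball x0 R) x * ennreal ((F x)\<^sup>2) \<partial>lborel)"
  proof (rule nn_integral_mono_AE)
    show "AE x in lborel. ennreal (norm (F x)) \<le> indicator (ball x0 R) x + indicator (ball x0 R) x * ennreal ((F x)\<^sup>2)"
      using R
    proof eventually_elim
      fix x assume *: "x \<notin> ball x0 R \<longrightarrow> F x = 0"
      have "\<bar>F x\<bar> \<le> 1 + (F x)\<^sup>2"
        using zero_le_power2[of "\<bar>F x\<bar> - 1"] by (simp add: power2_eq_square algebra_simps)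
      then have "ennreal \<bar>F x\<bar> \<le> ennreal (1 + (F x)\<^sup>2)" by (rule ennreal_leI)
      then show "ennreal (norm (F x)) \<le> indicator (ball x0 R) x + indicator (ball x0 R) x * ennreal ((F x)\<^sup>2)"
        using * by (simp add: ennreal_plus split: split_indicator)
    qed
  qed
  also have "\<dots> = emeasure lborel (ball x0 R) + (\<integral>\<^sup>+x. indicator (ball x0 R) x * ennreal ((F x)\<^sup>2) \<partial>lborel)"
    by (subst nn_integral_add) auto
  also have "\<dots> < \<infinity>"
    using assms(3) emeasure_lborel_ball_finite[of x0 R] by (simp add: ennreal_add_eq_top less_top)
  finally show "(\<integral>\<^sup>+x. ennreal (norm (F x)) \<partial>lborel) < \<infinity>" .
qed

lemma total_variation_superlevel:
  fixes f :: "'a::euclidean_space \<Rightarrow> real"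
  assumes f: "f \<in> borel_measurable (lebesgue_on (ball x0 R))" and f0: "\<And>x. 0 \<le> f x"
    and tv: "total_variation f (ball x0 R) \<le> ennreal V" and V: "0 \<le> V"
    and r: "0 < r" and p: "0 < p" and rp: "r + p \<le> R" and l: "0 < l"
    and small: "(\<integral>\<^sup>+x. ennreal ((f x)\<^sup>2) \<partial>lebesgue_on (ball x0 R))
                  \<le> ennreal (l\<^sup>2 * unit_ball_vol (real DIM('a)) * p ^ DIM('a) / 2)"
  shows "ennreal (l / 4) * emeasure lebesgue {x \<in> ball x0 r. l < f x} \<le> ennreal (p * V)"
proof -
  obtain F0 where F0: "F0 \<in> borel_measurable borel" "AE x in lborel. F0 x = indicator (ball x0 R) x * f x"
    using lebesgue_on_borel_representative[OF _ f] by auto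
  \<comment> \<open>\<open>TV_bounded_superlevel\<close> asks for a function that is nonnegative
    everywhere, whereas \<open>F0\<close> is so only almost everywhere.\<close>
  define F where "F x = \<bar>F0 x\<bar>" for x
  have F[measurable]: "F \<in> borel_measurable borel" unfolding F_def using F0(1) by measurable
  have FAE: "AE x in lborel. F x = indicator (ball x0 R) x * f x"
    using F0(2) by eventually_elim (auto simp: F_def f0)
  have small': "(\<integral>\<^sup>+x. indicator (ball x0 R) x * ennreal ((F x)\<^sup>2) \<partial>lborel)
      \<le> ennreal (l\<^sup>2 * unit_ball_vol (real DIM('a)) * p ^ DIM('a) / 2)"
    using small by (subst (asm) nn_integral_lebesgue_on_eq_lborel[OF _ FAE, where g="\<lambda>x y. y\<^sup>2"]) auto
  have int: "integrable lborel F"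
  proof (rule integrable_of_square_integrable_ball[OF F])
    show "AE x in lborel. x \<notin> ball x0 R \<longrightarrow> F x = 0" using FAE by eventually_elim auto
    show "(\<integral>\<^sup>+x. indicator (ball x0 R) x * ennreal ((F x)\<^sup>2) \<partial>lborel) < \<infinity>"
      using small' by (rule order.strict_trans1) simp
  qed
  have "TV_bounded F (ball x0 R) V"
    by (rule TV_bounded_representative[OF _ F FAE f tv V]) simp
  from TV_bounded_superlevel[OF int this V r p rp l _ small']
  have "ennreal (l / 4) * emeasure lborel {x \<in> ball x0 r. l < F x} \<le> ennreal (p * V)"
    by (simp add: F_def)
  also have "emeasure lborel {x \<in> ball x0 r. l < F x} = emeasure lebesgue {x \<in> ball x0 r. l < F x}"
    by simp
  also have "\<dots> = emeasure lebesgue {x \<in> ball x0 r. l < f x}"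
  proof (rule emeasure_eq_AE)
    have "AE x in lebesgue. F x = indicator (ball x0 R) x * f x" using FAE by (rule AE_completion)
    then show "AE x in lebesgue. x \<in> {x \<in> ball x0 r. l < F x} \<longleftrightarrow> x \<in> {x \<in> ball x0 r. l < f x}"
      by eventually_elim (use rp p in auto)
    have "{x \<in> ball x0 r. l < F x} \<in> sets borel" using F by measurable
    then show "{x \<in> ball x0 r. l < F x} \<in> sets lebesgue" by simp
    have "(\<lambda>x. if x \<in> ball x0 R then f x else 0) \<in> borel_measurable lebesgue"
      by (rule lebesgue_measurable_extend_zero[OF _ f]) simp
    then have "{x \<in> space lebesgue. l < (if x \<in> ball x0 R then f x else 0)} \<in> sets lebesgue"
      by measurable
    then have "{x \<in> space lebesgue. l < (if x \<in> ball x0 R then f x else 0)} \<inter> ball x0 r \<in> sets lebesgue"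
      by (rule sets.Int) simp
    moreover have "{x \<in> space lebesgue. l < (if x \<in> ball x0 R then f x else 0)} \<inter> ball x0 r = {x \<in> ball x0 r. l < f x}"
      using rp p by auto
    ultimately show "{x \<in> ball x0 r. l < f x} \<in> sets lebesgue" by simp
  qed
  finally show ?thesis .
qed

text \<open>The constant inherits the bound \<open>M\<close> because it is the value of a
  representative at a point where the bound holds. This later keeps the truncations of
  \<open>u\<close> at level \<open>c\<close> below \<open>2 * M\<close>.\<close>

lemma total_variation_Poincare:
  fixes f :: "'a::euclidean_space \<Rightarrow> real"
  assumes f: "f \<in> borel_measurable (lebesgue_on (ball x0 (4 * \<rho>)))"
    and f2: "integrable (lebesgue_on (ball x0 (4 * \<rho>))) (\<lambda>x. (f x)\<^sup>2)"
    and tv: "total_variation f (ball x0 (4 * \<rho>)) \<le> ennreal V" and V: "0 < V" and \<rho>: "0 < \<rho>"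
    and M: "AE x in lebesgue_on (ball x0 (4 * \<rho>)). \<bar>f x\<bar> \<le> M"
  obtains c where "\<bar>c\<bar> \<le> M"
    "(\<integral>\<^sup>+x. ennreal \<bar>f x - c\<bar> \<partial>lebesgue_on (ball x0 \<rho>)) \<le> ennreal (2 ^ (DIM('a) + 2) * \<rho> * V)"
proof -
  let ?R = "4 * \<rho>"
  obtain F where F: "F \<in> borel_measurable borel" "AE x in lborel. F x = indicator (ball x0 ?R) x * f x"
    using lebesgue_on_borel_representative[OF _ f] by auto
  have "(\<integral>\<^sup>+x. ennreal ((f x)\<^sup>2) \<partial>lebesgue_on (ball x0 ?R)) < \<infinity>"
    using f2 by (simp add: integrable_iff_bounded)
  then have i2: "(\<integral>\<^sup>+x. indicator (ball x0 ?R) x * ennreal ((F x)\<^sup>2) \<partial>lborel) < \<infinity>"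
    by (subst (asm) nn_integral_lebesgue_on_eq_lborel[OF _ F(2), where g="\<lambda>x y. y\<^sup>2"]) auto
  have int: "integrable lborel F"
  proof (rule integrable_of_square_integrable_ball[OF F(1) _ i2])
    show "AE x in lborel. x \<notin> ball x0 ?R \<longrightarrow> F x = 0" using F(2) by eventually_elim auto
  qed
  have TV: "TV_bounded F (ball x0 ?R) V"
    by (rule TV_bounded_representative[OF _ F f tv]) (use V in auto)
  have "AE x in lebesgue. x \<in> ball x0 ?R \<longrightarrow> \<bar>f x\<bar> \<le> M"
    using M by (simp add: AE_restrict_space_iff)
  then have "AE x in lborel. x \<in> ball x0 ?R \<longrightarrow> \<bar>f x\<bar> \<le> M" by (simp add: AE_completion_iff)
  with F(2) have "AE x in lborel. x \<in> ball x0 \<rho> \<longrightarrow> \<bar>F x\<bar> \<le> M"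
    by eventually_elim (use \<rho> in auto)
  from TV_bounded_Poincare[OF int TV V \<rho> this] obtain y where y: "\<bar>F y\<bar> \<le> M"
    "(\<integral>\<^sup>+x. indicator (ball x0 \<rho>) x * ennreal \<bar>F x - F y\<bar> \<partial>lborel) \<le> ennreal (2 ^ (DIM('a) + 2) * \<rho> * V)"
    by blast
  \<comment> \<open>\<open>F\<close> represents \<open>f\<close> on the ball of radius
    \<open>4 * \<rho>\<close>; only after multiplication by the indicator does it represent
    \<open>f\<close> on the small ball, as the transfer lemma requires.\<close>
  have "AE x in lborel. indicator (ball x0 \<rho>) x * F x = indicator (ball x0 \<rho>) x * f x"
    using F(2) by eventually_elim (use \<rho> in \<open>auto split: split_indicator\<close>)
  from nn_integral_lebesgue_on_eq_lborel[OF _ this, where g="\<lambda>x z. \<bar>z - F y\<bar>"]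
  have "(\<integral>\<^sup>+x. ennreal \<bar>f x - F y\<bar> \<partial>lebesgue_on (ball x0 \<rho>)) =
     (\<integral>\<^sup>+x. indicator (ball x0 \<rho>) x * ennreal \<bar>indicator (ball x0 \<rho>) x * F x - F y\<bar> \<partial>lborel)" by simp
  also have "\<dots> = (\<integral>\<^sup>+x. indicator (ball x0 \<rho>) x * ennreal \<bar>F x - F y\<bar> \<partial>lborel)"
    by (intro nn_integral_cong) (simp split: split_indicator)
  finally show thesis using that[of "F y"] y by simp
qed

section \<open>The total variation under addition of constants and under cutoffs\<close>

lemma integrable_continuous_compact_support:
  fixes g :: "'a::euclidean_space \<Rightarrow> real"
  assumes g: "continuous_on UNIV g" and K: "compact K" "\<And>x. x \<notin> K \<Longrightarrow> g x = 0"
  shows "integrable lborel g"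
proof -
  have "integrable lborel (\<lambda>x. indicator K x *\<^sub>R g x)"
    by (rule borel_integrable_compact[OF K(1)]) (use g continuous_on_subset in blast)
  moreover have "(\<lambda>x. indicator K x *\<^sub>R g x) = g"
    using K(2) by (auto simp: fun_eq_iff split: split_indicator)
  ultimately show ?thesis by simp
qed

text \<open>By translation invariance the integral of \<open>f (x - s *\<^sub>R e)\<close> is
  constant for small \<open>s\<close>, so its derivative at 0 vanishes. The ball \<open>B\<close>
  contains the supports of these translates, so its indicator can serve as the integrable factor in
  \<open>translated_integral_has_derivative\<close>.\<close>

lemma integral_directional_derivative_zero:
  fixes f :: "'a::euclidean_space \<Rightarrow> real"
  assumes f: "has_C1_gradient f G" and K: "compact K" "\<And>x. x \<notin> K \<Longrightarrow> f x = 0"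
  shows "(\<integral>x. G x \<bullet> e \<partial>lborel) = 0"
proof -
  obtain \<rho> where \<rho>: "\<And>x. x \<in> K \<Longrightarrow> norm x \<le> \<rho>"
    using compact_imp_bounded[OF K(1)] by (auto simp: bounded_iff)
  define B where "B = cball (0::'a) (\<rho> + norm e)"
  have F: "integrable lborel (\<lambda>x. indicator B x :: real)"
    unfolding B_def using emeasure_lborel_cball_finite[of "0::'a" "\<rho> + norm e"]
    by (simp add: integrable_indicator_iff infinity_ennreal_def)
  have fm: "(\<lambda>x. f (x - s *\<^sub>R e)) \<in> borel_measurable borel" for s
    by (rule borel_measurable_continuous_onI[OF has_C1_gradient_continuous[OF has_C1_gradient_translate[OF f]]])
  have const: "(\<integral>x. indicator B x * f (x - s *\<^sub>R e) \<partial>lborel) = (\<integral>x. f x \<partial>lborel)" if s: "\<bar>s\<bar> < 1" for s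
  proof -
    have "indicator B x * f (x - s *\<^sub>R e) = f (x - s *\<^sub>R e)" for x
    proof (cases "x - s *\<^sub>R e \<in> K")
      case True
      have "norm x \<le> norm (x - s *\<^sub>R e) + norm (s *\<^sub>R e)"
        using norm_triangle_ineq[of "x - s *\<^sub>R e" "s *\<^sub>R e"] by simp
      also have "norm (s *\<^sub>R e) \<le> norm e" using s by (simp add: mult_left_le_one_le)
      finally have "x \<in> B" using \<rho>[OF True] unfolding B_def by simp
      then show ?thesis by simp
    qed (simp add: K(2))
    then have "(\<integral>x. indicator B x * f (x - s *\<^sub>R e) \<partial>lborel) = (\<integral>x. f (x - s *\<^sub>R e) \<partial>lborel)"
      by (simp only:)
    also have "\<dots> = (\<integral>x. f x \<partial>lborel)"
      using lborel_integral_translate[of f "- s *\<^sub>R e"] fm[of 0] by simp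
    finally show ?thesis .
  qed
  have "((\<lambda>s. \<integral>x. indicator B x * f (x - s *\<^sub>R e) \<partial>lborel) has_real_derivative
           - (\<integral>x. indicator B x * (G (x - 0 *\<^sub>R e) \<bullet> e) \<partial>lborel)) (at 0)"
    by (rule translated_integral_has_derivative[OF F f K])
  moreover have "((\<lambda>s. \<integral>x. indicator B x * f (x - s *\<^sub>R e) \<partial>lborel) has_real_derivative 0) (at 0)"
  proof (rule has_field_derivative_transform_within_open[where S="{-1<..<1}"])
    show "((\<lambda>s::real. \<integral>x. f x \<partial>lborel) has_real_derivative 0) (at 0)" by simp
  qed (use const in auto)
  ultimately have "- (\<integral>x. indicator B x * (G (x - 0 *\<^sub>R e) \<bullet> e) \<partial>lborel) = 0"
    by (rule DERIV_unique)
  moreover have "indicator B x * (G x \<bullet> e) = G x \<bullet> e" for x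
  proof (cases "x \<in> K")
    case True
    then show ?thesis using \<rho>[of x] by (simp add: B_def add_increasing2)
  next
    case False
    then show ?thesis by (simp add: has_C1_gradient_zero_outside[OF f K])
  qed
  ultimately show ?thesis by simp
qed

lemma integral_divergence_zero:
  fixes \<phi> :: "'a::euclidean_space \<Rightarrow> 'a"
  assumes \<phi>: "\<phi> \<in> test_fields A"
  shows "(\<integral>x. divergence \<phi> x \<partial>lborel) = 0"
proof -
  obtain K where K: "compact K" "K \<subseteq> A" "\<And>x. x \<notin> K \<Longrightarrow> \<phi> x = 0"
    and d: "\<And>x. \<phi> differentiable (at x)"
    and c: "\<And>b. b \<in> Basis \<Longrightarrow> continuous_on UNIV (\<lambda>x. frechet_derivative \<phi> (at x) b)"
    using \<phi> unfolding test_fields_def by auto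
  \<comment> \<open>The gradient of the component \<open>\<phi> x \<bullet> b\<close>. The
    divergence is the sum of the terms \<open>G b x \<bullet> b\<close>, so each component can be
    treated alone.\<close>
  define G where "G b x = (\<Sum>c\<in>Basis. (frechet_derivative \<phi> (at x) c \<bullet> b) *\<^sub>R c)" for b x
  have G: "has_C1_gradient (\<lambda>x. \<phi> x \<bullet> b) (G b)" for b
    unfolding has_C1_gradient_def
  proof (intro conjI allI)
    show "continuous_on UNIV (G b)"
      unfolding G_def[abs_def] by (intro continuous_intros c)
    fix x
    have D: "(\<phi> has_derivative frechet_derivative \<phi> (at x)) (at x)"
      using d frechet_derivative_works by metis
    interpret bounded_linear "frechet_derivative \<phi> (at x)"
      by (rule has_derivative_bounded_linear[OF D])
    have "frechet_derivative \<phi> (at x) h \<bullet> b = G b x \<bullet> h" for h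
    proof -
      have "frechet_derivative \<phi> (at x) h = frechet_derivative \<phi> (at x) (\<Sum>c\<in>Basis. (h \<bullet> c) *\<^sub>R c)"
        by (simp add: euclidean_representation)
      then show ?thesis
        unfolding G_def by (simp add: sum scaleR inner_sum_left inner_sum_right inner_commute[of h] mult.commute)
    qed
    then have eq: "(\<lambda>h. frechet_derivative \<phi> (at x) h \<bullet> b) = (\<lambda>h. G b x \<bullet> h)" by auto
    show "((\<lambda>x. \<phi> x \<bullet> b) has_derivative (\<bullet>) (G b x)) (at x)"
      using has_derivative_inner_left[OF D, of b] unfolding eq .
  qed
  have G0: "G b x = 0" if "x \<notin> K" for b x
    by (rule has_C1_gradient_zero_outside[OF G K(1) _ that]) (simp add: K(3))
  have int: "integrable lborel (\<lambda>x. G b x \<bullet> b)" for b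
    by (rule integrable_continuous_compact_support[OF _ K(1)])
      (use G G0 in \<open>auto simp: has_C1_gradient_def intro!: continuous_intros\<close>)
  have "divergence \<phi> x = (\<Sum>b\<in>Basis. G b x \<bullet> b)" for x
    unfolding divergence_def G_def by (intro sum.cong refl) (simp add: inner_sum_left inner_Basis if_distrib cong: if_cong)
  then have "(\<integral>x. divergence \<phi> x \<partial>lborel) = (\<Sum>b\<in>Basis. \<integral>x. G b x \<bullet> b \<partial>lborel)"
    using int by simp
  also have "\<dots> = 0"
  proof (intro sum.neutral ballI)
    fix b show "(\<integral>x. G b x \<bullet> b \<partial>lborel) = 0"
      by (rule integral_directional_derivative_zero[OF G K(1)]) (simp add: K(3))
  qed
  finally show ?thesis .
qed

lemma total_variation_cong_AE:
  assumes "f \<in> borel_measurable (lebesgue_on A)" "g \<in> borel_measurable (lebesgue_on A)"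
    and ae: "AE x in lebesgue_on A. f x = g x"
  shows "total_variation f A = total_variation g A"
  unfolding total_variation_def
proof (intro SUP_cong refl arg_cong[where f=ennreal] integral_cong_AE)
  fix \<phi> assume "\<phi> \<in> {\<phi> \<in> test_fields A. \<forall>x. norm (\<phi> x) \<le> 1}"
  then have "\<phi> \<in> test_fields A" by blast
  then have "continuous_on UNIV (divergence \<phi>)" by (rule test_field_divergence)
  then have "divergence \<phi> \<in> borel_measurable borel" by (rule borel_measurable_continuous_onI)
  then have "divergence \<phi> \<in> borel_measurable (lebesgue_on A)"
    by (intro measurable_restrict_space1) (simp add: measurable_completion)
  then show "(\<lambda>x. f x * divergence \<phi> x) \<in> borel_measurable (lebesgue_on A)"
    "(\<lambda>x. g x * divergence \<phi> x) \<in> borel_measurable (lebesgue_on A)" using assms by auto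
  show "AE x in lebesgue_on A. f x * divergence \<phi> x = g x * divergence \<phi> x"
    using ae by eventually_elim simp
qed

text \<open>Integrals of divergences of test fields vanish. The statement identifies the variation
  of a function with that of its truncation at a lower bound, from which it differs by a
  constant.\<close>

lemma total_variation_add_const:
  fixes f :: "'a::euclidean_space \<Rightarrow> real"
  assumes f: "integrable (lebesgue_on (ball x0 R)) f"
  shows "total_variation (\<lambda>x. f x + c) (ball x0 R) = total_variation f (ball x0 R)"
  unfolding total_variation_def
proof (intro SUP_cong refl arg_cong[where f=ennreal])
  let ?A = "ball x0 R"
  fix \<phi> assume "\<phi> \<in> {\<phi> \<in> test_fields ?A. \<forall>x. norm (\<phi> x) \<le> 1}"
  then have \<phi>: "\<phi> \<in> test_fields ?A" by blast
  obtain K where K: "compact K" "K \<subseteq> ?A" "\<And>x. x \<notin> K \<Longrightarrow> divergence \<phi> x = 0"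
    "continuous_on UNIV (divergence \<phi>)" using test_field_divergence[OF \<phi>] by metis
  have dm: "divergence \<phi> \<in> borel_measurable borel" by (rule borel_measurable_continuous_onI[OF K(4)])
  have "compact (divergence \<phi> ` K)"
    using K(1,4) by (meson compact_continuous_image continuous_on_subset subset_UNIV)
  then obtain M where M: "\<And>x. x \<in> K \<Longrightarrow> \<bar>divergence \<phi> x\<bar> \<le> M"
    using compact_imp_bounded[of "divergence \<phi> ` K"] by (auto simp: bounded_iff)
  have M': "\<bar>divergence \<phi> x\<bar> \<le> max M 0" for x
    using M[of x] K(3)[of x] by (cases "x \<in> K") auto
  have i1: "integrable (lebesgue_on ?A) (\<lambda>x. f x * divergence \<phi> x)"
  proof (rule Bochner_Integration.integrable_bound[of _ "\<lambda>x. f x * max M 0"])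
    show "integrable (lebesgue_on ?A) (\<lambda>x. f x * max M 0)" using f by simp
    show "(\<lambda>x. f x * divergence \<phi> x) \<in> borel_measurable (lebesgue_on ?A)"
    proof (rule borel_measurable_times)
      show "f \<in> borel_measurable (lebesgue_on ?A)" using f by simp
      show "divergence \<phi> \<in> borel_measurable (lebesgue_on ?A)"
        using dm by (intro measurable_restrict_space1) (simp add: measurable_completion)
    qed
    show "AE x in lebesgue_on ?A. norm (f x * divergence \<phi> x) \<le> norm (f x * max M 0)"
      unfolding real_norm_def abs_mult
      by (intro AE_I2 mult_left_mono order_trans[OF M' abs_ge_self]) simp
  qed
  have "integrable lborel (divergence \<phi>)"
    by (rule integrable_continuous_compact_support[OF K(4,1,3)])
  then have "integrable lebesgue (divergence \<phi>)"
    using dm by (subst integrable_completion) auto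
  moreover have ind: "indicator ?A x *\<^sub>R divergence \<phi> x = divergence \<phi> x" for x
    using K(2) K(3)[of x] by (cases "x \<in> K") (auto split: split_indicator)
  ultimately have "integrable lebesgue (\<lambda>x. indicator ?A x *\<^sub>R divergence \<phi> x)"
    by (simp only:)
  then have i2: "integrable (lebesgue_on ?A) (divergence \<phi>)"
    using integrable_restrict_space[of ?A lebesgue "divergence \<phi>"] by simp
  have "integral\<^sup>L (lebesgue_on ?A) (divergence \<phi>) = (\<integral>x. divergence \<phi> x \<partial>lebesgue)"
    by (subst integral_restrict_space) (auto simp only: ind space_completion sets_completionI_sets, auto)
  also have "\<dots> = (\<integral>x. divergence \<phi> x \<partial>lborel)"
    by (rule integral_completion) (use dm in simp)
  also have "\<dots> = 0" by (rule integral_divergence_zero[OF \<phi>])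
  finally have "integral\<^sup>L (lebesgue_on ?A) (divergence \<phi>) = 0" .
  then show "integral\<^sup>L (lebesgue_on ?A) (\<lambda>x. (f x + c) * divergence \<phi> x)
      = integral\<^sup>L (lebesgue_on ?A) (\<lambda>x. f x * divergence \<phi> x)"
    using i1 i2 by (simp add: distrib_right)
qed

text \<open>A test field supported in the inner ball sees only the region where
  \<open>\<eta>\<close> is 1, so the variation of the product is bounded below without a product
  rule.\<close>

lemma total_variation_cutoff:
  fixes w :: "'a::euclidean_space \<Rightarrow> real"
  assumes r: "r \<le> R" and b: "0 \<le> b" and \<eta>: "\<And>x. x \<in> ball x0 r \<Longrightarrow> \<eta> x = 1"
  shows "ennreal b * total_variation w (ball x0 r) \<le> total_variation (\<lambda>x. w x * (\<eta> x * b)) (ball x0 R)"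
proof -
  have "ennreal b * total_variation w (ball x0 r) =
     (SUP \<phi>\<in>{\<phi>\<in>test_fields (ball x0 r). \<forall>x. norm (\<phi> x) \<le> 1}.
        ennreal b * ennreal (integral\<^sup>L (lebesgue_on (ball x0 r)) (\<lambda>x. w x * divergence \<phi> x)))"
    unfolding total_variation_def by (rule SUP_mult_left_ennreal)
  also have "\<dots> \<le> total_variation (\<lambda>x. w x * (\<eta> x * b)) (ball x0 R)"
  proof (rule SUP_least)
    fix \<phi> assume \<phi>: "\<phi> \<in> {\<phi> \<in> test_fields (ball x0 r). \<forall>x. norm (\<phi> x) \<le> 1}"
    then have "\<phi> \<in> test_fields (ball x0 r)" by blast
    then obtain K where K: "compact K" "K \<subseteq> ball x0 r" "\<And>x. x \<notin> K \<Longrightarrow> \<phi> x = 0" "\<And>x. x \<notin> K \<Longrightarrow> divergence \<phi> x = 0"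
      using test_field_divergence by metis
    have rR: "ball x0 r \<subseteq> ball x0 R" using r by auto
    have "integral\<^sup>L (lebesgue_on (ball x0 R)) (\<lambda>x. w x * (\<eta> x * b) * divergence \<phi> x)
       = (\<integral>x. indicator (ball x0 R) x *\<^sub>R (w x * (\<eta> x * b) * divergence \<phi> x) \<partial>lebesgue)"
      by (rule integral_restrict_space) auto
    also have "\<dots> = (\<integral>x. b * (indicator (ball x0 r) x *\<^sub>R (w x * divergence \<phi> x)) \<partial>lebesgue)"
    proof (rule Bochner_Integration.integral_cong[OF refl])
      fix x
      show "indicator (ball x0 R) x *\<^sub>R (w x * (\<eta> x * b) * divergence \<phi> x) = b * (indicator (ball x0 r) x *\<^sub>R (w x * divergence \<phi> x))"
        using K(2) K(4)[of x] rR \<eta>[of x] by (cases "x \<in> K") (auto simp: subset_eq)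
    qed
    also have "\<dots> = b * (\<integral>x. (indicator (ball x0 r) x *\<^sub>R (w x * divergence \<phi> x)) \<partial>lebesgue)"
      by (rule Bochner_Integration.integral_mult_right_zero)
    also have "(\<integral>x. (indicator (ball x0 r) x *\<^sub>R (w x * divergence \<phi> x)) \<partial>lebesgue) =
      integral\<^sup>L (lebesgue_on (ball x0 r)) (\<lambda>x. w x * divergence \<phi> x)"
      by (rule integral_restrict_space[symmetric]) auto
    finally have "ennreal b * ennreal (integral\<^sup>L (lebesgue_on (ball x0 r)) (\<lambda>x. w x * divergence \<phi> x))
       = ennreal (integral\<^sup>L (lebesgue_on (ball x0 R)) (\<lambda>x. w x * (\<eta> x * b) * divergence \<phi> x))"
      using b by (simp add: ennreal_mult')
    also have "\<dots> \<le> total_variation (\<lambda>x. w x * (\<eta> x * b)) (ball x0 R)"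
      unfolding total_variation_def
    proof (rule SUP_upper)
      show "\<phi> \<in> {\<phi> \<in> test_fields (ball x0 R). \<forall>x. norm (\<phi> x) \<le> 1}"
        using \<phi> rR unfolding test_fields_def by blast
    qed
    finally show "ennreal b * ennreal (integral\<^sup>L (lebesgue_on (ball x0 r)) (\<lambda>x. w x * divergence \<phi> x))
       \<le> total_variation (\<lambda>x. w x * (\<eta> x * b)) (ball x0 R)" .
  qed
  finally show ?thesis .
qed

section \<open>The Caccioppoli inequality\<close>

text \<open>Quadratic rather than linear in the distance to \<open>x0\<close>: the part between the
  two spheres is then a polynomial, hence smooth, and the gradient is still bounded by
  \<open>2 / (R - r)\<close>.\<close>

definition bump :: "'a::euclidean_space \<Rightarrow> real \<Rightarrow> real \<Rightarrow> 'a \<Rightarrow> real" where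
  "bump x0 r R x = min 1 (max 0 ((R\<^sup>2 - (norm (x - x0))\<^sup>2) / (R\<^sup>2 - r\<^sup>2)))"

lemma bump_bounds: "0 \<le> bump x0 r R x" "bump x0 r R x \<le> 1"
  unfolding bump_def by auto

lemma bump_inner:
  assumes "0 < r" "r < R" "norm (x - x0) \<le> r"
  shows "bump x0 r R x = 1"
proof -
  have "r\<^sup>2 < R\<^sup>2" "(norm (x - x0))\<^sup>2 \<le> r\<^sup>2" using assms by (auto intro: power_strict_mono power_mono)
  then have "1 \<le> (R\<^sup>2 - (norm (x - x0))\<^sup>2) / (R\<^sup>2 - r\<^sup>2)" by (simp add: le_divide_eq)
  then show ?thesis unfolding bump_def by simp
qed

lemma bump_middle:
  assumes "0 < r" "r < R" "r \<le> norm (x - x0)" "norm (x - x0) \<le> R"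
  shows "bump x0 r R x = (R\<^sup>2 - (norm (x - x0))\<^sup>2) / (R\<^sup>2 - r\<^sup>2)"
proof -
  have "r\<^sup>2 < R\<^sup>2" "r\<^sup>2 \<le> (norm (x - x0))\<^sup>2" "(norm (x - x0))\<^sup>2 \<le> R\<^sup>2"
    using assms by (auto intro: power_strict_mono power_mono)
  then have "(R\<^sup>2 - (norm (x - x0))\<^sup>2) / (R\<^sup>2 - r\<^sup>2) \<le> 1" "0 \<le> (R\<^sup>2 - (norm (x - x0))\<^sup>2) / (R\<^sup>2 - r\<^sup>2)"
    by (auto simp: divide_le_eq)
  then show ?thesis unfolding bump_def by simp
qed

lemma bump_outer:
  assumes "0 < r" "r < R" "R \<le> norm (x - x0)"
  shows "bump x0 r R x = 0"
proof -
  have "r\<^sup>2 < R\<^sup>2" "R\<^sup>2 \<le> (norm (x - x0))\<^sup>2" using assms by (auto intro: power_strict_mono power_mono)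
  then have "(R\<^sup>2 - (norm (x - x0))\<^sup>2) / (R\<^sup>2 - r\<^sup>2) \<le> 0" by (simp add: divide_le_0_iff)
  then show ?thesis unfolding bump_def by simp
qed

lemma continuous_on_bump:
  assumes "0 < r" "r < R"
  shows "continuous_on UNIV (bump x0 r R)"
proof -
  have "R\<^sup>2 - r\<^sup>2 \<noteq> 0" using assms power_strict_mono[of r R 2] by simp
  then show ?thesis unfolding bump_def[abs_def] by (intro continuous_intros) auto
qed

lemma gradient_eqI:
  fixes v :: "'a::euclidean_space"
  assumes "(f has_derivative (\<lambda>h. v \<bullet> h)) (at x)"
  shows "gradient f x = v"
proof -
  have "frechet_derivative f (at x) = (\<lambda>h. v \<bullet> h)"
    using frechet_derivative_at[OF assms] by simp
  then show ?thesis unfolding gradient_def by (simp add: euclidean_representation)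
qed

lemma gradient_bump:
  assumes r: "0 < r" "r < R" and x: "norm (x - x0) \<noteq> r" "norm (x - x0) < R"
  shows "gradient (\<lambda>y. bump x0 r R y * b) x =
     (if norm (x - x0) < r then 0 else - ((2 * b / (R\<^sup>2 - r\<^sup>2)) *\<^sub>R (x - x0)))"
proof (cases "norm (x - x0) < r")
  case True
  have "((\<lambda>y. bump x0 r R y * b) has_derivative (\<lambda>h. 0 \<bullet> h)) (at x)"
  proof (rule has_derivative_transform_within_open[where f="\<lambda>y. b" and s="ball x0 r"])
    show "((\<lambda>y. b) has_derivative (\<lambda>h. 0 \<bullet> h)) (at x)" by simp
    show "x \<in> ball x0 r" using True by (simp add: dist_norm norm_minus_commute)
    show "b = bump x0 r R y * b" if "y \<in> ball x0 r" for y
      using that bump_inner[OF r, of y x0] by (simp add: dist_norm norm_minus_commute)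
  qed simp
  then show ?thesis using True by (simp add: gradient_eqI)
next
  case False
  let ?U = "ball x0 R - cball x0 r"
  have "((\<lambda>y. (R\<^sup>2 - (y - x0) \<bullet> (y - x0)) / (R\<^sup>2 - r\<^sup>2) * b) has_derivative
       (\<lambda>h. (0 - ((x - x0) \<bullet> h + h \<bullet> (x - x0))) / (R\<^sup>2 - r\<^sup>2) * b)) (at x)"
    unfolding divide_inverse
    by (intro has_derivative_mult_left has_derivative_diff has_derivative_const)
      (auto intro!: derivative_eq_intros)
  moreover have "(0 - ((x - x0) \<bullet> h + h \<bullet> (x - x0))) / (R\<^sup>2 - r\<^sup>2) * b = - ((2 * b / (R\<^sup>2 - r\<^sup>2)) *\<^sub>R (x - x0)) \<bullet> h" for h
    by (simp add: inner_commute[of h])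
  ultimately have D: "((\<lambda>y. (R\<^sup>2 - (y - x0) \<bullet> (y - x0)) / (R\<^sup>2 - r\<^sup>2) * b) has_derivative
       (\<lambda>h. - ((2 * b / (R\<^sup>2 - r\<^sup>2)) *\<^sub>R (x - x0)) \<bullet> h)) (at x)"
    by (simp only:)
  have "((\<lambda>y. bump x0 r R y * b) has_derivative (\<lambda>h. - ((2 * b / (R\<^sup>2 - r\<^sup>2)) *\<^sub>R (x - x0)) \<bullet> h)) (at x)"
  proof (rule has_derivative_transform_within_open[OF D, where s="?U"])
    show "x \<in> ?U" using False x by (simp add: dist_norm norm_minus_commute)
    show "(R\<^sup>2 - (y - x0) \<bullet> (y - x0)) / (R\<^sup>2 - r\<^sup>2) * b = bump x0 r R y * b" if "y \<in> ?U" for y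
    proof -
      have "r \<le> norm (y - x0)" "norm (y - x0) \<le> R"
        using that by (auto simp: dist_norm norm_minus_commute)
      then show ?thesis using bump_middle[OF r, of y x0] by (simp add: power2_norm_eq_inner)
    qed
  qed (simp add: open_Diff)
  then show ?thesis using False by (simp add: gradient_eqI)
qed

section \<open>The space-time cutoff and the null interface on which it need not be
  differentiable\<close>

lemma null_sets_sphere_times:
  "(sphere x0 r \<times> (UNIV :: real set) :: ('a::euclidean_space \<times> real) set) \<in> null_sets lebesgue"
proof -
  have "sphere x0 r \<in> null_sets lebesgue"
    using negligible_sphere negligible_iff_null_sets by blast
  then have "emeasure lborel (sphere x0 r) = 0" by (simp add: null_sets_def)
  then have "emeasure (lborel \<Otimes>\<^sub>M lborel) (sphere x0 r \<times> (UNIV :: real set)) = 0"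
    by (subst lborel.emeasure_pair_measure_Times) auto
  then have "emeasure lborel (sphere x0 r \<times> (UNIV :: real set)) = 0" by (simp only: lborel_prod)
  moreover have "(sphere x0 r \<times> (UNIV :: real set)) \<in> sets borel"
    by (intro borel_closed closed_Times) auto
  ultimately have "(sphere x0 r \<times> (UNIV :: real set)) \<in> null_sets lborel" by auto
  then show ?thesis by (rule null_sets_completionI)
qed

text \<open>Every subset of a null set is Lebesgue measurable. This deals with the gradient of a
  cutoff, for which no formula is available on the interface.\<close>

lemma borel_measurable_lebesgue_on_eq_off_null:
  fixes f g :: "'a::euclidean_space \<Rightarrow> real"
  assumes S: "S \<in> sets lebesgue" and g: "g \<in> borel_measurable (lebesgue_on S)"
    and Z: "Z \<in> null_sets lebesgue" and eq: "\<And>x. x \<in> S - Z \<Longrightarrow> f x = g x"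
  shows "f \<in> borel_measurable (lebesgue_on S)"
proof (rule measurableI)
  fix B :: "real set" assume "B \<in> sets borel"
  with g have "g -` B \<inter> S \<in> sets (lebesgue_on S)" by (metis measurable_sets space_lebesgue_on)
  then have 1: "g -` B \<inter> S \<in> sets lebesgue" using S by (simp add: sets_restrict_space_iff)
  have 2: "f -` B \<inter> S \<inter> Z \<in> sets lebesgue"
    using null_sets_completion_subset[of "f -` B \<inter> S \<inter> Z" Z lborel] Z by (auto intro: null_setsD2)
  have "f -` B \<inter> S = (g -` B \<inter> S - Z) \<union> (f -` B \<inter> S \<inter> Z)" using eq by auto
  also have "\<dots> \<in> sets lebesgue" using 1 2 Z by (auto intro: null_setsD2)
  finally show "f -` B \<inter> space (lebesgue_on S) \<in> sets (lebesgue_on S)"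
    using S by (simp add: sets_restrict_space_iff)
qed simp

context
  fixes x0 :: "'a::euclidean_space" and r R t0 t1 \<alpha> \<beta> :: real
  assumes r: "0 < r" "r < R" and t: "t0 < t1" and ab: "0 \<le> \<alpha>" "0 \<le> \<beta>"
begin

text \<open>The affine factor in time covers two uses. With \<open>\<alpha> = 1\<close> and
  \<open>\<beta> = 0\<close> the cutoff is independent of time; with \<open>\<alpha> = 0\<close> it
  vanishes at \<open>t0\<close>, which erases the initial term of the energy inequality. It is not
  capped at 1 in time, so no interface in time arises.\<close>

definition cutoff :: "'a \<times> real \<Rightarrow> real" where
  "cutoff z = bump x0 r R (fst z) * (\<alpha> + \<beta> * (snd z - t0))"

text \<open>The parameter \<open>\<theta> = (t1 - t0) / R\<close> makes radius and time interval
  independent of each other in the energy inequality.\<close>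

lemma cylinder_eq: "cylinder x0 t1 ((t1 - t0) / R) R = ball x0 R \<times> {t0<..t1}"
  unfolding cylinder_def using r by simp

lemma cylinder_sets: "ball x0 R \<times> {t0<..t1} \<in> sets borel"
  by (intro borel_Times) auto

lemma square_diff_ge: "(R - r) * R \<le> R\<^sup>2 - r\<^sup>2" "0 < R\<^sup>2 - r\<^sup>2"
proof -
  have "R\<^sup>2 - r\<^sup>2 = (R - r) * (R + r)" by (simp add: power2_eq_square algebra_simps)
  then show "(R - r) * R \<le> R\<^sup>2 - r\<^sup>2" "0 < R\<^sup>2 - r\<^sup>2" using r by auto
qed

lemma time_deriv_cutoff: "time_deriv cutoff z = bump x0 r R (fst z) * \<beta>"
  unfolding time_deriv_def cutoff_def
  by (rule DERIV_imp_deriv) (auto intro!: derivative_eq_intros)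

lemma space_gradient_cutoff:
  assumes "fst z \<in> ball x0 R" "fst z \<notin> sphere x0 r"
  shows "norm (space_gradient cutoff z) = (if norm (fst z - x0) < r then 0
     else 2 * \<bar>\<alpha> + \<beta> * (snd z - t0)\<bar> / (R\<^sup>2 - r\<^sup>2) * norm (fst z - x0))"
proof -
  have "space_gradient cutoff z = gradient (\<lambda>y. bump x0 r R y * (\<alpha> + \<beta> * (snd z - t0))) (fst z)"
    unfolding space_gradient_def cutoff_def by simp
  also have "\<dots> = (if norm (fst z - x0) < r then 0
     else - ((2 * (\<alpha> + \<beta> * (snd z - t0)) / (R\<^sup>2 - r\<^sup>2)) *\<^sub>R (fst z - x0)))"
    by (rule gradient_bump[OF r]) (use assms in \<open>auto simp: dist_norm norm_minus_commute\<close>)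
  moreover have "norm (- ((2 * q / (R\<^sup>2 - r\<^sup>2)) *\<^sub>R (fst z - x0))) = 2 * \<bar>q\<bar> / (R\<^sup>2 - r\<^sup>2) * norm (fst z - x0)" for q
    using square_diff_ge by (simp add: abs_mult)
  ultimately show ?thesis by (simp only: norm_zero split: if_split) simp
qed

lemma space_gradient_cutoff_le:
  assumes "fst z \<in> ball x0 R" "fst z \<notin> sphere x0 r" "t0 \<le> snd z" "snd z \<le> t1"
  shows "norm (space_gradient cutoff z) \<le> 2 * (\<alpha> + \<beta> * (t1 - t0)) / (R - r)"
proof (cases "norm (fst z - x0) < r")
  case True
  then show ?thesis using assms r t ab by (simp add: space_gradient_cutoff)
next
  case False
  have b: "0 \<le> \<alpha> + \<beta> * (snd z - t0)" "\<alpha> + \<beta> * (snd z - t0) \<le> \<alpha> + \<beta> * (t1 - t0)"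
    using assms ab by (auto intro: mult_left_mono)
  have "norm (space_gradient cutoff z) = 2 * (\<alpha> + \<beta> * (snd z - t0)) / (R\<^sup>2 - r\<^sup>2) * norm (fst z - x0)"
    using False assms b by (simp add: space_gradient_cutoff)
  also have "\<dots> \<le> 2 * (\<alpha> + \<beta> * (t1 - t0)) / (R\<^sup>2 - r\<^sup>2) * R"
    using b assms(1) square_diff_ge r
    by (intro mult_mono divide_right_mono) (auto simp: dist_norm norm_minus_commute)
  also have "\<dots> \<le> 2 * (\<alpha> + \<beta> * (t1 - t0)) / ((R - r) * R) * R"
    using b square_diff_ge r by (intro mult_right_mono divide_left_mono) auto
  also have "\<dots> = 2 * (\<alpha> + \<beta> * (t1 - t0)) / (R - r)" using r by simp
  finally show ?thesis .
qed

lemma AE_off_sphere: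
  fixes S :: "('a \<times> real) set"
  assumes "S \<in> sets lebesgue"
  shows "AE z in lebesgue_on S. fst z \<notin> sphere x0 r"
proof -
  have "AE z in lebesgue. (z :: 'a \<times> real) \<notin> sphere x0 r \<times> UNIV"
    by (rule AE_not_in[OF null_sets_sphere_times])
  then have "AE z in lebesgue. z \<in> S \<longrightarrow> fst z \<notin> sphere x0 r"
    by eventually_elim (auto simp: mem_Times_iff)
  then show ?thesis using assms by (simp add: AE_restrict_space_iff)
qed

lemma cutoff_in_cutoffs: "cutoff \<in> cutoffs x0 t1 ((t1 - t0) / R) R"
proof -
  let ?Q = "ball x0 R \<times> {t0<..t1}"
  have cont: "continuous_on S cutoff" for S
    unfolding cutoff_def[abs_def]
    by (intro continuous_intros continuous_on_compose2[OF continuous_on_bump[OF r]]) auto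
  have "piecewise_smooth_on ?Q cutoff"
    unfolding piecewise_smooth_on_def
  proof (intro conjI cont)
    let ?C1 = "{z :: 'a \<times> real. norm (fst z - x0) \<le> r}" and ?C2 = "{z :: 'a \<times> real. r \<le> norm (fst z - x0)}"
    have lin: "real_polynomial_function (\<lambda>z :: 'a \<times> real. \<alpha> + \<beta> * (snd z + - t0))"
      by (intro real_polynomial_function.intros(2-4) real_polynomial_function.intros(1)[OF bounded_linear_snd])
    have "real_polynomial_function ((\<lambda>x. (norm (x - x0))\<^sup>2) \<circ> (fst :: 'a \<times> real \<Rightarrow> 'a))"
      by (intro real_polynomial_function_compose polynomial_function_bounded_linear
          bounded_linear_fst real_polynomial_function_norm_square)
    then have "real_polynomial_function (\<lambda>z :: 'a \<times> real. (norm (fst z - x0))\<^sup>2)" by (simp add: o_def)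
    then have quad: "real_polynomial_function (\<lambda>z :: 'a \<times> real. (1 / (R\<^sup>2 - r\<^sup>2) * (R\<^sup>2 + (-1) * (norm (fst z - x0))\<^sup>2)) * (\<alpha> + \<beta> * (snd z + - t0)))"
      by (intro real_polynomial_function.intros(3,4) lin real_polynomial_function.intros(2))
    have C1: "closed ?C1 \<and> (\<exists>U g. open U \<and> ?C1 \<inter> ?Q \<subseteq> U \<and> smooth_on U g \<and> (\<forall>z\<in>?C1 \<inter> ?Q. cutoff z = g z))"
    proof (intro conjI exI)
      show "closed ?C1" by (intro closed_Collect_le continuous_intros)
      show "smooth_on UNIV (\<lambda>z :: 'a \<times> real. \<alpha> + \<beta> * (snd z + - t0))"
        unfolding smooth_on_def using Ck_on_polynomial[OF lin] by blast
    qed (auto simp: cutoff_def bump_inner[OF r])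
    have C2: "closed ?C2 \<and> (\<exists>U g. open U \<and> ?C2 \<inter> ?Q \<subseteq> U \<and> smooth_on U g \<and> (\<forall>z\<in>?C2 \<inter> ?Q. cutoff z = g z))"
    proof (intro conjI exI)
      show "closed ?C2" by (intro closed_Collect_le continuous_intros)
      show "smooth_on UNIV (\<lambda>z :: 'a \<times> real. (1 / (R\<^sup>2 - r\<^sup>2) * (R\<^sup>2 + (-1) * (norm (fst z - x0))\<^sup>2)) * (\<alpha> + \<beta> * (snd z + - t0)))"
        unfolding smooth_on_def using Ck_on_polynomial[OF quad] by blast
    qed (auto simp: cutoff_def bump_middle[OF r] dist_norm norm_minus_commute)
    show "\<exists>P. finite P \<and> ?Q \<subseteq> \<Union>P \<and>
       (\<forall>C\<in>P. closed C \<and> (\<exists>U g. open U \<and> C \<inter> ?Q \<subseteq> U \<and> smooth_on U g \<and> (\<forall>z\<in>C \<inter> ?Q. cutoff z = g z)))"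
      by (rule exI[of _ "{?C1, ?C2}"]) (use C1 C2 in auto)
  qed
  moreover have Q: "?Q \<in> sets lebesgue" using cylinder_sets by simp
  have "(\<lambda>z. norm (space_gradient cutoff z) + time_deriv cutoff z) \<in> Linf ?Q"
    unfolding Linf_def
  proof (intro CollectI conjI exI)
    \<comment> \<open>The explicit formula for the derivatives off the sphere, read as a Borel
      function on the whole space-time.\<close>
    define g where "g z = (if norm (fst z - x0) < r then 0
     else 2 * \<bar>\<alpha> + \<beta> * (snd z - t0)\<bar> / (R\<^sup>2 - r\<^sup>2) * norm (fst z - x0)) + bump x0 r R (fst z) * \<beta>" for z :: "'a \<times> real"
    have [measurable]: "bump x0 r R \<in> borel_measurable borel"
      by (rule borel_measurable_continuous_onI[OF continuous_on_bump[OF r]])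
    have "g \<in> borel_measurable borel"
      unfolding g_def borel_prod[symmetric] by measurable
    then have "g \<in> borel_measurable (lebesgue_on ?Q)"
      by (intro measurable_restrict_space1) (simp add: measurable_completion)
    then show "(\<lambda>z. norm (space_gradient cutoff z) + time_deriv cutoff z) \<in> borel_measurable (lebesgue_on ?Q)"
      by (rule borel_measurable_lebesgue_on_eq_off_null[OF Q _ null_sets_sphere_times[of x0 r]])
        (auto simp: g_def time_deriv_cutoff space_gradient_cutoff mem_Times_iff)
    show "AE z in lebesgue_on ?Q. \<bar>norm (space_gradient cutoff z) + time_deriv cutoff z\<bar>
        \<le> 2 * (\<alpha> + \<beta> * (t1 - t0)) / (R - r) + \<beta>"
      using AE_off_sphere[OF Q] AE_space[of "lebesgue_on ?Q"]
    proof eventually_elim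
      fix z assume "fst z \<notin> sphere x0 r" "z \<in> space (lebesgue_on ?Q)"
      then have "norm (space_gradient cutoff z) \<le> 2 * (\<alpha> + \<beta> * (t1 - t0)) / (R - r)"
        by (intro space_gradient_cutoff_le) auto
      moreover have "0 \<le> time_deriv cutoff z" "time_deriv cutoff z \<le> \<beta>"
        unfolding time_deriv_cutoff using bump_bounds[of x0 r R "fst z"] ab
        by (auto simp: mult_left_le_one_le)
      ultimately show "\<bar>norm (space_gradient cutoff z) + time_deriv cutoff z\<bar>
        \<le> 2 * (\<alpha> + \<beta> * (t1 - t0)) / (R - r) + \<beta>" by simp
    qed
  qed
  ultimately show ?thesis
    unfolding cutoffs_def cylinder_eq
    using r t ab cont bump_bounds(1)[of x0 r R] bump_outer[OF r, of _ x0]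
    by (auto simp: time_deriv_cutoff cutoff_def[of "(_, _)"] dist_norm norm_minus_commute)
qed

end

lemma nn_integral_lebesgue_on_mono_set:
  assumes "A \<in> sets lebesgue" "B \<in> sets lebesgue" "A \<subseteq> B" and "\<And>x. x \<in> A \<Longrightarrow> f x \<le> g x"
  shows "(\<integral>\<^sup>+x. f x \<partial>lebesgue_on A) \<le> (\<integral>\<^sup>+x. g x \<partial>lebesgue_on B)"
proof -
  have "(\<integral>\<^sup>+x. f x \<partial>lebesgue_on A) = (\<integral>\<^sup>+x. f x * indicator A x \<partial>lebesgue)"
    by (rule nn_integral_restrict_space) (use assms in auto)
  also have "\<dots> \<le> (\<integral>\<^sup>+x. g x * indicator B x \<partial>lebesgue)"
    by (rule nn_integral_mono) (use assms in \<open>auto split: split_indicator\<close>)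
  also have "\<dots> = (\<integral>\<^sup>+x. g x \<partial>lebesgue_on B)"
    by (rule nn_integral_restrict_space[symmetric]) (use assms in auto)
  finally show ?thesis .
qed

text \<open>Bounds on \<open>w\<close> and on the derivatives of the cutoff reduce the right-hand
  side to a constant times the measure of \<open>A\<close>, outside which \<open>w\<close> vanishes.
  The supremum in the energy inequality runs over all times of the interval, hence the first bound
  for every single slice. The time weight stays on the left, so both kinds of cutoff are
  covered.\<close>

lemma Caccioppoli:
  fixes w :: "'a::euclidean_space \<times> real \<Rightarrow> real"
  defines "Q \<equiv> \<lambda>x0 R t0 t1. ball (x0::'a) R \<times> {t0<..t1::real}"
  assumes r: "0 < r" "r < R" and t: "t0 < t1" and ab: "0 \<le> \<alpha>" "0 \<le> \<beta>" and \<gamma>: "0 \<le> \<gamma>"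
    and en: "\<And>\<zeta>. \<zeta> \<in> cutoffs x0 t1 ((t1 - t0) / R) R \<Longrightarrow> energy_ineq \<gamma> w x0 t1 ((t1 - t0) / R) R \<zeta>"
    and w: "\<And>z. 0 \<le> w z" and w\<omega>: "AE z in lebesgue_on (Q x0 R t0 t1). w z \<le> \<omega>" and \<omega>: "0 \<le> \<omega>"
    and A: "A \<in> sets lebesgue" "\<And>z. z \<in> Q x0 R t0 t1 \<Longrightarrow> z \<notin> A \<Longrightarrow> w z = 0"
      "emeasure lebesgue A \<le> ennreal a" and a: "0 \<le> a"
    and d: "(\<integral>\<^sup>+x. ennreal (\<alpha> * (w (x, t0))\<^sup>2) \<partial>lebesgue_on (ball x0 R)) \<le> ennreal d" "0 \<le> d"
  defines "C \<equiv> \<gamma> * (2 * \<omega> / (R - r) * (\<alpha> + \<beta> * (t1 - t0)) + \<beta> * \<omega>\<^sup>2) * a + d"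
  shows "\<And>t. t \<in> {t0..t1} \<Longrightarrow>
      (\<integral>\<^sup>+x. ennreal ((\<alpha> + \<beta> * (t - t0)) * (w (x, t))\<^sup>2) \<partial>lebesgue_on (ball x0 r)) \<le> ennreal C"
    and "(\<integral>\<^sup>+t. ennreal (\<alpha> + \<beta> * (t - t0)) * total_variation (\<lambda>x. w (x, t)) (ball x0 r) \<partial>lebesgue_on {t0..t1}) \<le> ennreal C"
proof -
  define \<zeta> where "\<zeta> = (\<lambda>z. bump x0 r R (fst z) * (\<alpha> + \<beta> * (snd z - t0)))"
  have \<zeta>eq: "\<zeta> = cutoff x0 r R t0 \<alpha> \<beta>"
    unfolding \<zeta>_def by (rule ext) (simp add: cutoff_def[OF r t ab])
  have "\<zeta> \<in> cutoffs x0 t1 ((t1 - t0) / R) R"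
    unfolding \<zeta>eq by (rule cutoff_in_cutoffs[OF r t ab])
  from en[OF this] have E: "energy_ineq \<gamma> w x0 t1 ((t1 - t0) / R) R \<zeta>" .
  have t0: "t1 - (t1 - t0) / R * R = t0" using r by simp
  have cyl: "cylinder x0 t1 ((t1 - t0) / R) R = Q x0 R t0 t1"
    unfolding cylinder_def t0 Q_def by simp
  have "Q x0 R t0 t1 \<in> sets borel" unfolding Q_def by (intro borel_Times) auto
  then have Qs: "Q x0 R t0 t1 \<in> sets lebesgue" by simp
  define m where "m = 2 * \<omega> / (R - r) * (\<alpha> + \<beta> * (t1 - t0)) + \<beta> * \<omega>\<^sup>2"
  have m: "0 \<le> m" unfolding m_def using \<omega> r ab t by (auto intro!: add_nonneg_nonneg mult_nonneg_nonneg divide_nonneg_nonneg)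
  have "(\<integral>\<^sup>+ z. ennreal (w z * norm (space_gradient \<zeta> z) + (w z)\<^sup>2 * \<bar>time_deriv \<zeta> z\<bar>) \<partial>lebesgue_on (Q x0 R t0 t1))
      \<le> (\<integral>\<^sup>+ z. ennreal m * indicator A z \<partial>lebesgue_on (Q x0 R t0 t1))"
  proof (rule nn_integral_mono_AE)
    show "AE z in lebesgue_on (Q x0 R t0 t1). ennreal (w z * norm (space_gradient \<zeta> z) + (w z)\<^sup>2 * \<bar>time_deriv \<zeta> z\<bar>)
       \<le> ennreal m * indicator A z"
      using w\<omega> AE_off_sphere[OF r t ab Qs] AE_space[of "lebesgue_on (Q x0 R t0 t1)"]
    proof eventually_elim
      fix z assume z: "w z \<le> \<omega>" "fst z \<notin> sphere x0 r" "z \<in> space (lebesgue_on (Q x0 R t0 t1))"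
      show "ennreal (w z * norm (space_gradient \<zeta> z) + (w z)\<^sup>2 * \<bar>time_deriv \<zeta> z\<bar>) \<le> ennreal m * indicator A z"
      proof (cases "z \<in> A")
        case True
        have g: "norm (space_gradient \<zeta> z) \<le> 2 * (\<alpha> + \<beta> * (t1 - t0)) / (R - r)"
          unfolding \<zeta>eq by (rule space_gradient_cutoff_le[OF r t ab]) (use z in \<open>auto simp: Q_def\<close>)
        have td: "\<bar>time_deriv \<zeta> z\<bar> \<le> \<beta>"
          unfolding \<zeta>eq time_deriv_cutoff[OF r t ab] using bump_bounds[of x0 r R "fst z"] ab
          by (simp add: abs_mult mult_left_le_one_le)
        have "w z * norm (space_gradient \<zeta> z) \<le> \<omega> * (2 * (\<alpha> + \<beta> * (t1 - t0)) / (R - r))"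
          by (intro mult_mono g z \<omega>) auto
        moreover have "(w z)\<^sup>2 * \<bar>time_deriv \<zeta> z\<bar> \<le> \<omega>\<^sup>2 * \<beta>"
          by (intro mult_mono td power_mono z w) auto
        moreover have eq: "2 * \<omega> / (R - r) * X + \<beta> * \<omega>\<^sup>2 = \<omega> * (2 * X / (R - r)) + \<omega>\<^sup>2 * \<beta>" for X
          by (simp add: mult_ac)
        ultimately have "w z * norm (space_gradient \<zeta> z) + (w z)\<^sup>2 * \<bar>time_deriv \<zeta> z\<bar> \<le> m"
          unfolding m_def eq by linarith
        then show ?thesis using True by (simp add: ennreal_leI)
      next
        case False
        then have "w z = 0" using A(2) z(3) by simp
        then show ?thesis by simp
      qed
    qed
  qed
  also have "\<dots> = (\<integral>\<^sup>+ z. ennreal m * indicator A z * indicator (Q x0 R t0 t1) z \<partial>lebesgue)"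
    by (rule nn_integral_restrict_space) (use Qs in auto)
  also have "\<dots> \<le> (\<integral>\<^sup>+ z. ennreal m * indicator A z \<partial>lebesgue)"
    by (rule nn_integral_mono) (auto split: split_indicator)
  also have "\<dots> = ennreal m * emeasure lebesgue A" by (rule nn_integral_cmult_indicator[OF A(1)])
  also have "\<dots> \<le> ennreal m * ennreal a" by (intro mult_left_mono A(3)) simp
  finally have "ennreal \<gamma> * (\<integral>\<^sup>+ z. ennreal (w z * norm (space_gradient \<zeta> z) + (w z)\<^sup>2 * \<bar>time_deriv \<zeta> z\<bar>) \<partial>lebesgue_on (Q x0 R t0 t1))
     \<le> ennreal \<gamma> * (ennreal m * ennreal a)" by (rule mult_left_mono) simp
  also have "\<dots> = ennreal (\<gamma> * m * a)" using \<gamma> m a by (simp add: ennreal_mult mult.assoc)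
  finally have R1: "ennreal \<gamma> * (\<integral>\<^sup>+ z. ennreal (w z * norm (space_gradient \<zeta> z) + (w z)\<^sup>2 * \<bar>time_deriv \<zeta> z\<bar>) \<partial>lebesgue_on (Q x0 R t0 t1))
     \<le> ennreal (\<gamma> * m * a)" .
  have "(\<integral>\<^sup>+ x. ennreal ((w (x, t0))\<^sup>2 * \<zeta> (x, t0)) \<partial>lebesgue_on (ball x0 R))
     \<le> (\<integral>\<^sup>+x. ennreal (\<alpha> * (w (x, t0))\<^sup>2) \<partial>lebesgue_on (ball x0 R))"
  proof (intro nn_integral_mono ennreal_leI)
    fix x
    have "bump x0 r R x * \<alpha> \<le> \<alpha>" using bump_bounds[of x0 r R x] ab by (simp add: mult_left_le_one_le)
    then have "(w (x, t0))\<^sup>2 * (bump x0 r R x * \<alpha>) \<le> (w (x, t0))\<^sup>2 * \<alpha>" by (rule mult_left_mono) simp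
    then show "(w (x, t0))\<^sup>2 * \<zeta> (x, t0) \<le> \<alpha> * (w (x, t0))\<^sup>2" by (simp add: \<zeta>_def mult.commute)
  qed
  then have R2: "(\<integral>\<^sup>+ x. ennreal ((w (x, t0))\<^sup>2 * \<zeta> (x, t0)) \<partial>lebesgue_on (ball x0 R)) \<le> ennreal d"
    using d(1) by (rule order_trans)
  have Ceq: "ennreal C = ennreal (\<gamma> * m * a) + ennreal d"
    unfolding C_def m_def[symmetric] using \<gamma> m a d by (intro ennreal_plus) auto
  have main: "(SUP t\<in>{t0..t1}. \<integral>\<^sup>+ x. ennreal ((w (x, t))\<^sup>2 * \<zeta> (x, t)) \<partial>lebesgue_on (ball x0 R))
     + (\<integral>\<^sup>+ t. total_variation (\<lambda>x. w (x, t) * \<zeta> (x, t)) (ball x0 R) \<partial>lebesgue_on {t0..t1}) \<le> ennreal C"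
    using E unfolding energy_ineq_def t0 cyl Ceq by (rule order_trans) (intro add_mono R1 R2)
  have rR: "ball x0 r \<subseteq> ball x0 R" using r by auto
  show "(\<integral>\<^sup>+x. ennreal ((\<alpha> + \<beta> * (t - t0)) * (w (x, t))\<^sup>2) \<partial>lebesgue_on (ball x0 r)) \<le> ennreal C" if "t \<in> {t0..t1}" for t
  proof -
    have "(\<integral>\<^sup>+x. ennreal ((\<alpha> + \<beta> * (t - t0)) * (w (x, t))\<^sup>2) \<partial>lebesgue_on (ball x0 r))
       \<le> (\<integral>\<^sup>+ x. ennreal ((w (x, t))\<^sup>2 * \<zeta> (x, t)) \<partial>lebesgue_on (ball x0 R))"
    proof (rule nn_integral_lebesgue_on_mono_set[OF _ _ rR])
      fix x assume "x \<in> ball x0 r"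
      then have "bump x0 r R x = 1" by (intro bump_inner[OF r]) (simp add: dist_norm norm_minus_commute)
      then show "ennreal ((\<alpha> + \<beta> * (t - t0)) * (w (x, t))\<^sup>2) \<le> ennreal ((w (x, t))\<^sup>2 * \<zeta> (x, t))"
        by (simp add: \<zeta>_def mult.commute)
    qed auto
    also have "\<dots> \<le> (SUP t\<in>{t0..t1}. \<integral>\<^sup>+ x. ennreal ((w (x, t))\<^sup>2 * \<zeta> (x, t)) \<partial>lebesgue_on (ball x0 R))"
      by (rule SUP_upper[OF that])
    also have "\<dots> \<le> ennreal C" by (rule order_trans[OF _ main]) simp
    finally show ?thesis .
  qed
  have "(\<integral>\<^sup>+t. ennreal (\<alpha> + \<beta> * (t - t0)) * total_variation (\<lambda>x. w (x, t)) (ball x0 r) \<partial>lebesgue_on {t0..t1})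
     \<le> (\<integral>\<^sup>+ t. total_variation (\<lambda>x. w (x, t) * \<zeta> (x, t)) (ball x0 R) \<partial>lebesgue_on {t0..t1})"
  proof (rule nn_integral_lebesgue_on_mono_set)
    fix t assume "t \<in> {t0..t1}"
    then show "ennreal (\<alpha> + \<beta> * (t - t0)) * total_variation (\<lambda>x. w (x, t)) (ball x0 r)
      \<le> total_variation (\<lambda>x. w (x, t) * \<zeta> (x, t)) (ball x0 R)"
      unfolding \<zeta>_def fst_conv snd_conv
      by (intro total_variation_cutoff bump_inner[OF r])
        (use r ab in \<open>auto simp: dist_norm norm_minus_commute\<close>)
  qed auto
  also have "\<dots> \<le> ennreal C" by (rule order_trans[OF _ main]) simp
  finally show "(\<integral>\<^sup>+t. ennreal (\<alpha> + \<beta> * (t - t0)) * total_variation (\<lambda>x. w (x, t)) (ball x0 r) \<partial>lebesgue_on {t0..t1}) \<le> ennreal C" .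
qed

text \<open>Fubini is applied only to a Borel part of \<open>S\<close> of full measure, whose slices
  have a measure that lies below \<open>g\<close>. Hence \<open>g\<close> may be nonmeasurable, as
  the total variation of a slice might be.\<close>

lemma emeasure_lebesgue_le_slices:
  fixes S :: "('a::euclidean_space \<times> real) set"
  assumes S: "S \<in> sets lebesgue"
    and slice: "\<And>t. {x. (x, t) \<in> S} \<in> sets lebesgue"
    and le: "\<And>t. emeasure lebesgue {x. (x, t) \<in> S} \<le> g t"
  shows "emeasure lebesgue S \<le> (\<integral>\<^sup>+t. g t \<partial>lebesgue)"
proof -
  obtain B N N' where B: "S = B \<union> N" "N \<subseteq> N'" "N' \<in> null_sets lborel" "B \<in> sets lborel"
    using S by (rule sets_completionE)
  have B': "B \<in> sets (lborel \<Otimes>\<^sub>M lborel)" using B(4) by (simp only: lborel_prod)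
  have "emeasure lebesgue S = emeasure lborel B"
  proof -
    have "N \<in> null_sets lebesgue"
      using B(2,3) null_sets_completion_subset null_sets_completionI by blast
    then have "emeasure lebesgue (B \<union> N) = emeasure lebesgue B"
      using B(4) by (intro emeasure_Un_null_set) auto
    then show ?thesis using B(1,4) by simp
  qed
  also have "\<dots> = emeasure (lborel \<Otimes>\<^sub>M lborel) B" by (simp only: lborel_prod)
  also have "\<dots> = (\<integral>\<^sup>+t. emeasure lborel ((\<lambda>x. (x, t)) -` B) \<partial>lborel)"
    by (rule lborel_pair.emeasure_pair_measure_alt2[OF B'])
  also have "\<dots> = (\<integral>\<^sup>+t. emeasure lborel ((\<lambda>x. (x, t)) -` B) \<partial>lebesgue)"
    by (rule nn_integral_completion[symmetric])
  also have "\<dots> \<le> (\<integral>\<^sup>+t. g t \<partial>lebesgue)"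
  proof (rule nn_integral_mono)
    fix t
    have "(\<lambda>x. (x, t)) -` B \<in> sets lborel" by (rule sets_Pair2[OF B'])
    then have "emeasure lborel ((\<lambda>x. (x, t)) -` B) = emeasure lebesgue ((\<lambda>x. (x, t)) -` B)" by simp
    also have "\<dots> \<le> emeasure lebesgue {x. (x, t) \<in> S}"
      by (rule emeasure_mono[OF _ slice]) (use B(1) in auto)
    also have "\<dots> \<le> g t" by (rule le)
    finally show "emeasure lborel ((\<lambda>x. (x, t)) -` B) \<le> g t" .
  qed
  finally show ?thesis .
qed

section \<open>De Giorgi iteration for subsolutions\<close>

text \<open>No measurability of \<open>f\<close> is assumed: dividing by \<open>c\<close> a simple
  function below \<open>c\<close> times \<open>f\<close> gives one below \<open>f\<close>. This half
  of the scaling rule suffices for time integrals of the total variation.\<close>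

lemma nn_integral_cmult_le:
  assumes c: "0 < c"
  shows "(\<integral>\<^sup>+x. ennreal c * f x \<partial>M) \<le> ennreal c * (\<integral>\<^sup>+x. f x \<partial>M)"
  unfolding nn_integral_def[of M "\<lambda>x. ennreal c * f x"]
proof (rule SUP_least)
  fix g assume "g \<in> {g. simple_function M g \<and> g \<le> (\<lambda>x. ennreal c * f x)}"
  then have g: "simple_function M g" and le: "\<And>x. g x \<le> ennreal c * f x"
    by (auto simp: le_fun_def)
  have gm: "g \<in> borel_measurable M" using g by (rule borel_measurable_simple_function)
  have inv: "ennreal (1 / c) * ennreal c = 1" using c by (simp flip: ennreal_mult)
  have "integral\<^sup>S M g = (\<integral>\<^sup>+x. g x \<partial>M)" using g by (rule nn_integral_eq_simple_integral[symmetric])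
  also have "\<dots> = (\<integral>\<^sup>+x. ennreal c * (ennreal (1 / c) * g x) \<partial>M)"
    using inv by (simp add: mult.assoc[symmetric] mult.commute[of "ennreal c"])
  also have "\<dots> = ennreal c * (\<integral>\<^sup>+x. ennreal (1 / c) * g x \<partial>M)"
    by (rule nn_integral_cmult) (use gm in measurable)
  also have "\<dots> \<le> ennreal c * (\<integral>\<^sup>+x. f x \<partial>M)"
  proof (intro mult_left_mono nn_integral_mono)
    fix x
    have "ennreal (1 / c) * g x \<le> ennreal (1 / c) * (ennreal c * f x)" by (intro mult_left_mono le) simp
    then show "ennreal (1 / c) * g x \<le> f x" by (simp add: mult.assoc[symmetric] inv)
  qed simp
  finally show "integral\<^sup>S M g \<le> ennreal c * (\<integral>\<^sup>+x. f x \<partial>M)" .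
qed

text \<open>A one-sided setting satisfied by \<open>u\<close> and by \<open>- u\<close>, so that
  each upper bound proved here also yields a lower bound for \<open>u\<close>.\<close>

locale DG_subsolution =
  fixes E :: "'a::euclidean_space set" and T \<gamma> :: real and v :: "'a \<times> real \<Rightarrow> real"
  assumes open_E: "open E" and \<gamma>_pos: "0 < \<gamma>"
    and v_measurable: "v \<in> borel_measurable (lebesgue_on (E \<times> {0<..<T}))"
    and slice_L2: "\<And>E' t. open E' \<Longrightarrow> compactly_contained E' E \<Longrightarrow> t \<in> {0<..<T} \<Longrightarrow> (\<lambda>x. v (x, t)) \<in> L2 E'"
    and energy: "\<And>xo to \<theta> \<rho> k \<zeta>. 0 < \<theta> \<Longrightarrow> 0 < \<rho> \<Longrightarrow> cylinder xo to \<theta> \<rho> \<subseteq> E \<times> {0<..<T} \<Longrightarrow>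
       0 < to - \<theta> * \<rho> \<Longrightarrow> \<zeta> \<in> cutoffs xo to \<theta> \<rho> \<Longrightarrow> energy_ineq \<gamma> (\<lambda>z. trunc_pos k (v z)) xo to \<theta> \<rho> \<zeta>"
begin

lemma slice_ball:
  assumes "cball x0 R \<subseteq> E" "t \<in> {0<..<T}"
  shows "(\<lambda>x. v (x, t)) \<in> L2 (ball x0 R)"
proof (rule slice_L2[OF open_ball _ assms(2)])
  have "compact (closure (ball x0 R))" by (rule compact_closure[THEN iffD2]) simp
  moreover have "closure (ball x0 R) \<subseteq> cball x0 R"
    by (rule closure_minimal) auto
  ultimately show "compactly_contained (ball x0 R) E"
    using assms(1) unfolding compactly_contained_def by blast
qed

lemma slice_measurable:
  assumes "cball x0 R \<subseteq> E" "t \<in> {0<..<T}"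
  shows "(\<lambda>x. v (x, t)) \<in> borel_measurable (lebesgue_on (ball x0 R))"
  using slice_ball[OF assms] by (simp add: L2_def)

lemma slice_superlevel_sets:
  assumes "cball x0 R \<subseteq> E" "t \<in> {0<..<T}"
  shows "{x \<in> ball x0 R. k < v (x, t)} \<in> sets lebesgue"
proof -
  have "{x \<in> space (lebesgue_on (ball x0 R)). k < v (x, t)} \<in> sets (lebesgue_on (ball x0 R))"
    using slice_measurable[OF assms] by measurable
  then show ?thesis by (simp add: sets_restrict_space_iff)
qed

lemma superlevel_sets:
  assumes "S \<in> sets borel" "S \<subseteq> E \<times> {0<..<T}"
  shows "{z \<in> S. k < v z} \<in> sets lebesgue"
proof -
  have "E \<times> {0<..<T} \<in> sets borel" by (intro borel_open open_Times open_E) simp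
  then have D: "E \<times> {0<..<T} \<in> sets lebesgue" by simp
  have "{z \<in> space (lebesgue_on (E \<times> {0<..<T})). k < v z} \<in> sets (lebesgue_on (E \<times> {0<..<T}))"
    using v_measurable by measurable
  then have "{z \<in> E \<times> {0<..<T}. k < v z} \<in> sets lebesgue"
    using D by (simp add: sets_restrict_space_iff)
  then have "{z \<in> E \<times> {0<..<T}. k < v z} \<inter> S \<in> sets lebesgue"
    by (rule sets.Int) (use assms(1) in simp)
  moreover have "{z \<in> E \<times> {0<..<T}. k < v z} \<inter> S = {z \<in> S. k < v z}" using assms(2) by auto
  ultimately show ?thesis by simp
qed

lemma cylinder_domain:
  assumes "cball x0 R \<subseteq> E" "0 < t0" "t1 < T"
  shows "ball x0 R \<times> {t0<..t1} \<subseteq> E \<times> {0<..<T}"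
proof -
  have "ball x0 R \<subseteq> E" using ball_subset_cball assms(1) by blast
  then show ?thesis using assms(2,3) by auto
qed

lemma energy_cylinder:
  assumes "0 < R" "cball x0 R \<subseteq> E" "0 < t0" "t0 < t1" "t1 < T"
    and "\<zeta> \<in> cutoffs x0 t1 ((t1 - t0) / R) R"
  shows "energy_ineq \<gamma> (\<lambda>z. trunc_pos k (v z)) x0 t1 ((t1 - t0) / R) R \<zeta>"
proof (rule energy[OF _ \<open>0 < R\<close> _ _ assms(6)])
  have "t1 - (t1 - t0) / R * R = t0" using assms(1) by simp
  then show "0 < t1 - (t1 - t0) / R * R" "cylinder x0 t1 ((t1 - t0) / R) R \<subseteq> E \<times> {0<..<T}"
    using assms(3) cylinder_domain[OF assms(2,3,5)] by (auto simp: cylinder_def)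
  show "0 < (t1 - t0) / R" using assms by simp
qed

lemma trunc_pos_nonneg: "0 \<le> trunc_pos k y"
  by (simp add: trunc_pos_def)

lemma emeasure_superlevel_le_time:
  assumes R: "cball x0 R \<subseteq> E" and t: "0 < t0" "t0 < t1" "t1 < T" and Y: "0 \<le> Y"
    and le: "\<And>t. t \<in> {t0..t1} \<Longrightarrow> emeasure lebesgue {x \<in> ball x0 R. k < v (x, t)} \<le> ennreal Y"
  shows "emeasure lebesgue {z \<in> ball x0 R \<times> {t0<..t1}. k < v z} \<le> ennreal ((t1 - t0) * Y)"
proof -
  let ?S = "{z \<in> ball x0 R \<times> {t0<..t1}. k < v z}"
  have slice: "{x. (x, t) \<in> ?S} = (if t \<in> {t0<..t1} then {x \<in> ball x0 R. k < v (x, t)} else {})" for t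
    by auto
  have "emeasure lebesgue ?S \<le> (\<integral>\<^sup>+t. ennreal Y * indicator {t0<..t1} t \<partial>lebesgue)"
  proof (rule emeasure_lebesgue_le_slices)
    show "?S \<in> sets lebesgue"
      by (rule superlevel_sets[OF _ cylinder_domain[OF R t(1,3)]]) (intro borel_Times; simp)
    show "{x. (x, t) \<in> ?S} \<in> sets lebesgue" for t
      unfolding slice using slice_superlevel_sets[OF R, of t] t by auto
    show "emeasure lebesgue {x. (x, t) \<in> ?S} \<le> ennreal Y * indicator {t0<..t1} t" for t
      unfolding slice using le[of t] by auto
  qed
  also have "\<dots> = ennreal Y * emeasure lebesgue {t0<..t1}"
    by (rule nn_integral_cmult_indicator) simp
  also have "\<dots> = ennreal ((t1 - t0) * Y)"
    using t Y by (simp add: ennreal_mult[symmetric] mult.commute)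
  finally show ?thesis .
qed

text \<open>The cutoff independent of time, followed by Chebyshev's inequality. The old measure
  bound \<open>Y\<close> reappears multiplied by \<open>t1 - t0\<close>, so a short time interval
  gains a small factor, at the price of the initial energy \<open>d\<close>.\<close>

lemma superlevel_step_time_slices:
  assumes r: "0 < r" "r < R" and R: "cball x0 R \<subseteq> E" and t: "0 < t0" "t0 < t1" "t1 < T"
    and \<omega>: "0 \<le> \<omega>" "AE z in lebesgue_on (ball x0 R \<times> {t0<..t1}). trunc_pos k (v z) \<le> \<omega>"
    and Y: "0 \<le> Y" "\<And>t. t \<in> {t0..t1} \<Longrightarrow> emeasure lebesgue {x \<in> ball x0 R. k < v (x, t)} \<le> ennreal Y"
    and d: "0 \<le> d" "(\<integral>\<^sup>+x. ennreal ((trunc_pos k (v (x, t0)))\<^sup>2) \<partial>lebesgue_on (ball x0 R)) \<le> ennreal d"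
    and h: "0 < h" and t': "t \<in> {t0..t1}"
  shows "emeasure lebesgue {x \<in> ball x0 r. k + h < v (x, t)}
     \<le> ennreal ((\<gamma> * (2 * \<omega> / (R - r)) * ((t1 - t0) * Y) + d) / h\<^sup>2)"
proof -
  let ?A = "{z \<in> ball x0 R \<times> {t0<..t1}. k < v z}"
  have A: "?A \<in> sets lebesgue"
    by (rule superlevel_sets[OF _ cylinder_domain[OF R t(1,3)]]) (intro borel_Times; simp)
  have rR: "cball x0 r \<subseteq> E" using R r by (meson cball_subset_cball_iff order_trans subset_cball less_imp_le)
  have t'T: "t \<in> {0<..<T}" using t t' by auto
  define C where "C = \<gamma> * (2 * \<omega> / (R - r)) * ((t1 - t0) * Y) + d"
  have C: "0 \<le> C" unfolding C_def using \<omega> r t Y d \<gamma>_pos by (auto intro!: add_nonneg_nonneg mult_nonneg_nonneg)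
  have "(\<integral>\<^sup>+x. ennreal ((1 + 0 * (t - t0)) * (trunc_pos k (v (x, t)))\<^sup>2) \<partial>lebesgue_on (ball x0 r))
     \<le> ennreal (\<gamma> * (2 * \<omega> / (R - r) * (1 + 0 * (t1 - t0)) + 0 * \<omega>\<^sup>2) * ((t1 - t0) * Y) + d)"
    by (rule Caccioppoli(1)[OF r t(2) _ _ _ energy_cylinder _ \<omega>(2,1) A _
          emeasure_superlevel_le_time[OF R t Y]])
      (use r R t Y d t' \<gamma>_pos in \<open>auto simp: trunc_pos_def\<close>)
  then have E: "(\<integral>\<^sup>+x. ennreal ((trunc_pos k (v (x, t)))\<^sup>2) \<partial>lebesgue_on (ball x0 r)) \<le> ennreal C"
    unfolding C_def by simp
  let ?S = "{x \<in> ball x0 r. k + h < v (x, t)}"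
  have S: "?S \<in> sets lebesgue" by (rule slice_superlevel_sets[OF rR t'T])
  have "ennreal (h\<^sup>2) * emeasure lebesgue ?S = (\<integral>\<^sup>+x. ennreal (h\<^sup>2) * indicator ?S x \<partial>lebesgue)"
    by (rule nn_integral_cmult_indicator[OF S, symmetric])
  also have "\<dots> \<le> (\<integral>\<^sup>+x. ennreal ((trunc_pos k (v (x, t)))\<^sup>2) * indicator (ball x0 r) x \<partial>lebesgue)"
  proof (rule nn_integral_mono)
    fix x
    have "h\<^sup>2 \<le> (trunc_pos k (v (x, t)))\<^sup>2" if "x \<in> ?S"
      using that h by (intro power_mono) (auto simp: trunc_pos_def)
    then show "ennreal (h\<^sup>2) * indicator ?S x \<le> ennreal ((trunc_pos k (v (x, t)))\<^sup>2) * indicator (ball x0 r) x"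
      by (auto split: split_indicator intro: ennreal_leI)
  qed
  also have "\<dots> = (\<integral>\<^sup>+x. ennreal ((trunc_pos k (v (x, t)))\<^sup>2) \<partial>lebesgue_on (ball x0 r))"
    by (rule nn_integral_restrict_space[symmetric]) auto
  also note E
  finally have *: "ennreal (h\<^sup>2) * emeasure lebesgue ?S \<le> ennreal C" .
  have "emeasure lebesgue ?S = ennreal (1 / h\<^sup>2) * (ennreal (h\<^sup>2) * emeasure lebesgue ?S)"
    using h by (simp add: mult.assoc[symmetric] flip: ennreal_mult)
  also have "\<dots> \<le> ennreal (1 / h\<^sup>2) * ennreal C" by (intro mult_left_mono *) simp
  also have "\<dots> = ennreal (C / h\<^sup>2)" using C by (simp flip: ennreal_mult)
  finally show ?thesis unfolding C_def .
qed

text \<open>The cutoff vanishing at \<open>t0\<close> removes the initial term. The energy then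
  serves twice: it bounds the square integral of each slice, which permits the isoperimetric gain on
  that slice, and it bounds the time integral of the variation, which sums these gains.\<close>

lemma superlevel_step_DeGiorgi:
  assumes r: "0 < r'" "r' < r" "r < R" and R: "cball x0 R \<subseteq> E"
    and t: "0 < t0" "t0 < t'" "t' < t1" "t1 < T"
    and \<omega>: "0 \<le> \<omega>" "AE z in lebesgue_on (ball x0 R \<times> {t0<..t1}). trunc_pos k (v z) \<le> \<omega>"
    and a: "0 \<le> a" "emeasure lebesgue {z \<in> ball x0 R \<times> {t0<..t1}. k < v z} \<le> ennreal a"
    and C: "\<gamma> * (2 * \<omega> / (R - r) * ((t1 - t0) / (t' - t0)) + \<omega>\<^sup>2 / (t' - t0)) * a \<le> C"
    and p: "0 < p" "r' + p \<le> r" and l: "0 < l"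
    and Cl: "C \<le> l\<^sup>2 * unit_ball_vol (real DIM('a)) * p ^ DIM('a) / 2"
  shows "emeasure lebesgue {z \<in> ball x0 r' \<times> {t'<..t1}. k + l < v z} \<le> ennreal (4 * p * C / l)"
proof -
  let ?A = "{z \<in> ball x0 R \<times> {t0<..t1}. k < v z}"
  let ?w = "\<lambda>t x. trunc_pos k (v (x, t))"
  \<comment> \<open>With this slope the time weight reaches 1 exactly at \<open>t'\<close>.\<close>
  define \<beta> where "\<beta> = 1 / (t' - t0)"
  have \<beta>: "0 \<le> \<beta>" "\<And>t. t \<in> {t'..t1} \<Longrightarrow> 1 \<le> \<beta> * (t - t0)" unfolding \<beta>_def using t by (auto simp: field_simps)
  have A: "?A \<in> sets lebesgue"
    by (rule superlevel_sets[OF _ cylinder_domain[OF R t(1,4)]]) (intro borel_Times; simp)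
  have rR: "cball x0 r \<subseteq> E" "cball x0 r' \<subseteq> E"
    using R r by (meson order_trans subset_cball less_imp_le)+
  have t01: "t0 < t1" using t by simp
  have "0 \<le> \<gamma> * (2 * \<omega> / (R - r) * ((t1 - t0) / (t' - t0)) + \<omega>\<^sup>2 / (t' - t0)) * a"
    using \<omega> r t a \<gamma>_pos by (auto intro!: add_nonneg_nonneg mult_nonneg_nonneg divide_nonneg_nonneg)
  then have C0: "0 \<le> C" using C by linarith
  have eq: "\<gamma> * (2 * \<omega> / (R - r) * (0 + \<beta> * (t1 - t0)) + \<beta> * \<omega>\<^sup>2) * a + 0
    = \<gamma> * (2 * \<omega> / (R - r) * ((t1 - t0) / (t' - t0)) + \<omega>\<^sup>2 / (t' - t0)) * a"
    by (simp add: \<beta>_def)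
  have E1: "(\<integral>\<^sup>+x. ennreal ((?w t x)\<^sup>2) \<partial>lebesgue_on (ball x0 r)) \<le> ennreal C" if tt: "t \<in> {t'..t1}" for t
  proof -
    have "(\<integral>\<^sup>+x. ennreal ((?w t x)\<^sup>2) \<partial>lebesgue_on (ball x0 r))
       \<le> (\<integral>\<^sup>+x. ennreal ((0 + \<beta> * (t - t0)) * (?w t x)\<^sup>2) \<partial>lebesgue_on (ball x0 r))"
    proof (intro nn_integral_mono ennreal_leI)
      fix x
      show "(?w t x)\<^sup>2 \<le> (0 + \<beta> * (t - t0)) * (?w t x)\<^sup>2"
        using mult_right_mono[OF \<beta>(2)[OF tt], of "(?w t x)\<^sup>2"] by simp
    qed
    also have "\<dots> \<le> ennreal (\<gamma> * (2 * \<omega> / (R - r) * (0 + \<beta> * (t1 - t0)) + \<beta> * \<omega>\<^sup>2) * a + 0)"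
      by (rule Caccioppoli(1)[OF _ r(3) t01 _ \<beta>(1) _ energy_cylinder _ \<omega>(2,1) A _ a(2,1)])
        (use r R t tt \<gamma>_pos in \<open>auto simp: trunc_pos_def\<close>)
    also have "\<dots> \<le> ennreal C" unfolding eq by (rule ennreal_leI[OF C])
    finally show ?thesis .
  qed
  have "(\<integral>\<^sup>+t. ennreal (0 + \<beta> * (t - t0)) * total_variation (?w t) (ball x0 r) \<partial>lebesgue_on {t0..t1})
     \<le> ennreal (\<gamma> * (2 * \<omega> / (R - r) * (0 + \<beta> * (t1 - t0)) + \<beta> * \<omega>\<^sup>2) * a + 0)"
    by (rule Caccioppoli(2)[OF _ r(3) t01 _ \<beta>(1) _ energy_cylinder _ \<omega>(2,1) A _ a(2,1)])
      (use r R t \<gamma>_pos in \<open>auto simp: trunc_pos_def\<close>)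
  also have "\<dots> \<le> ennreal C" unfolding eq by (rule ennreal_leI[OF C])
  finally have E2: "(\<integral>\<^sup>+t. ennreal (\<beta> * (t - t0)) * total_variation (?w t) (ball x0 r) \<partial>lebesgue_on {t0..t1}) \<le> ennreal C"
    by simp
  have slice_le: "emeasure lebesgue {x \<in> ball x0 r'. k + l < v (x, t)} \<le> ennreal (4 * p / l) * total_variation (?w t) (ball x0 r)"
    if tt: "t \<in> {t'..t1}" for t
  proof (cases "total_variation (?w t) (ball x0 r)")
    case (real V)
    have m: "?w t \<in> borel_measurable (lebesgue_on (ball x0 r))"
      using slice_measurable[OF rR(1), of t] tt t unfolding trunc_pos_def by auto
    have "ennreal (l / 4) * emeasure lebesgue {x \<in> ball x0 r'. l < ?w t x} \<le> ennreal (p * V)"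
    proof (rule total_variation_superlevel[OF m trunc_pos_nonneg _ real(1) r(1) p l])
      show "(\<integral>\<^sup>+x. ennreal ((?w t x)\<^sup>2) \<partial>lebesgue_on (ball x0 r))
         \<le> ennreal (l\<^sup>2 * unit_ball_vol (real DIM('a)) * p ^ DIM('a) / 2)"
        by (rule order_trans[OF E1[OF tt] ennreal_leI[OF Cl]])
    qed (simp add: real)
    moreover have "{x \<in> ball x0 r'. l < ?w t x} = {x \<in> ball x0 r'. k + l < v (x, t)}"
      using l by (auto simp: trunc_pos_def)
    ultimately have *: "ennreal (l / 4) * emeasure lebesgue {x \<in> ball x0 r'. k + l < v (x, t)} \<le> ennreal (p * V)"
      by simp
    have "emeasure lebesgue {x \<in> ball x0 r'. k + l < v (x, t)}
        = ennreal (4 / l) * (ennreal (l / 4) * emeasure lebesgue {x \<in> ball x0 r'. k + l < v (x, t)})"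
      using l by (simp add: mult.assoc[symmetric] flip: ennreal_mult)
    also have "\<dots> \<le> ennreal (4 / l) * ennreal (p * V)" by (intro mult_left_mono *) simp
    also have "\<dots> = ennreal (4 * p / l) * ennreal V"
      using l p real by (simp flip: ennreal_mult)
    finally show ?thesis using real by simp
  next
    case top
    have "ennreal (4 * p / l) * top = top" using p l by (simp add: ennreal_mult_eq_top_iff)
    then show ?thesis by (simp add: top)
  qed
  let ?S = "{z \<in> ball x0 r' \<times> {t'<..t1}. k + l < v z}"
  have slice: "{x. (x, t) \<in> ?S} = (if t \<in> {t'<..t1} then {x \<in> ball x0 r'. k + l < v (x, t)} else {})" for t
    by auto
  have "emeasure lebesgue ?S \<le> (\<integral>\<^sup>+t. ennreal (4 * p / l) * (total_variation (?w t) (ball x0 r) * indicator {t'<..t1} t) \<partial>lebesgue)"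
  proof (rule emeasure_lebesgue_le_slices)
    show "?S \<in> sets lebesgue"
      by (rule superlevel_sets[OF _ cylinder_domain[OF rR(2) _ t(4)]]) (use t in \<open>auto intro!: borel_Times\<close>)
    show "{x. (x, t) \<in> ?S} \<in> sets lebesgue" for t
      unfolding slice using slice_superlevel_sets[OF rR(2), of t] t by auto
    show "emeasure lebesgue {x. (x, t) \<in> ?S} \<le> ennreal (4 * p / l) * (total_variation (?w t) (ball x0 r) * indicator {t'<..t1} t)" for t
      unfolding slice using slice_le[of t] by auto
  qed
  also have "\<dots> \<le> ennreal (4 * p / l) * (\<integral>\<^sup>+t. total_variation (?w t) (ball x0 r) * indicator {t'<..t1} t \<partial>lebesgue)"
    by (rule nn_integral_cmult_le) (use p l in simp)
  also have "(\<integral>\<^sup>+t. total_variation (?w t) (ball x0 r) * indicator {t'<..t1} t \<partial>lebesgue)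
      = (\<integral>\<^sup>+t. total_variation (?w t) (ball x0 r) \<partial>lebesgue_on {t'<..t1})"
    by (rule nn_integral_restrict_space[symmetric]) simp
  also have "\<dots> \<le> (\<integral>\<^sup>+t. ennreal (\<beta> * (t - t0)) * total_variation (?w t) (ball x0 r) \<partial>lebesgue_on {t0..t1})"
  proof (rule nn_integral_lebesgue_on_mono_set)
    fix t assume "t \<in> {t'<..t1}"
    then have "ennreal 1 \<le> ennreal (\<beta> * (t - t0))" using \<beta>(2)[of t] by (intro ennreal_leI) auto
    then show "total_variation (?w t) (ball x0 r) \<le> ennreal (\<beta> * (t - t0)) * total_variation (?w t) (ball x0 r)"
      using mult_right_mono[of "ennreal 1" "ennreal (\<beta> * (t - t0))" "total_variation (?w t) (ball x0 r)"] by simp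
  qed (use t in auto)
  also note E2
  also have "ennreal (4 * p / l) * ennreal C = ennreal (4 * p * C / l)"
    using p l C0 by (simp flip: ennreal_mult)
  finally show ?thesis by (simp add: mult_left_mono)
qed

end

lemma AE_lebesgue_on_subset:
  assumes "AE z in lebesgue_on B. P z" "A \<subseteq> B" "A \<in> sets lebesgue" "B \<in> sets lebesgue"
  shows "AE z in lebesgue_on A. P z"
proof -
  have "AE z in lebesgue. z \<in> B \<longrightarrow> P z" using assms by (simp add: AE_restrict_space_iff)
  then have "AE z in lebesgue. z \<in> A \<longrightarrow> P z" by eventually_elim (use assms(2) in auto)
  then show ?thesis using assms by (simp add: AE_restrict_space_iff)
qed

lemma cylinder_lebesgue: "ball (x0 :: 'a::euclidean_space) R \<times> {t0<..t1::real} \<in> sets lebesgue"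
proof -
  have "ball x0 R \<times> {t0<..t1} \<in> sets borel" by (intro borel_Times) auto
  then show ?thesis by simp
qed

context DG_subsolution
begin

text \<open>De Giorgi's iteration. Instead of the usual recursion \<open>a\<^sub>j\<^sub>+\<^sub>1 \<le> C\<^sup>j a\<^sub>j\<^sup>1\<^sup>+\<^sup>1\<^sup>/\<^sup>N\<close>, the averaging radius
  \<open>p\<^sub>j = r\<^sub>0 8\<^sup>-\<^sup>j\<close> of the isoperimetric gain is prescribed, and the measures decay like \<open>a q\<^sup>j\<close>.\<close>

lemma DeGiorgi_iteration:
  assumes R: "0 < R" "cball x0 R \<subseteq> E" and t: "0 < s" "0 < \<tau>" "s + \<tau> < T" and H: "0 < H"
    and \<omega>: "0 \<le> \<omega>" "AE z in lebesgue_on (ball x0 R \<times> {s<..s + \<tau>}). trunc_pos k (v z) \<le> \<omega>"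
    and a: "0 \<le> a" "emeasure lebesgue {z \<in> ball x0 R \<times> {s<..s + \<tau>}. k < v z} \<le> ennreal a"
    and \<Lambda>: "\<Lambda> = \<gamma> * (64 * \<omega> / R + 4 * \<omega>\<^sup>2 / \<tau>)"
    and r0: "0 < r0" "r0 \<le> R / 16" "8 * r0 * \<Lambda> / H \<le> 1 / (16 * 8 ^ DIM('a))"
    and small: "\<Lambda> * a \<le> H\<^sup>2 * r0 ^ DIM('a) * unit_ball_vol (real DIM('a)) / 32"
  shows "AE z in lebesgue_on (ball x0 (R / 2) \<times> {s + \<tau> / 2<..s + \<tau>}). v z \<le> k + H"
proof -
  define \<kappa> where "\<kappa> = unit_ball_vol (real DIM('a))"
  have \<kappa>: "0 < \<kappa>" unfolding \<kappa>_def by simp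
  \<comment> \<open>The ratio satisfies \<open>4 * q = (1 / 4) * (1 / 8) ^ DIM('a)\<close>. The
    energy constant grows by 4 in each step, the squares of the level increments shrink by 4 and the
    volumes of the averaging balls by \<open>8 ^ DIM('a)\<close>; so the threshold of the
    isoperimetric gain, once met, is met at every \<open>j\<close>.\<close>
  define q where "q = 1 / (16 * 8 ^ DIM('a) :: real)"
  have q: "0 < q" "q \<le> 1 / 16" unfolding q_def by (auto simp: field_simps)
  have \<Lambda>0: "0 \<le> \<Lambda>" unfolding \<Lambda> using \<gamma>_pos \<omega> R t by (auto intro!: add_nonneg_nonneg mult_nonneg_nonneg)
  define e :: "nat \<Rightarrow> real" where "e j = (1 / 2) ^ j" for j
  have e: "0 < e j" "e j \<le> 1" "e (Suc j) = e j / 2" for j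
    unfolding e_def by (auto intro: power_le_one)
  \<comment> \<open>Radii decrease from \<open>R\<close> to \<open>R / 2\<close>, initial times
    increase from \<open>s\<close> to \<open>s + \<tau> / 2\<close>, and levels increase from
    \<open>k\<close> to \<open>k + H\<close>.\<close>
  define Rj where "Rj j = R / 2 * (1 + e j)" for j
  define tj where "tj j = s + \<tau> / 2 * (1 - e j)" for j
  define kj where "kj j = k + H * (1 - e j)" for j
  define S where "S j = {z \<in> ball x0 (Rj j) \<times> {tj j<..s + \<tau>}. kj j < v z}" for j
  have RjR: "Rj j \<le> R" "0 < Rj j" for j
    unfolding Rj_def using e[of j] R by (auto simp: field_simps mult_left_le intro: add_pos_pos)
  have tjs: "s \<le> tj j" "tj j < s + \<tau>" for j
    unfolding tj_def using e[of j] t by (auto simp: field_simps mult_left_le add_strict_increasing)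
  have "emeasure lebesgue (S j) \<le> ennreal (a * q ^ j)" for j
  proof (induction j)
    case 0
    show ?case using a(2) unfolding S_def Rj_def tj_def kj_def e_def by simp
  next
    case (Suc j)
    define l where "l = H * e j / 2"
    \<comment> \<open>The factor 8 is 4 times 2: it offsets the growth of \<open>C\<close> by
      \<open>4 ^ j\<close> and the division by a level increment of order \<open>e j\<close>, so the
      measure contracts by the same \<open>q\<close> in every step.\<close>
    define p where "p = r0 * (1 / 8) ^ j"
    define C where "C = (4 ^ j) * \<Lambda> * (a * q ^ j)"
    have l: "0 < l" unfolding l_def using H e by simp
    have p: "0 < p" unfolding p_def using r0 by simp
    have e8: "(1 / 8) ^ j \<le> e j" unfolding e_def by (intro power_mono) auto
    have "Rj j - Rj (Suc j) = R * e j / 4" unfolding Rj_def e(3) by (simp add: field_simps)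
    moreover have "0 < R * e j / 4" using R e by simp
    \<comment> \<open>The midpoint splits the gap between consecutive radii: the outer half carries
      the spatial cutoff, the inner half leaves room for the averaging radius
      \<open>p\<close>.\<close>
    ultimately have r: "0 < Rj (Suc j)" "Rj (Suc j) < (Rj j + Rj (Suc j)) / 2" "(Rj j + Rj (Suc j)) / 2 < Rj j"
      using RjR(2)[of "Suc j"] by auto
    have gapR: "Rj j - (Rj j + Rj (Suc j)) / 2 = R * e j / 8"
      "(Rj j + Rj (Suc j)) / 2 - Rj (Suc j) = R * e j / 8"
      unfolding Rj_def e(3) by (auto simp: field_simps)
    have gapt: "tj (Suc j) - tj j = \<tau> * e j / 4" unfolding tj_def e(3) by (simp add: field_simps)
    have "0 < \<tau> * e j / 4" using e(1)[of j] t by simp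
    then have "tj (Suc j) < s + \<tau>" "tj j < tj (Suc j)" using tjs(2)[of "Suc j"] gapt by auto
    note tt = less_le_trans[OF t(1) tjs(1)[of j]] this(2,1) t(3)
    have RE: "cball x0 (Rj j) \<subseteq> E" using R(2) RjR(1)[of j] by (meson order_trans subset_cball)
    have kk: "k \<le> kj j" unfolding kj_def using H e(2)[of j] by simp
    have sub: "ball x0 (Rj j) \<times> {tj j<..s + \<tau>} \<subseteq> ball x0 R \<times> {s<..s + \<tau>}"
      using RjR(1)[of j] tjs(1)[of j] by auto
    have "AE z in lebesgue_on (ball x0 (Rj j) \<times> {tj j<..s + \<tau>}). trunc_pos k (v z) \<le> \<omega>"
      by (rule AE_lebesgue_on_subset[OF \<omega>(2) sub cylinder_lebesgue cylinder_lebesgue])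
    then have \<omega>j: "AE z in lebesgue_on (ball x0 (Rj j) \<times> {tj j<..s + \<tau>}). trunc_pos (kj j) (v z) \<le> \<omega>"
      by eventually_elim (use kk in \<open>auto simp: trunc_pos_def\<close>)
    have aq: "0 \<le> a * q ^ j" using a q by simp
    have inv_e: "1 / e j = 2 ^ j" unfolding e_def by (simp add: power_one_over)
    have "2 * \<omega> / (R * e j / 8) * ((s + \<tau> - tj j) / (\<tau> * e j / 4)) \<le> 2 * \<omega> / (R * e j / 8) * (\<tau> / (\<tau> * e j / 4))"
      using tjs(1)[of j] e(1)[of j] \<omega> R t by (intro mult_left_mono divide_right_mono) auto
    also have "\<dots> = 64 * \<omega> / R * (1 / e j) * (1 / e j)" using t by simp
    also have "\<dots> = 4 ^ j * (64 * \<omega> / R)" unfolding inv_e by (simp flip: power_mult_distrib)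
    finally have c1: "2 * \<omega> / (R * e j / 8) * ((s + \<tau> - tj j) / (\<tau> * e j / 4)) \<le> 4 ^ j * (64 * \<omega> / R)" .
    have "\<omega>\<^sup>2 / (\<tau> * e j / 4) = (1 / e j) * (4 * \<omega>\<^sup>2 / \<tau>)" by (simp add: mult.commute)
    also have "\<dots> \<le> 4 ^ j * (4 * \<omega>\<^sup>2 / \<tau>)"
      unfolding inv_e using t by (intro mult_right_mono power_mono) auto
    finally have c2: "\<omega>\<^sup>2 / (\<tau> * e j / 4) \<le> 4 ^ j * (4 * \<omega>\<^sup>2 / \<tau>)" .
    have "\<gamma> * (2 * \<omega> / (R * e j / 8) * ((s + \<tau> - tj j) / (\<tau> * e j / 4)) + \<omega>\<^sup>2 / (\<tau> * e j / 4)) * (a * q ^ j)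
       \<le> \<gamma> * (4 ^ j * (64 * \<omega> / R) + 4 ^ j * (4 * \<omega>\<^sup>2 / \<tau>)) * (a * q ^ j)"
      using aq \<gamma>_pos by (intro mult_right_mono mult_left_mono add_mono c1 c2) auto
    also have "\<dots> = C" unfolding C_def \<Lambda> by (simp add: algebra_simps)
    finally have Cle: "\<gamma> * (2 * \<omega> / (Rj j - (Rj j + Rj (Suc j)) / 2) * ((s + \<tau> - tj j) / (tj (Suc j) - tj j))
       + \<omega>\<^sup>2 / (tj (Suc j) - tj j)) * (a * q ^ j) \<le> C"
      unfolding gapR gapt .
    have "p \<le> R * e j / 8"
    proof -
      have "p \<le> R / 16 * e j" unfolding p_def using r0 e8 R by (intro mult_mono) auto
      also have "\<dots> \<le> R * e j / 8" using R e(1)[of j] by simp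
      finally show ?thesis .
    qed
    then have pr: "Rj (Suc j) + p \<le> (Rj j + Rj (Suc j)) / 2" using gapR(2) by linarith
    have qj: "4 ^ j * q ^ j = (1 / 4) ^ j * ((1 / 8) ^ j) ^ DIM('a)"
    proof -
      have "4 * q = (1 / 4) * (1 / 8) ^ DIM('a)" unfolding q_def by (simp add: power_one_over)
      then have "4 ^ j * q ^ j = (1 / 4) ^ j * ((1 / 8) ^ DIM('a)) ^ j" by (simp only: power_mult_distrib[symmetric])
      moreover have "((1 / 8 :: real) ^ DIM('a)) ^ j = ((1 / 8) ^ j) ^ DIM('a)"
        by (simp only: power_mult[symmetric] mult.commute)
      ultimately show ?thesis by (simp only:)
    qed
    have e4: "(1 / 4) ^ j = (e j)\<^sup>2"
    proof -
      have "(e j)\<^sup>2 = ((1 / 2)\<^sup>2) ^ j" unfolding e_def by (simp only: power_mult[symmetric] mult.commute)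
      then show ?thesis by (simp add: power2_eq_square)
    qed
    have "C = (\<Lambda> * a) * (4 ^ j * q ^ j)" unfolding C_def by simp
    also have "\<dots> \<le> (H\<^sup>2 * r0 ^ DIM('a) * \<kappa> / 32) * (4 ^ j * q ^ j)"
      using small q unfolding \<kappa>_def by (intro mult_right_mono) auto
    also have "\<dots> = l\<^sup>2 * \<kappa> * p ^ DIM('a) / 8"
      unfolding qj e4 l_def p_def by (simp add: power_mult_distrib field_simps)
    also have "\<dots> \<le> l\<^sup>2 * \<kappa> * p ^ DIM('a) / 2" using \<kappa> p by simp
    finally have Cl: "C \<le> l\<^sup>2 * unit_ball_vol (real DIM('a)) * p ^ DIM('a) / 2" unfolding \<kappa>_def .
    have kS: "kj j + l = kj (Suc j)" unfolding kj_def l_def e(3) by (simp add: algebra_simps)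
    have "emeasure lebesgue {z \<in> ball x0 (Rj (Suc j)) \<times> {tj (Suc j)<..s + \<tau>}. kj j + l < v z} \<le> ennreal (4 * p * C / l)"
      by (rule superlevel_step_DeGiorgi[OF r RE tt \<omega>(1) \<omega>j aq _ Cle p pr l Cl])
        (use Suc.IH in \<open>simp add: S_def\<close>)
    then have "emeasure lebesgue (S (Suc j)) \<le> ennreal (4 * p * C / l)" unfolding S_def kS .
    also have "4 * p * C / l \<le> a * q ^ Suc j"
    proof -
      have "(1 / 8) ^ j * 4 ^ j = e j" unfolding e_def by (simp flip: power_mult_distrib)
      then have "4 * p * C = 4 * r0 * \<Lambda> * (a * q ^ j) * e j" unfolding p_def C_def by (simp add: mult_ac)
      then have "4 * p * C / l = 8 * r0 * \<Lambda> / H * (a * q ^ j)"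
        unfolding l_def using e(1)[of j] by simp
      also have "\<dots> \<le> q * (a * q ^ j)" using r0(3) aq unfolding q_def[symmetric] by (rule mult_right_mono)
      finally show ?thesis by (simp add: mult_ac)
    qed
    finally show ?case by (simp add: ennreal_leI)
  qed
  note Sle = this
  let ?B = "ball x0 (R / 2) \<times> {s + \<tau> / 2<..s + \<tau>}"
  have BE: "?B \<subseteq> E \<times> {0<..<T}"
  proof (rule cylinder_domain)
    have "cball x0 (R / 2) \<subseteq> cball x0 R" using R by (intro subset_cball) simp
    then show "cball x0 (R / 2) \<subseteq> E" using R(2) by blast
  qed (use t in auto)
  let ?Z = "{z \<in> ?B. k + H < v z}"
  have Z: "?Z \<in> sets lebesgue"
    by (rule superlevel_sets[OF _ BE]) (intro borel_Times; simp)
  have Sm: "S j \<in> sets lebesgue" for j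
    unfolding S_def
  proof (rule superlevel_sets)
    show "ball x0 (Rj j) \<times> {tj j<..s + \<tau>} \<in> sets borel" by (intro borel_Times) auto
    have "cball x0 (Rj j) \<subseteq> cball x0 R" using RjR by (intro subset_cball)
    then show "ball x0 (Rj j) \<times> {tj j<..s + \<tau>} \<subseteq> E \<times> {0<..<T}"
      using R(2) t tjs(1)[of j] by (intro cylinder_domain) auto
  qed
  have "emeasure lebesgue ?Z \<le> ennreal (a * q ^ j)" for j
  proof -
    have "k + H * (1 - e j) \<le> k + H" using H e(1)[of j] by (simp add: mult_left_le)
    moreover have "R / 2 \<le> Rj j" "tj j \<le> s + \<tau> / 2"
      unfolding Rj_def tj_def using R t e(1,2)[of j] by (auto simp: field_simps mult_left_le)
    ultimately have "?Z \<subseteq> S j" unfolding S_def kj_def by auto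
    then show ?thesis using Sle[of j] by (meson emeasure_mono Sm order_trans)
  qed
  moreover have "(\<lambda>j. ennreal (a * q ^ j)) \<longlonglongrightarrow> ennreal (a * 0)"
    using q by (intro tendsto_ennrealI tendsto_intros LIMSEQ_power_zero) auto
  ultimately have "emeasure lebesgue ?Z \<le> ennreal (a * 0)"
    by (intro LIMSEQ_le_const) auto
  then have "?Z \<in> null_sets lebesgue" using Z by (simp add: null_sets_def)
  then have "AE z in lebesgue. z \<notin> ?Z" by (rule AE_not_in)
  then have "AE z in lebesgue. z \<in> ?B \<longrightarrow> v z \<le> k + H" by eventually_elim auto
  then show ?thesis by (subst AE_restrict_space_iff) (auto simp: cylinder_lebesgue)
qed

end

section \<open>Upper bounds from closeness to a constant at one time\<close>

context DG_subsolution
begin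

text \<open>\<open>B\<close> collects the radius gap \<open>\<rho> / (2 * n)\<close>, the squared
  level increment \<open>\<epsilon> / n\<close> and the time length
  \<open>\<theta> * \<rho>\<close>. Every repetition multiplies the measure by \<open>B\<close> and
  adds one copy of the initial error; \<open>B \<le> 1\<close> prevents earlier errors from growing.
  The bound is kept for all times of the interval because the next step integrates it in
  time.\<close>

lemma superlevel_bootstrap:
  fixes n :: nat
  assumes \<rho>: "0 < \<rho>" "cball x0 \<rho> \<subseteq> E" and n: "0 < n" and t: "0 < s" "0 < \<theta>" "s + \<theta> * \<rho> < T"
    and \<omega>: "0 \<le> \<omega>" "AE z in lebesgue_on (ball x0 \<rho> \<times> {s<..s + \<theta> * \<rho>}). trunc_pos c (v z) \<le> \<omega>"
    and \<epsilon>: "0 < \<epsilon>" and \<delta>: "0 \<le> \<delta>"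
      "(\<integral>\<^sup>+x. ennreal ((trunc_pos c (v (x, s)))\<^sup>2) \<partial>lebesgue_on (ball x0 \<rho>)) \<le> ennreal (\<delta> * \<rho> ^ DIM('a))"
    and B: "B = 4 * \<gamma> * \<omega> * real n ^ 3 * \<theta> / \<epsilon>\<^sup>2" "B \<le> 1"
    and i: "i \<le> n" and tt: "t' \<in> {s..s + \<theta> * \<rho>}"
  shows "emeasure lebesgue {x \<in> ball x0 (\<rho> * (1 - i / (2 * n))). c + i * (\<epsilon> / n) < v (x, t')}
     \<le> ennreal (\<rho> ^ DIM('a) * (B ^ i * unit_ball_vol (real DIM('a)) + i * ((real n)\<^sup>2 / \<epsilon>\<^sup>2 * \<delta>)))"
  using i tt
proof (induction i arbitrary: t')
  case 0
  have "emeasure lebesgue {x \<in> ball x0 \<rho>. c < v (x, t')} \<le> emeasure lebesgue (ball x0 \<rho>)"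
    by (intro emeasure_mono) auto
  also have "\<dots> = emeasure lborel (ball x0 \<rho>)" by simp
  also have "\<dots> = ennreal (unit_ball_vol (real DIM('a)) * \<rho> ^ DIM('a))"
    by (rule emeasure_ball) (use \<rho> in simp)
  finally show ?case by (simp add: mult.commute)
next
  case (Suc i)
  define R where "R = \<rho> * (1 - i / (2 * n))"
  define r where "r = \<rho> * (1 - Suc i / (2 * n))"
  define k where "k = c + i * (\<epsilon> / n)"
  define D where "D = (real n)\<^sup>2 / \<epsilon>\<^sup>2 * \<delta>"
  define y where "y = B ^ i * unit_ball_vol (real DIM('a)) + i * D"
  have B0: "0 \<le> B" unfolding B using \<gamma>_pos \<omega> t \<epsilon> by simp
  have D0: "0 \<le> D" unfolding D_def using \<delta> by simp
  have y0: "0 \<le> y" unfolding y_def using B0 D0 by simp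
  have "real (Suc i) / (2 * n) \<le> 1 / 2" using Suc.prems(1) n by (simp add: field_simps)
  then have "0 < 1 - real (Suc i) / (2 * n)" by linarith
  then have r0: "0 < r" unfolding r_def using \<rho> by (intro mult_pos_pos) auto
  have gap: "R - r = \<rho> / (2 * n)" unfolding R_def r_def using n by (simp add: field_simps)
  have "0 < \<rho> / (2 * real n)" using \<rho> n by simp
  then have rR: "r < R" using gap by linarith
  have R\<rho>: "R \<le> \<rho>" unfolding R_def using \<rho> n by (simp add: mult_left_le)
  have RE: "cball x0 R \<subseteq> E" using \<rho>(2) R\<rho> by (meson order_trans subset_cball)
  have kc: "c \<le> k" unfolding k_def using \<epsilon> n by simp
  have sub: "ball x0 R \<times> {s<..s + \<theta> * \<rho>} \<subseteq> ball x0 \<rho> \<times> {s<..s + \<theta> * \<rho>}" using R\<rho> by auto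
  have "AE z in lebesgue_on (ball x0 R \<times> {s<..s + \<theta> * \<rho>}). trunc_pos c (v z) \<le> \<omega>"
    by (rule AE_lebesgue_on_subset[OF \<omega>(2) sub cylinder_lebesgue cylinder_lebesgue])
  then have \<omega>k: "AE z in lebesgue_on (ball x0 R \<times> {s<..s + \<theta> * \<rho>}). trunc_pos k (v z) \<le> \<omega>"
    by eventually_elim (use kc in \<open>auto simp: trunc_pos_def\<close>)
  have "(\<integral>\<^sup>+x. ennreal ((trunc_pos k (v (x, s)))\<^sup>2) \<partial>lebesgue_on (ball x0 R))
      \<le> (\<integral>\<^sup>+x. ennreal ((trunc_pos c (v (x, s)))\<^sup>2) \<partial>lebesgue_on (ball x0 \<rho>))"
    by (rule nn_integral_lebesgue_on_mono_set)
      (use R\<rho> kc in \<open>auto simp: trunc_pos_def intro!: ennreal_leI power_mono\<close>)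
  also note \<delta>(2)
  finally have init: "(\<integral>\<^sup>+x. ennreal ((trunc_pos k (v (x, s)))\<^sup>2) \<partial>lebesgue_on (ball x0 R)) \<le> ennreal (\<delta> * \<rho> ^ DIM('a))" .
  have s\<rho>: "s < s + \<theta> * \<rho>" using t \<rho> by simp
  have h: "0 < \<epsilon> / n" using \<epsilon> n by simp
  have "emeasure lebesgue {x \<in> ball x0 r. k + \<epsilon> / n < v (x, t')}
     \<le> ennreal ((\<gamma> * (2 * \<omega> / (R - r)) * ((s + \<theta> * \<rho> - s) * (\<rho> ^ DIM('a) * y)) + \<delta> * \<rho> ^ DIM('a)) / (\<epsilon> / n)\<^sup>2)"
  proof (rule superlevel_step_time_slices[OF r0 rR RE t(1) s\<rho> t(3) \<omega>(1) \<omega>k _ _ _ init h Suc.prems(2)])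
    show "emeasure lebesgue {x \<in> ball x0 R. k < v (x, t)} \<le> ennreal (\<rho> ^ DIM('a) * y)" if "t \<in> {s..s + \<theta> * \<rho>}" for t
      using Suc.IH[OF Suc_leD[OF Suc.prems(1)] that] unfolding R_def k_def y_def D_def .
  qed (use y0 \<rho> \<delta> in auto)
  also have "(\<gamma> * (2 * \<omega> / (R - r)) * ((s + \<theta> * \<rho> - s) * (\<rho> ^ DIM('a) * y)) + \<delta> * \<rho> ^ DIM('a)) / (\<epsilon> / n)\<^sup>2
     = \<rho> ^ DIM('a) * (B * y + D)"
  proof -
    have "\<gamma> * (2 * \<omega> / (\<rho> / (2 * real n))) * ((s + \<theta> * \<rho> - s) * (\<rho> ^ DIM('a) * y))
        = 4 * \<gamma> * \<omega> * n * \<theta> * (\<rho> ^ DIM('a) * y)" using \<rho> n by simp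
    moreover have "X / (\<epsilon> / n)\<^sup>2 = X * (real n)\<^sup>2 / \<epsilon>\<^sup>2" for X by (simp add: power_divide)
    ultimately show ?thesis
      unfolding gap B D_def by (simp add: algebra_simps add_divide_distrib power3_eq_cube power2_eq_square)
  qed
  finally have "emeasure lebesgue {x \<in> ball x0 r. k + \<epsilon> / n < v (x, t')} \<le> ennreal (\<rho> ^ DIM('a) * (B * y + D))" .
  also have "ennreal (\<rho> ^ DIM('a) * (B * y + D))
      \<le> ennreal (\<rho> ^ DIM('a) * (B ^ Suc i * unit_ball_vol (real DIM('a)) + Suc i * D))"
  proof (intro ennreal_leI mult_left_mono)
    have "B * (i * D) \<le> i * D" using B0 B(2) D0 by (intro mult_left_le_one_le) auto
    then show "B * y + D \<le> B ^ Suc i * unit_ball_vol (real DIM('a)) + Suc i * D"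
      unfolding y_def by (simp add: algebra_simps)
  qed (use \<rho> in simp)
  finally have "emeasure lebesgue {x \<in> ball x0 r. k + \<epsilon> / n < v (x, t')}
     \<le> ennreal (\<rho> ^ DIM('a) * (B ^ Suc i * unit_ball_vol (real DIM('a)) + Suc i * D))" .
  moreover have "k + \<epsilon> / n = c + Suc i * (\<epsilon> / n)" unfolding k_def by (simp add: algebra_simps add_divide_distrib)
  ultimately show ?case unfolding r_def D_def by (simp only:)
qed

end

text \<open>The uniformity is essential: \<open>\<theta>\<close> and \<open>\<delta>\<close> have to
  be fixed before the radius, the starting time and the level are found, and the same pair must
  serve \<open>u\<close> and \<open>- u\<close>.\<close>

lemma DG_local_upper_bound:
  assumes \<gamma>: "0 < \<gamma>" and \<omega>: "0 < \<omega>" and \<epsilon>: "0 < \<epsilon>"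
  shows "\<exists>\<theta> \<delta>. 0 < \<theta> \<and> \<theta> \<le> 1 \<and> 0 < \<delta> \<and>
    (\<forall>(E :: 'a::euclidean_space set) T v x0 \<rho> s c. DG_subsolution E T \<gamma> v \<longrightarrow> 0 < \<rho> \<longrightarrow> cball x0 \<rho> \<subseteq> E \<longrightarrow>
      0 < s \<longrightarrow> s + \<theta> * \<rho> < T \<longrightarrow>
      (AE z in lebesgue_on (ball x0 \<rho> \<times> {s<..s + \<theta> * \<rho>}). trunc_pos c (v z) \<le> \<omega>) \<longrightarrow>
      (\<integral>\<^sup>+x. ennreal ((trunc_pos c (v (x, s)))\<^sup>2) \<partial>lebesgue_on (ball x0 \<rho>)) \<le> ennreal (\<delta> * \<rho> ^ DIM('a)) \<longrightarrow>
      (AE z in lebesgue_on (ball x0 (\<rho> / 4) \<times> {s + \<theta> * \<rho> / 2<..s + \<theta> * \<rho>}). v z \<le> c + 2 * \<epsilon>))"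
proof -
  define N where "N = DIM('a)"
  \<comment> \<open>One more than the dimension: \<open>\<theta> ^ N\<close> matches the threshold
    of the iteration and the spare factor \<open>\<theta>\<close> absorbs the constants.\<close>
  define n where "n = Suc N"
  define \<kappa> where "\<kappa> = unit_ball_vol (real DIM('a))"
  define q where "q = 1 / (16 * 8 ^ N :: real)"
  \<comment> \<open>The constant \<open>\<Lambda>\<close> of the iteration, at radius
    \<open>\<rho> / 2\<close> and height \<open>\<theta> * \<rho>\<close>, is at most
    \<open>G / (\<theta> * \<rho>)\<close> because \<open>\<theta> \<le> 1\<close>.\<close>
  define G where "G = \<gamma> * (128 * \<omega> + 4 * \<omega>\<^sup>2)"
  \<comment> \<open>The iteration starts with the averaging radius
    \<open>g * \<theta> * \<rho>\<close>. The first bound makes it at most a sixteenth of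
    \<open>\<rho> / 2\<close>, the second yields the contraction by \<open>q\<close>.\<close>
  define g where "g = min (1 / 32) (q * \<epsilon> / (8 * G))"
  define B' where "B' = 4 * \<gamma> * \<omega> * real n ^ 3 / \<epsilon>\<^sup>2"
  define \<theta> where "\<theta> = min 1 (min (1 / B') (\<epsilon>\<^sup>2 * g ^ N / (64 * G * B' ^ n)))"
  define D where "D = (real n)\<^sup>2 / \<epsilon>\<^sup>2"
  \<comment> \<open>The \<open>n\<close> copies of the initial error take exactly the other
    half.\<close>
  define \<delta> where "\<delta> = \<epsilon>\<^sup>2 * (g * \<theta>) ^ N * \<kappa> / (64 * G * (n * D))"
  have pos: "0 < \<kappa>" "0 < q" "0 < G" "0 < n" "0 < B'" "0 < D"
    using \<gamma> \<omega> \<epsilon> unfolding \<kappa>_def q_def G_def n_def B'_def D_def by (auto intro!: mult_pos_pos add_pos_pos)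
  have g: "0 < g" "g \<le> 1 / 32" "8 * g * G / \<epsilon> \<le> q"
  proof -
    show "0 < g" "g \<le> 1 / 32" unfolding g_def using pos \<epsilon> by auto
    have "g \<le> q * \<epsilon> / (8 * G)" unfolding g_def by simp
    then show "8 * g * G / \<epsilon> \<le> q" using pos \<epsilon> by (simp add: field_simps)
  qed
  have \<theta>: "0 < \<theta>" "\<theta> \<le> 1" "B' * \<theta> \<le> 1" "G * B' ^ n * \<theta> \<le> \<epsilon>\<^sup>2 * g ^ N / 64"
  proof -
    show "0 < \<theta>" "\<theta> \<le> 1" unfolding \<theta>_def using pos \<epsilon> g by auto
    have "\<theta> \<le> 1 / B'" unfolding \<theta>_def by simp
    then show "B' * \<theta> \<le> 1" using pos by (simp add: field_simps)
    have "\<theta> \<le> \<epsilon>\<^sup>2 * g ^ N / (64 * G * B' ^ n)" unfolding \<theta>_def by simp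
    then show "G * B' ^ n * \<theta> \<le> \<epsilon>\<^sup>2 * g ^ N / 64" using pos by (simp add: field_simps)
  qed
  have \<delta>: "0 < \<delta>" unfolding \<delta>_def using pos \<epsilon> g \<theta> by simp
  define Y where "Y = (B' * \<theta>) ^ n * \<kappa> + n * (D * \<delta>)"
  have Y0: "0 \<le> Y" unfolding Y_def using pos \<theta> \<delta> by simp
  have Y: "G * Y \<le> \<epsilon>\<^sup>2 * (g * \<theta>) ^ N * \<kappa> / 32"
  proof -
    have "G * ((B' * \<theta>) ^ n * \<kappa>) = (G * B' ^ n * \<theta>) * (\<theta> ^ N * \<kappa>)"
      unfolding n_def by (simp add: power_mult_distrib)
    also have "\<dots> \<le> (\<epsilon>\<^sup>2 * g ^ N / 64) * (\<theta> ^ N * \<kappa>)" using \<theta> pos by (intro mult_right_mono) auto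
    also have "\<dots> = \<epsilon>\<^sup>2 * (g * \<theta>) ^ N * \<kappa> / 64" by (simp add: power_mult_distrib)
    finally have "G * ((B' * \<theta>) ^ n * \<kappa>) \<le> \<epsilon>\<^sup>2 * (g * \<theta>) ^ N * \<kappa> / 64" .
    moreover have "G * (n * (D * \<delta>)) = \<epsilon>\<^sup>2 * (g * \<theta>) ^ N * \<kappa> / 64"
      unfolding \<delta>_def using pos by simp
    ultimately show ?thesis unfolding Y_def distrib_left by linarith
  qed
  have "AE z in lebesgue_on (ball x0 (\<rho> / 4) \<times> {s + \<theta> * \<rho> / 2<..s + \<theta> * \<rho>}). v z \<le> c + 2 * \<epsilon>"
    if DGv: "DG_subsolution E T \<gamma> v" and \<rho>: "0 < \<rho>" "cball x0 \<rho> \<subseteq> E" and t: "0 < s" "s + \<theta> * \<rho> < T"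
      and bd: "AE z in lebesgue_on (ball x0 \<rho> \<times> {s<..s + \<theta> * \<rho>}). trunc_pos c (v z) \<le> \<omega>"
      and init: "(\<integral>\<^sup>+x. ennreal ((trunc_pos c (v (x, s)))\<^sup>2) \<partial>lebesgue_on (ball x0 \<rho>)) \<le> ennreal (\<delta> * \<rho> ^ DIM('a))"
    for E :: "'a set" and T v x0 \<rho> s c
  proof -
    interpret DG_subsolution E T \<gamma> v by (rule DGv)
    have \<theta>\<rho>: "0 < \<theta> * \<rho>" using \<theta> \<rho> by simp
    have half: "cball x0 (\<rho> / 2) \<subseteq> E" using \<rho> subset_cball[of "\<rho> / 2" \<rho> x0] by auto
    have "emeasure lebesgue {x \<in> ball x0 (\<rho> * (1 - n / (2 * n))). c + n * (\<epsilon> / n) < v (x, t')}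
       \<le> ennreal (\<rho> ^ DIM('a) * ((B' * \<theta>) ^ n * unit_ball_vol (real DIM('a)) + n * ((real n)\<^sup>2 / \<epsilon>\<^sup>2 * \<delta>)))"
      if "t' \<in> {s..s + \<theta> * \<rho>}" for t'
      by (rule superlevel_bootstrap[OF \<rho> _ t(1) \<theta>(1) t(2) _ bd \<epsilon> _ init _ \<theta>(3) _ that])
        (use pos \<omega> \<delta> in \<open>auto simp: B'_def\<close>)
    \<comment> \<open>After \<open>n\<close> repetitions the radius is \<open>\<rho> / 2\<close> and
      the level \<open>c + \<epsilon>\<close>. The iteration then spends the second
      \<open>\<epsilon>\<close> and halves the radius again.\<close>
    then have sl: "emeasure lebesgue {x \<in> ball x0 (\<rho> / 2). c + \<epsilon> < v (x, t')} \<le> ennreal (\<rho> ^ N * Y)"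
      if "t' \<in> {s..s + \<theta> * \<rho>}" for t'
      using that pos(4) unfolding Y_def \<kappa>_def D_def N_def by simp
    have s\<rho>: "s < s + \<theta> * \<rho>" using \<theta>\<rho> by simp
    have "0 \<le> \<rho> ^ N * Y" using \<rho> Y0 by simp
    from emeasure_superlevel_le_time[OF half t(1) s\<rho> t(2) this sl]
    have em: "emeasure lebesgue {z \<in> ball x0 (\<rho> / 2) \<times> {s<..s + \<theta> * \<rho>}. c + \<epsilon> < v z} \<le> ennreal (\<theta> * \<rho> * (\<rho> ^ N * Y))"
      by simp
    define \<Lambda> where "\<Lambda> = \<gamma> * (64 * \<omega> / (\<rho> / 2) + 4 * \<omega>\<^sup>2 / (\<theta> * \<rho>))"
    have \<Lambda>: "\<Lambda> \<le> G / (\<theta> * \<rho>)"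
    proof -
      have "64 * \<omega> / (\<rho> / 2) = 128 * \<omega> * \<theta> / (\<theta> * \<rho>)" using \<theta>(1) by simp
      also have "\<dots> \<le> 128 * \<omega> / (\<theta> * \<rho>)"
        using \<theta> \<omega> \<rho> by (intro divide_right_mono) auto
      finally have "\<Lambda> \<le> \<gamma> * (128 * \<omega> / (\<theta> * \<rho>) + 4 * \<omega>\<^sup>2 / (\<theta> * \<rho>))"
        unfolding \<Lambda>_def using \<gamma> by (intro mult_left_mono add_right_mono) auto
      then show ?thesis unfolding G_def by (simp add: add_divide_distrib distrib_left)
    qed
    have "AE z in lebesgue_on (ball x0 (\<rho> / 2) \<times> {s<..s + \<theta> * \<rho>}). trunc_pos c (v z) \<le> \<omega>"
      by (rule AE_lebesgue_on_subset[OF bd _ cylinder_lebesgue cylinder_lebesgue]) (use \<rho> in auto)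
    then have bd': "AE z in lebesgue_on (ball x0 (\<rho> / 2) \<times> {s<..s + \<theta> * \<rho>}). trunc_pos (c + \<epsilon>) (v z) \<le> \<omega>"
      by eventually_elim (use \<epsilon> in \<open>auto simp: trunc_pos_def\<close>)
    have "AE z in lebesgue_on (ball x0 (\<rho> / 2 / 2) \<times> {s + \<theta> * \<rho> / 2<..s + \<theta> * \<rho>}). v z \<le> c + \<epsilon> + \<epsilon>"
    proof (rule DeGiorgi_iteration[OF _ half t(1) \<theta>\<rho> t(2) \<epsilon> _ bd' _ em \<Lambda>_def, where ?r0.0="g * \<theta> * \<rho>"])
      have "g * \<theta> * \<rho> \<le> 1 / 32 * 1 * \<rho>" using g \<theta> \<rho> by (intro mult_mono) auto
      then show "g * \<theta> * \<rho> \<le> \<rho> / 2 / 16" by simp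
      have "8 * (g * \<theta> * \<rho>) * \<Lambda> / \<epsilon> \<le> 8 * (g * \<theta> * \<rho>) * (G / (\<theta> * \<rho>)) / \<epsilon>"
        using g \<theta> \<rho> \<epsilon> \<Lambda> by (intro divide_right_mono mult_left_mono) auto
      also have "\<dots> = 8 * g * G / \<epsilon>" using \<theta> \<rho> by simp
      also note g(3)
      finally show "8 * (g * \<theta> * \<rho>) * \<Lambda> / \<epsilon> \<le> 1 / (16 * 8 ^ DIM('a))" unfolding q_def N_def .
      have "\<Lambda> * (\<theta> * \<rho> * (\<rho> ^ N * Y)) \<le> G / (\<theta> * \<rho>) * (\<theta> * \<rho> * (\<rho> ^ N * Y))"
        using \<Lambda> \<theta>\<rho> \<rho> Y0 by (intro mult_right_mono) auto
      also have "\<dots> = \<rho> ^ N * (G * Y)" using \<theta> \<rho> by simp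
      also have "\<dots> \<le> \<rho> ^ N * (\<epsilon>\<^sup>2 * (g * \<theta>) ^ N * \<kappa> / 32)" using \<rho> by (intro mult_left_mono Y) auto
      also have "\<dots> = \<epsilon>\<^sup>2 * (g * \<theta> * \<rho>) ^ DIM('a) * unit_ball_vol (real DIM('a)) / 32"
        unfolding \<kappa>_def N_def by (simp add: power_mult_distrib)
      finally show "\<Lambda> * (\<theta> * \<rho> * (\<rho> ^ N * Y)) \<le> \<epsilon>\<^sup>2 * (g * \<theta> * \<rho>) ^ DIM('a) * unit_ball_vol (real DIM('a)) / 32" .
    qed (use \<rho> \<theta> g \<omega> Y0 in auto)
    moreover have "\<rho> / 2 / 2 = \<rho> / 4" "c + \<epsilon> + \<epsilon> = c + 2 * \<epsilon>" by simp_all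
    ultimately show ?thesis by (simp only:)
  qed
  then show ?thesis
    by (intro exI[of _ \<theta>] exI[of _ \<delta>] conjI allI impI \<theta>(1,2) \<delta>)
qed

section \<open>The continuity criterion\<close>

lemma AE_lebesgue_slices:
  fixes P :: "'a::euclidean_space \<times> real \<Rightarrow> bool"
  assumes "AE z in lebesgue. P z"
  shows "AE t in lebesgue. AE x in lebesgue. P (x, t)"
proof -
  have "AE z in lborel. P z" using assms by (simp only: AE_completion_iff)
  then obtain N where N: "N \<in> null_sets lborel" "{z \<in> space lborel. \<not> P z} \<subseteq> N"
    by (auto simp: eventually_ae_filter)
  then have N': "N \<in> sets (lborel \<Otimes>\<^sub>M lborel)" "emeasure (lborel \<Otimes>\<^sub>M lborel) N = 0"
    by (auto simp only: lborel_prod null_sets_def)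
  have "(\<integral>\<^sup>+t. emeasure lborel ((\<lambda>x. (x, t)) -` N) \<partial>lborel) = 0"
    using N'(2) by (simp only: lborel_pair.emeasure_pair_measure_alt2[OF N'(1)])
  then have "AE t in lborel. emeasure lborel ((\<lambda>x. (x, t)) -` N) = 0"
    using lborel_pair.measurable_emeasure_Pair2[OF N'(1)] by (simp only: nn_integral_0_iff_AE)
  then have "AE t in lebesgue. emeasure lborel ((\<lambda>x. (x, t)) -` N) = 0" by (rule AE_completion)
  then show ?thesis
  proof eventually_elim
    fix t assume "emeasure lborel ((\<lambda>x. (x, t)) -` N) = 0"
    then have "(\<lambda>x. (x, t)) -` N \<in> null_sets lborel"
      using sets_Pair2[OF N'(1)] by (simp add: null_sets_def)
    then have "AE x in lborel. x \<notin> (\<lambda>x. (x, t)) -` N" by (rule AE_not_in)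
    then have "AE x in lborel. P (x, t)" by eventually_elim (use N(2) in auto)
    then show "AE x in lebesgue. P (x, t)" by (rule AE_completion)
  qed
qed

lemma emeasure_lebesgue_cylinder:
  assumes "0 \<le> R" "t0 \<le> t1"
  shows "emeasure lebesgue (ball (x0::'a::euclidean_space) R \<times> {t0<..t1::real})
    = ennreal (unit_ball_vol (real DIM('a)) * R ^ DIM('a) * (t1 - t0))"
proof -
  have "ball x0 R \<times> {t0<..t1} \<in> sets borel" by (intro borel_Times) auto
  then have "emeasure lebesgue (ball x0 R \<times> {t0<..t1}) = emeasure lborel (ball x0 R \<times> {t0<..t1})"
    by simp
  also have "\<dots> = emeasure (lborel \<Otimes>\<^sub>M lborel) (ball x0 R \<times> {t0<..t1})" by (simp only: lborel_prod)
  also have "\<dots> = emeasure lborel (ball x0 R) * emeasure lborel {t0<..t1}"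
    by (rule lborel.emeasure_pair_measure_Times) auto
  also have "\<dots> = ennreal (unit_ball_vol (real DIM('a)) * R ^ DIM('a) * (t1 - t0))"
    using assms by (simp add: emeasure_ball ennreal_mult[symmetric])
  finally show ?thesis .
qed

lemma measure_cylinder:
  assumes "0 < \<rho>"
  shows "measure lebesgue (cylinder (0::'a::euclidean_space) 0 1 \<rho>) = unit_ball_vol (real DIM('a)) * \<rho> ^ DIM('a) * \<rho>"
  using emeasure_lebesgue_cylinder[of \<rho> "- \<rho>" 0 "0::'a"] assms
  by (simp add: cylinder_def measure_def)

lemma AE_nontrivial_lebesgue_on:
  fixes x :: "'a::euclidean_space"
  assumes "AE z in lebesgue_on (ball x r). P z" "0 < r"
  obtains z where "z \<in> ball x r" "P z"
proof -
  have "\<exists>z\<in>ball x r. P z"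
  proof (rule ccontr)
    assume "\<not> ?thesis"
    then have "AE z in lebesgue. z \<notin> ball x r"
      using assms(1) by (auto simp: AE_restrict_space_iff elim!: eventually_mono)
    then have "ball x r \<in> null_sets lebesgue"
      by (subst (asm) AE_iff_null_sets[symmetric]) auto
    then have "negligible (ball x r)" by (simp add: negligible_iff_null_sets)
    then show False using assms(2) open_not_negligible[of "ball x r"] by auto
  qed
  then show thesis using that by blast
qed

lemma DG_imp_subsolution:
  assumes "open E" "0 < \<gamma>" "u \<in> DG E T \<gamma>"
  shows "DG_subsolution E T \<gamma> u" "DG_subsolution E T \<gamma> (\<lambda>z. - u z)"
proof -
  have p: "u \<in> DG_trunc trunc_pos E T \<gamma>" and n: "u \<in> DG_trunc trunc_neg E T \<gamma>"
    using assms(3) unfolding DG_def DG_plus_def DG_minus_def by auto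
  have m: "u \<in> borel_measurable (lebesgue_on (E \<times> {0<..<T}))" and c: "u \<in> C_L2_loc T E"
    using p unfolding DG_trunc_def by auto
  have s: "(\<lambda>x. u (x, t)) \<in> L2 E'" if "open E'" "compactly_contained E' E" "t \<in> {0<..<T}" for E' t
    using c that unfolding C_L2_loc_def by blast
  show "DG_subsolution E T \<gamma> u"
  proof
    fix xo to \<theta> \<rho> k \<zeta>
    assume "0 < \<theta>" "0 < \<rho>" "cylinder xo to \<theta> \<rho> \<subseteq> E \<times> {0<..<T}" "0 < to - \<theta> * \<rho>" "\<zeta> \<in> cutoffs xo to \<theta> \<rho>"
    then show "energy_ineq \<gamma> (\<lambda>z. trunc_pos k (u z)) xo to \<theta> \<rho> \<zeta>"
      using p unfolding DG_trunc_def by auto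
  qed (use assms m s in auto)
  show "DG_subsolution E T \<gamma> (\<lambda>z. - u z)"
  proof
    fix xo to \<theta> \<rho> k \<zeta>
    assume "0 < \<theta>" "0 < \<rho>" "cylinder xo to \<theta> \<rho> \<subseteq> E \<times> {0<..<T}" "0 < to - \<theta> * \<rho>" "\<zeta> \<in> cutoffs xo to \<theta> \<rho>"
    then have "energy_ineq \<gamma> (\<lambda>z. trunc_neg (- k) (u z)) xo to \<theta> \<rho> \<zeta>"
      using n unfolding DG_trunc_def by auto
    moreover have "trunc_neg (- k) y = trunc_pos k (- y)" for y
      by (simp add: trunc_neg_def trunc_pos_def)
    ultimately show "energy_ineq \<gamma> (\<lambda>z. trunc_pos k (- u z)) xo to \<theta> \<rho> \<zeta>" by simp
  next
    fix E' t assume "open E'" "compactly_contained E' E" "t \<in> {0<..<T}"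
    from s[OF this] show "(\<lambda>x. - u (x, t)) \<in> L2 E'" unfolding L2_def by auto
  qed (use assms m in auto)
qed

text \<open>Truncated at the lower bound \<open>m\<close>, the function becomes \<open>v - m\<close>
  almost everywhere: it has the same variation and is at most \<open>e\<close>. On the cylinder of
  double size the time weight with \<open>\<alpha> = 0\<close> and
  \<open>\<beta> = 1 / \<rho>\<close> kills the initial term and is at least 1 during the last
  \<open>\<rho>\<close> units of time. The terms \<open>4 * e\<close> and \<open>e\<^sup>2\<close>
  come from the gradient and the time derivative of the cutoff.\<close>

lemma (in DG_subsolution) total_variation_integral_le:
  assumes \<rho>: "0 < \<rho>" "cball x0 (2 * \<rho>) \<subseteq> E" and t: "0 < t1 - 2 * \<rho>" "t1 < T" and e: "0 \<le> e"
    and bd: "AE z in lebesgue_on (ball x0 (2 * \<rho>) \<times> {t1 - 2 * \<rho><..t1}). m \<le> v z \<and> v z \<le> m + e"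
  shows "(\<integral>\<^sup>+t. total_variation (\<lambda>x. v (x, t)) (ball x0 \<rho>) \<partial>lebesgue_on {t1 - \<rho>..t1})
     \<le> ennreal (\<gamma> * (4 * e + e\<^sup>2) * (2 * 2 ^ DIM('a)) * (unit_ball_vol (real DIM('a)) * \<rho> ^ DIM('a)))"
proof -
  define \<kappa> where "\<kappa> = unit_ball_vol (real DIM('a))"
  have \<kappa>: "0 < \<kappa>" unfolding \<kappa>_def by simp
  let ?t0 = "t1 - 2 * \<rho>"
  let ?Q = "ball x0 (2 * \<rho>) \<times> {?t0<..t1}"
  let ?w = "\<lambda>z. trunc_pos m (v z)"
  have w\<omega>: "AE z in lebesgue_on ?Q. ?w z \<le> e"
    using bd by eventually_elim (use e in \<open>auto simp: trunc_pos_def\<close>)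
  have em: "emeasure lebesgue ?Q \<le> ennreal (\<kappa> * (2 * \<rho>) ^ DIM('a) * (2 * \<rho>))"
    unfolding \<kappa>_def using \<rho> by (subst emeasure_lebesgue_cylinder) auto
  have r: "\<rho> < 2 * \<rho>" and t01: "?t0 < t1" and R: "0 < 2 * \<rho>" using \<rho> by auto
  have "(\<integral>\<^sup>+t. ennreal (0 + 1 / \<rho> * (t - ?t0)) * total_variation (\<lambda>x. ?w (x, t)) (ball x0 \<rho>) \<partial>lebesgue_on {?t0..t1})
     \<le> ennreal (\<gamma> * (2 * e / (2 * \<rho> - \<rho>) * (0 + 1 / \<rho> * (t1 - ?t0)) + 1 / \<rho> * e\<^sup>2) * (\<kappa> * (2 * \<rho>) ^ DIM('a) * (2 * \<rho>)) + 0)"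
    by (rule Caccioppoli(2)[OF \<rho>(1) r t01 _ _ _ energy_cylinder[OF R \<rho>(2) t(1) t01 t(2)] _ w\<omega> e cylinder_lebesgue _ em])
      (use \<rho> \<kappa> \<gamma>_pos in \<open>auto simp: trunc_pos_def\<close>)
  also have "\<gamma> * (2 * e / (2 * \<rho> - \<rho>) * (0 + 1 / \<rho> * (t1 - ?t0)) + 1 / \<rho> * e\<^sup>2) * (\<kappa> * (2 * \<rho>) ^ DIM('a) * (2 * \<rho>)) + 0
     = \<gamma> * (4 * e + e\<^sup>2) * (2 * 2 ^ DIM('a)) * (\<kappa> * \<rho> ^ DIM('a))"
    using \<rho> by (simp add: power_mult_distrib field_simps)
  finally have C: "(\<integral>\<^sup>+t. ennreal (0 + 1 / \<rho> * (t - ?t0)) * total_variation (\<lambda>x. ?w (x, t)) (ball x0 \<rho>) \<partial>lebesgue_on {?t0..t1})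
     \<le> ennreal (\<gamma> * (4 * e + e\<^sup>2) * (2 * 2 ^ DIM('a)) * (\<kappa> * \<rho> ^ DIM('a)))" .
  have \<rho>E: "cball x0 \<rho> \<subseteq> E" using \<rho> subset_cball[of \<rho> "2 * \<rho>" x0] by auto
  have "AE z in lebesgue. z \<in> ?Q \<longrightarrow> m \<le> v z"
    using bd by (subst (asm) AE_restrict_space_iff) (auto simp: cylinder_lebesgue elim!: eventually_mono)
  from AE_lebesgue_slices[OF this]
  have ae: "AE t in lebesgue_on {t1 - \<rho>..t1}. AE x in lebesgue. (x, t) \<in> ?Q \<longrightarrow> m \<le> v (x, t)"
    by (subst AE_restrict_space_iff) auto
  have "(\<integral>\<^sup>+t. total_variation (\<lambda>x. v (x, t)) (ball x0 \<rho>) \<partial>lebesgue_on {t1 - \<rho>..t1})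
    \<le> (\<integral>\<^sup>+t. ennreal (0 + 1 / \<rho> * (t - ?t0)) * total_variation (\<lambda>x. ?w (x, t)) (ball x0 \<rho>) \<partial>lebesgue_on {t1 - \<rho>..t1})"
  proof (rule nn_integral_mono_AE)
    show "AE t in lebesgue_on {t1 - \<rho>..t1}. total_variation (\<lambda>x. v (x, t)) (ball x0 \<rho>)
        \<le> ennreal (0 + 1 / \<rho> * (t - ?t0)) * total_variation (\<lambda>x. ?w (x, t)) (ball x0 \<rho>)"
      using ae AE_space[of "lebesgue_on {t1 - \<rho>..t1}"]
    proof eventually_elim
      fix t assume ae': "AE x in lebesgue. (x, t) \<in> ?Q \<longrightarrow> m \<le> v (x, t)" and "t \<in> space (lebesgue_on {t1 - \<rho>..t1})"
      then have tt: "t \<in> {t1 - \<rho>..t1}" by simp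
      then have tT: "t \<in> {0<..<T}" using t \<rho> by auto
      have vm: "(\<lambda>x. v (x, t)) \<in> borel_measurable (lebesgue_on (ball x0 \<rho>))"
        by (rule slice_measurable[OF \<rho>E tT])
      have wm: "(\<lambda>x. ?w (x, t)) \<in> borel_measurable (lebesgue_on (ball x0 \<rho>))"
        using vm unfolding trunc_pos_def by auto
      have fin: "finite_measure (lebesgue_on (ball x0 \<rho>))"
        by (rule finite_measure_lebesgue_on) simp
      have "integrable (lebesgue_on (ball x0 \<rho>)) (\<lambda>x. (v (x, t))\<^sup>2)"
        using slice_ball[OF \<rho>E tT] by (simp add: L2_def)
      then have "integrable (lebesgue_on (ball x0 \<rho>)) (\<lambda>x. v (x, t))"
        by (rule finite_measure.square_integrable_imp_integrable[OF fin vm])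
      moreover have "integrable (lebesgue_on (ball x0 \<rho>)) (\<lambda>x. m)"
        using fin by (simp add: finite_measure.integrable_const)
      ultimately have "integrable (lebesgue_on (ball x0 \<rho>)) (\<lambda>x. ?w (x, t))"
        unfolding trunc_pos_def by (intro integrable_max) auto
      from total_variation_add_const[OF this, of m]
      have "total_variation (\<lambda>x. ?w (x, t)) (ball x0 \<rho>) = total_variation (\<lambda>x. ?w (x, t) + m) (ball x0 \<rho>)" ..
      also have "\<dots> = total_variation (\<lambda>x. v (x, t)) (ball x0 \<rho>)"
      proof (rule total_variation_cong_AE[OF _ vm])
        show "(\<lambda>x. ?w (x, t) + m) \<in> borel_measurable (lebesgue_on (ball x0 \<rho>))" using wm by simp
        have "AE x in lebesgue. x \<in> ball x0 \<rho> \<longrightarrow> ?w (x, t) + m = v (x, t)"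
          using ae' by eventually_elim (use tt \<rho> in \<open>auto simp: trunc_pos_def\<close>)
        then show "AE x in lebesgue_on (ball x0 \<rho>). ?w (x, t) + m = v (x, t)"
          by (subst AE_restrict_space_iff) auto
      qed
      finally have eq: "total_variation (\<lambda>x. ?w (x, t)) (ball x0 \<rho>) = total_variation (\<lambda>x. v (x, t)) (ball x0 \<rho>)" .
      have "ennreal 1 \<le> ennreal (0 + 1 / \<rho> * (t - ?t0))"
        using tt \<rho> by (intro ennreal_leI) (simp add: field_simps)
      then show "total_variation (\<lambda>x. v (x, t)) (ball x0 \<rho>)
        \<le> ennreal (0 + 1 / \<rho> * (t - ?t0)) * total_variation (\<lambda>x. ?w (x, t)) (ball x0 \<rho>)"
        unfolding eq using mult_right_mono[of "ennreal 1" "ennreal (0 + 1 / \<rho> * (t - ?t0))" "total_variation (\<lambda>x. v (x, t)) (ball x0 \<rho>)"]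
        by simp
    qed
  qed
  also have "\<dots> \<le> (\<integral>\<^sup>+t. ennreal (0 + 1 / \<rho> * (t - ?t0)) * total_variation (\<lambda>x. ?w (x, t)) (ball x0 \<rho>) \<partial>lebesgue_on {?t0..t1})"
    by (rule nn_integral_lebesgue_on_mono_set) (use \<rho> in auto)
  also note C
  finally show ?thesis unfolding \<kappa>_def .
qed

text \<open>A single time slice suffices: the smallness of the total variation is only used to find one time
  \<open>s\<close> before \<open>t\<^sub>o\<close> at which \<open>u(s)\<close> is close to a constant in \<open>L\<^sup>1\<close>; both one-sided bounds
  then propagate forward in time, past \<open>t\<^sub>o\<close>.\<close>

lemma DG_oscillation_small:
  fixes E :: "'a::euclidean_space set"
  assumes u: "DG_subsolution E T \<gamma> u" "DG_subsolution E T \<gamma> (\<lambda>z. - u z)"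
    and r1: "0 < r1" "cball xo r1 \<subseteq> E" "0 < to - r1" "to + r1 < T"
    and M: "0 < M" "AE z in lebesgue_on (cball xo r1 \<times> {to - r1..to + r1}). \<bar>u z\<bar> \<le> M"
    and lim: "\<And>\<eta>. 0 < \<eta> \<Longrightarrow> \<forall>\<^sub>F \<rho> in at_right 0.
       (\<integral>\<^sup>+t. total_variation (\<lambda>x. u (x, t)) (ball xo \<rho>) \<partial>lebesgue_on {to - \<rho>..to}) \<le> ennreal (\<eta> * \<rho> ^ DIM('a))"
    and \<epsilon>: "0 < \<epsilon>"
  shows "\<exists>r>0. \<exists>c. AE z in lebesgue_on (ball (xo, to) r). \<bar>u z - c\<bar> \<le> 2 * \<epsilon>"
proof -
  interpret up: DG_subsolution E T \<gamma> u by (rule u)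
  interpret um: DG_subsolution E T \<gamma> "\<lambda>z. - u z" by (rule u)
  have \<omega>: "0 < 2 * M" using M by simp
  obtain \<theta> \<delta> where \<theta>: "0 < \<theta>" "\<theta> \<le> 1" and \<delta>: "0 < \<delta>"
    and bound: "\<forall>(E :: 'a set) T v x0 \<rho> s c. DG_subsolution E T \<gamma> v \<longrightarrow> 0 < \<rho> \<longrightarrow> cball x0 \<rho> \<subseteq> E \<longrightarrow>
      0 < s \<longrightarrow> s + \<theta> * \<rho> < T \<longrightarrow>
      (AE z in lebesgue_on (ball x0 \<rho> \<times> {s<..s + \<theta> * \<rho>}). trunc_pos c (v z) \<le> 2 * M) \<longrightarrow>
      (\<integral>\<^sup>+x. ennreal ((trunc_pos c (v (x, s)))\<^sup>2) \<partial>lebesgue_on (ball x0 \<rho>)) \<le> ennreal (\<delta> * \<rho> ^ DIM('a)) \<longrightarrow>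
      (AE z in lebesgue_on (ball x0 (\<rho> / 4) \<times> {s + \<theta> * \<rho> / 2<..s + \<theta> * \<rho>}). v z \<le> c + 2 * \<epsilon>)"
    using DG_local_upper_bound[OF up.\<gamma>_pos \<omega> \<epsilon>, where ?'a = 'a] by (elim exE conjE) (rule that)
  \<comment> \<open>Chosen so that the Poincare error times the bound \<open>2 * M\<close> of the
    truncations equals \<open>\<delta> * \<rho> ^ DIM('a)\<close>.\<close>
  define \<eta> where "\<eta> = \<delta> * \<theta> / (2 * M * 2 ^ (DIM('a) + 2) * 16 * 4 ^ DIM('a))"
  have \<eta>: "0 < \<eta>" unfolding \<eta>_def using \<delta> \<theta> M by simp
  from lim[OF \<eta>] obtain b where b: "0 < b" "\<And>\<rho>. 0 < \<rho> \<Longrightarrow> \<rho> < b \<Longrightarrow>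
      (\<integral>\<^sup>+t. total_variation (\<lambda>x. u (x, t)) (ball xo \<rho>) \<partial>lebesgue_on {to - \<rho>..to}) \<le> ennreal (\<eta> * \<rho> ^ DIM('a))"
    unfolding eventually_at_right_field by blast
  \<comment> \<open>The variation is needed on the ball of radius \<open>4 * \<rho>\<close>, which
    the Poincare inequality requires; dividing by 5 keeps that radius strictly below
    \<open>b\<close>.\<close>
  define \<rho> where "\<rho> = min (b / 5) (r1 / 4)"
  have \<rho>: "0 < \<rho>" "4 * \<rho> < b" "4 * \<rho> \<le> r1" unfolding \<rho>_def using b r1 by auto
  have \<theta>\<rho>: "0 < \<theta> * \<rho>" "\<theta> * \<rho> \<le> \<rho>" using \<theta> \<rho> by (auto simp: mult_left_le_one_le)
  have E4: "cball xo (4 * \<rho>) \<subseteq> E" using r1(2) subset_cball[OF \<rho>(3), of xo] by blast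
  \<comment> \<open>\<open>V\<close> times the length \<open>\<theta> * \<rho> / 8\<close> of the
    window \<open>J\<close> is twice the available integral of the variation, so the variation
    cannot exceed \<open>V\<close> at almost every time in \<open>J\<close>.\<close>
  define V where "V = 16 * \<eta> * 4 ^ DIM('a) * \<rho> ^ DIM('a) / (\<theta> * \<rho>)"
  have V: "0 < V" unfolding V_def using \<eta> \<rho> \<theta>\<rho> by simp
  let ?K = "cball xo r1 \<times> {to - r1..to + r1}"
  have "?K \<in> sets borel" by (intro borel_closed closed_Times) auto
  then have K: "?K \<in> sets lebesgue" by simp
  have MK: "AE z in lebesgue. z \<in> ?K \<longrightarrow> \<bar>u z\<bar> \<le> M"
    using M(2) by (subst (asm) AE_restrict_space_iff) (auto simp: K)
  \<comment> \<open>For \<open>s\<close> in this window the time interval of the final bound, from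
    \<open>s + \<theta> * \<rho> / 2\<close> to \<open>s + \<theta> * \<rho>\<close>, starts no
    later than \<open>to - \<theta> * \<rho> / 8\<close> and ends after
    \<open>to + \<theta> * \<rho> / 4\<close>. Hence \<open>to\<close> is an interior time and the
    radius \<open>\<theta> * \<rho> / 8\<close> is admissible at the end.\<close>
  define J where "J = {to - 3 / 4 * (\<theta> * \<rho>)<..to - 5 / 8 * (\<theta> * \<rho>)}"
  have JK: "t \<in> {to - 4 * \<rho>..to}" "t \<in> {to - r1..to + r1}" if "t \<in> J" for t
  proof -
    have "to - 3 / 4 * (\<theta> * \<rho>) < t" "t \<le> to - 5 / 8 * (\<theta> * \<rho>)" using that unfolding J_def by auto
    then have "to - \<rho> < t" "t < to" using \<theta>\<rho> \<rho> by linarith+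
    then show "t \<in> {to - 4 * \<rho>..to}" "t \<in> {to - r1..to + r1}" using \<rho> by auto
  qed
  have "\<exists>s\<in>J. total_variation (\<lambda>x. u (x, s)) (ball xo (4 * \<rho>)) \<le> ennreal V \<and>
      (AE x in lebesgue. (x, s) \<in> ?K \<longrightarrow> \<bar>u (x, s)\<bar> \<le> M)"
  proof (rule ccontr)
    assume neg: "\<not> ?thesis"
    have "ennreal (2 * \<eta> * (4 * \<rho>) ^ DIM('a)) = ennreal (V * (\<theta> * \<rho> / 8))"
      unfolding V_def using \<theta>(1) \<rho>(1) by (simp add: power_mult_distrib mult_ac)
    also have "\<dots> = ennreal V * emeasure lebesgue J"
    proof -
      have "emeasure lebesgue J = emeasure lborel J" unfolding J_def by simp
      also have "\<dots> = ennreal (to - 5 / 8 * (\<theta> * \<rho>) - (to - 3 / 4 * (\<theta> * \<rho>)))"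
        unfolding J_def by (rule emeasure_lborel_Ioc) (use \<theta>\<rho> in linarith)
      also have "to - 5 / 8 * (\<theta> * \<rho>) - (to - 3 / 4 * (\<theta> * \<rho>)) = \<theta> * \<rho> / 8" by simp
      finally show ?thesis using V by (simp only: ennreal_mult' less_imp_le)
    qed
    also have "\<dots> = (\<integral>\<^sup>+t. ennreal V * indicator J t \<partial>lebesgue)"
      by (rule nn_integral_cmult_indicator[symmetric]) (simp add: J_def)
    also have "\<dots> \<le> (\<integral>\<^sup>+t. total_variation (\<lambda>x. u (x, t)) (ball xo (4 * \<rho>)) * indicator {to - 4 * \<rho>..to} t \<partial>lebesgue)"
    proof (rule nn_integral_mono_AE)
      show "AE t in lebesgue. ennreal V * indicator J t
         \<le> total_variation (\<lambda>x. u (x, t)) (ball xo (4 * \<rho>)) * indicator {to - 4 * \<rho>..to} t"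
        using AE_lebesgue_slices[OF MK]
      proof eventually_elim
        fix t assume "AE x in lebesgue. (x, t) \<in> ?K \<longrightarrow> \<bar>u (x, t)\<bar> \<le> M"
        then have "ennreal V \<le> total_variation (\<lambda>x. u (x, t)) (ball xo (4 * \<rho>))" if "t \<in> J"
          using neg that by (meson linear)
        then show "ennreal V * indicator J t
         \<le> total_variation (\<lambda>x. u (x, t)) (ball xo (4 * \<rho>)) * indicator {to - 4 * \<rho>..to} t"
          using JK(1)[of t] by (auto split: split_indicator)
      qed
    qed
    also have "\<dots> = (\<integral>\<^sup>+t. total_variation (\<lambda>x. u (x, t)) (ball xo (4 * \<rho>)) \<partial>lebesgue_on {to - 4 * \<rho>..to})"
      by (rule nn_integral_restrict_space[symmetric]) simp
    also have "\<dots> \<le> ennreal (\<eta> * (4 * \<rho>) ^ DIM('a))" by (rule b(2)) (use \<rho> in auto)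
    finally have "2 * \<eta> * (4 * \<rho>) ^ DIM('a) \<le> \<eta> * (4 * \<rho>) ^ DIM('a)"
      using \<eta> \<rho> by (subst (asm) ennreal_le_iff) auto
    moreover have "0 < \<eta> * (4 * \<rho>) ^ DIM('a)" using \<eta> \<rho> by simp
    ultimately show False by linarith
  qed
  then obtain s where s: "s \<in> J" and tv: "total_variation (\<lambda>x. u (x, s)) (ball xo (4 * \<rho>)) \<le> ennreal V"
    and Ms: "AE x in lebesgue. (x, s) \<in> ?K \<longrightarrow> \<bar>u (x, s)\<bar> \<le> M" by blast
  have sT: "s \<in> {0<..<T}" using JK(2)[OF s] r1 by auto
  have Ms': "AE x in lebesgue_on (ball xo (4 * \<rho>)). \<bar>u (x, s)\<bar> \<le> M"
  proof -
    have "AE x in lebesgue. x \<in> ball xo (4 * \<rho>) \<longrightarrow> \<bar>u (x, s)\<bar> \<le> M"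
      using Ms by eventually_elim (use JK(2)[OF s] \<rho>(3) in auto)
    then show ?thesis by (subst AE_restrict_space_iff) auto
  qed
  have "integrable (lebesgue_on (ball xo (4 * \<rho>))) (\<lambda>x. (u (x, s))\<^sup>2)"
    using up.slice_ball[OF E4 sT] by (simp add: L2_def)
  then obtain c where c: "\<bar>c\<bar> \<le> M"
    and near: "(\<integral>\<^sup>+x. ennreal \<bar>u (x, s) - c\<bar> \<partial>lebesgue_on (ball xo \<rho>)) \<le> ennreal (2 ^ (DIM('a) + 2) * \<rho> * V)"
    by (rule total_variation_Poincare[OF up.slice_measurable[OF E4 sT] _ tv V \<rho>(1) Ms'])
  have Ms1: "AE x in lebesgue_on (ball xo \<rho>). \<bar>u (x, s)\<bar> \<le> M"
    by (rule AE_lebesgue_on_subset[OF Ms']) (use \<rho> in auto)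
  \<comment> \<open>A general \<open>g\<close> treats the truncations of \<open>u\<close> at
    \<open>c\<close> and of \<open>- u\<close> at \<open>- c\<close> together. One factor of the
    square is bounded by \<open>2 * M\<close>, so closeness in L1 gives the required smallness of
    the square integral.\<close>
  have init: "(\<integral>\<^sup>+x. ennreal ((g (u (x, s)))\<^sup>2) \<partial>lebesgue_on (ball xo \<rho>)) \<le> ennreal (\<delta> * \<rho> ^ DIM('a))"
    if g: "\<And>y. 0 \<le> g y" "\<And>y. g y \<le> \<bar>y - c\<bar>" for g :: "real \<Rightarrow> real"
  proof -
    have "(\<integral>\<^sup>+x. ennreal ((g (u (x, s)))\<^sup>2) \<partial>lebesgue_on (ball xo \<rho>))
       \<le> (\<integral>\<^sup>+x. ennreal (2 * M) * ennreal \<bar>u (x, s) - c\<bar> \<partial>lebesgue_on (ball xo \<rho>))"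
    proof (rule nn_integral_mono_AE)
      show "AE x in lebesgue_on (ball xo \<rho>). ennreal ((g (u (x, s)))\<^sup>2) \<le> ennreal (2 * M) * ennreal \<bar>u (x, s) - c\<bar>"
        using Ms1
      proof eventually_elim
        fix x assume "\<bar>u (x, s)\<bar> \<le> M"
        then have "g (u (x, s)) \<le> 2 * M" using g(2)[of "u (x, s)"] c by linarith
        then have "g (u (x, s)) * g (u (x, s)) \<le> 2 * M * \<bar>u (x, s) - c\<bar>"
          using g M by (intro mult_mono) auto
        then show "ennreal ((g (u (x, s)))\<^sup>2) \<le> ennreal (2 * M) * ennreal \<bar>u (x, s) - c\<bar>"
          using M by (simp add: power2_eq_square ennreal_leI flip: ennreal_mult)
      qed
    qed
    also have "\<dots> \<le> ennreal (2 * M) * (\<integral>\<^sup>+x. ennreal \<bar>u (x, s) - c\<bar> \<partial>lebesgue_on (ball xo \<rho>))"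
      by (rule nn_integral_cmult_le[OF \<omega>])
    also have "\<dots> \<le> ennreal (2 * M) * ennreal (2 ^ (DIM('a) + 2) * \<rho> * V)"
      by (intro mult_left_mono near) simp
    also have "\<dots> = ennreal (2 * M * (2 ^ (DIM('a) + 2) * \<rho> * V))"
      by (rule ennreal_mult[symmetric]) (use M \<rho> V in auto)
    also have "2 * M * (2 ^ (DIM('a) + 2) * \<rho> * V) = \<delta> * \<rho> ^ DIM('a)"
    proof -
      define A where "A = 2 * M * 2 ^ (DIM('a) + 2) * 16 * 4 ^ DIM('a)"
      have A: "0 < A" unfolding A_def using M by simp
      have "2 * M * (2 ^ (DIM('a) + 2) * \<rho> * V) = A * \<eta> * \<rho> ^ DIM('a) * (\<rho> / (\<theta> * \<rho>))"
        unfolding V_def A_def by (simp only: times_divide_eq_right times_divide_eq_left mult_ac)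
      also have "\<rho> / (\<theta> * \<rho>) = 1 / \<theta>" using \<rho> by simp
      also have "A * \<eta> = \<delta> * \<theta>" unfolding \<eta>_def A_def[symmetric] using A by simp
      finally show ?thesis using \<theta> by simp
    qed
    finally show ?thesis .
  qed
  have s': "to - 3 / 4 * (\<theta> * \<rho>) < s" "s \<le> to - 5 / 8 * (\<theta> * \<rho>)" "s + \<theta> * \<rho> < to + r1"
  proof -
    show "to - 3 / 4 * (\<theta> * \<rho>) < s" and *: "s \<le> to - 5 / 8 * (\<theta> * \<rho>)" using s unfolding J_def by auto
    show "s + \<theta> * \<rho> < to + r1" using * \<theta>\<rho> \<rho> by linarith
  qed
  have sub: "ball xo \<rho> \<times> {s<..s + \<theta> * \<rho>} \<subseteq> ?K"
  proof -
    have "to - r1 \<le> s" using JK(2)[OF s] by simp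
    then show ?thesis using s' \<rho> by auto
  qed
  have Mc: "AE z in lebesgue_on (ball xo \<rho> \<times> {s<..s + \<theta> * \<rho>}). \<bar>u z\<bar> \<le> M"
    by (rule AE_lebesgue_on_subset[OF M(2) sub cylinder_lebesgue K])
  have E1: "cball xo \<rho> \<subseteq> E" using r1(2) subset_cball[of \<rho> r1 xo] \<rho> by auto
  have s0: "0 < s" and sT': "s + \<theta> * \<rho> < T" using sT s'(3) r1(4) by auto
  let ?B = "ball xo (\<rho> / 4) \<times> {s + \<theta> * \<rho> / 2<..s + \<theta> * \<rho>}"
  have "AE z in lebesgue_on ?B. u z \<le> c + 2 * \<epsilon>"
  proof (rule bound[rule_format, OF u(1) \<rho>(1) E1 s0 sT'])
    show "AE z in lebesgue_on (ball xo \<rho> \<times> {s<..s + \<theta> * \<rho>}). trunc_pos c (u z) \<le> 2 * M"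
      using Mc by eventually_elim (use c in \<open>auto simp: trunc_pos_def\<close>)
    show "(\<integral>\<^sup>+x. ennreal ((trunc_pos c (u (x, s)))\<^sup>2) \<partial>lebesgue_on (ball xo \<rho>)) \<le> ennreal (\<delta> * \<rho> ^ DIM('a))"
      by (rule init) (auto simp: trunc_pos_def)
  qed
  moreover have "AE z in lebesgue_on ?B. - u z \<le> - c + 2 * \<epsilon>"
  proof (rule bound[rule_format, OF u(2) \<rho>(1) E1 s0 sT'])
    show "AE z in lebesgue_on (ball xo \<rho> \<times> {s<..s + \<theta> * \<rho>}). trunc_pos (- c) (- u z) \<le> 2 * M"
      using Mc by eventually_elim (use c in \<open>auto simp: trunc_pos_def\<close>)
    show "(\<integral>\<^sup>+x. ennreal ((trunc_pos (- c) (- u (x, s)))\<^sup>2) \<partial>lebesgue_on (ball xo \<rho>)) \<le> ennreal (\<delta> * \<rho> ^ DIM('a))"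
      by (rule init[of "\<lambda>y. trunc_pos (- c) (- y)"]) (auto simp: trunc_pos_def)
  qed
  ultimately have AEB: "AE z in lebesgue_on ?B. \<bar>u z - c\<bar> \<le> 2 * \<epsilon>"
    by eventually_elim auto
  define r where "r = \<theta> * \<rho> / 8"
  have r: "0 < r" unfolding r_def using \<theta>\<rho> by simp
  have "ball (xo, to) r \<subseteq> ?B"
  proof
    fix z assume z: "z \<in> ball (xo, to) r"
    have "dist xo (fst z) < r" "dist to (snd z) < r"
      using z dist_fst_le[of "(xo, to)" z] dist_snd_le[of "(xo, to)" z] by auto
    moreover have "r \<le> \<rho> / 4" "s + \<theta> * \<rho> / 2 \<le> to - r" "to + r \<le> s + \<theta> * \<rho>"
      using s'(1,2) \<theta>\<rho> \<rho>(1) unfolding r_def by linarith+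
    ultimately show "z \<in> ?B" by (auto simp: mem_Times_iff dist_real_def)
  qed
  then have "AE z in lebesgue_on (ball (xo, to) r). \<bar>u z - c\<bar> \<le> 2 * \<epsilon>"
    by (rule AE_lebesgue_on_subset[OF AEB _ _ cylinder_lebesgue]) simp
  then show ?thesis using r by blast
qed

section \<open>Essential oscillation\<close>

lemma ess_osc_nonneg:
  fixes z :: "'a::euclidean_space"
  assumes "0 < r"
  shows "0 \<le> ess_osc u (ball z r)"
proof -
  have ae: "AE y in lebesgue_on (ball z r). ereal (u y) \<le> esssup (lebesgue_on (ball z r)) (\<lambda>y. ereal (u y)) \<and>
      - ereal (u y) \<le> esssup (lebesgue_on (ball z r)) (\<lambda>y. - ereal (u y))"
    using esssup_AE by (rule AE_conjI[OF esssup_AE])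
  obtain y where "ereal (u y) \<le> esssup (lebesgue_on (ball z r)) (\<lambda>y. ereal (u y)) \<and>
      - ereal (u y) \<le> esssup (lebesgue_on (ball z r)) (\<lambda>y. - ereal (u y))"
    by (rule AE_nontrivial_lebesgue_on[OF ae assms])
  then have y: "ereal (u y) \<le> esssup (lebesgue_on (ball z r)) (\<lambda>y. ereal (u y))"
      "- ereal (u y) \<le> esssup (lebesgue_on (ball z r)) (\<lambda>y. - ereal (u y))" by auto
  have "0 = ereal (u y) + - ereal (u y)" by simp
  also have "\<dots> \<le> ess_osc u (ball z r)" unfolding ess_osc_def by (rule add_mono[OF y])
  finally show ?thesis .
qed

lemma ess_osc_le:
  assumes m: "u \<in> borel_measurable (lebesgue_on A)" and le: "AE y in lebesgue_on A. \<bar>u y - c\<bar> \<le> e"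
  shows "ess_osc u A \<le> ereal (2 * e)"
proof -
  have "esssup (lebesgue_on A) (\<lambda>y. ereal (u y)) \<le> ereal (c + e)"
    using m le by (intro esssup_I) (auto elim!: eventually_mono)
  moreover have "esssup (lebesgue_on A) (\<lambda>y. - ereal (u y)) \<le> ereal (e - c)"
    using m le by (intro esssup_I) (auto elim!: eventually_mono)
  ultimately have "ess_osc u A \<le> ereal (c + e) + ereal (e - c)"
    unfolding ess_osc_def by (rule add_mono)
  then show ?thesis by simp
qed

lemma ess_osc_lessE:
  fixes z :: "'a::euclidean_space"
  assumes r: "0 < r" and less: "ess_osc u (ball z r) < ereal e"
  obtains m where "AE y in lebesgue_on (ball z r). m \<le> u y \<and> u y \<le> m + e"
proof -
  let ?S = "esssup (lebesgue_on (ball z r)) (\<lambda>y. ereal (u y))"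
  let ?S' = "esssup (lebesgue_on (ball z r)) (\<lambda>y. - ereal (u y))"
  have ae: "AE y in lebesgue_on (ball z r). ereal (u y) \<le> ?S \<and> - ereal (u y) \<le> ?S'"
    using esssup_AE by (rule AE_conjI[OF esssup_AE])
  obtain y where y': "ereal (u y) \<le> ?S \<and> - ereal (u y) \<le> ?S'"
    by (rule AE_nontrivial_lebesgue_on[OF ae r])
  then have y: "ereal (u y) \<le> ?S" "- ereal (u y) \<le> ?S'" by auto
  have sum: "?S + ?S' < ereal e" using less unfolding ess_osc_def .
  \<comment> \<open>The point \<open>y\<close> excludes minus infinity for both suprema; the finite
    bound on their sum then excludes plus infinity.\<close>
  obtain a b where ab: "?S = ereal a" "?S' = ereal b"
    using y sum by (cases ?S; cases ?S') auto
  have "a + b < e" using sum ab by simp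
  have "AE y in lebesgue_on (ball z r). - b \<le> u y \<and> u y \<le> - b + e"
    using ae unfolding ab by eventually_elim (use \<open>a + b < e\<close> in auto)
  then show thesis by (rule that)
qed

theorem mainTheorem2:
  fixes E :: "'a::euclidean_space set"
    and u :: "'a \<times> real \<Rightarrow> real"
    and T \<gamma> to :: real
    and xo :: 'a
  assumes "open E" and "0 < T" and "0 < \<gamma>"
    and "u \<in> DG E T \<gamma> \<inter> Linf_loc (E \<times> {0<..<T})"
    and "(xo, to) \<in> E \<times> {0<..<T}"
  shows "ess_continuous_at u (xo, to) \<longleftrightarrow>
    Limsup (at_right 0)
      (\<lambda>\<rho>. ennreal (\<rho> / measure lebesgue (cylinder (0::'a) 0 1 \<rho>)) *
        (\<integral>\<^sup>+ t. total_variation (\<lambda>x. u (x, t)) (ball xo \<rho>) \<partial>lebesgue_on {to - \<rho>..to})) = 0"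
proof -
  define \<kappa> where "\<kappa> = unit_ball_vol (real DIM('a))"
  have \<kappa>: "0 < \<kappa>" unfolding \<kappa>_def by simp
  define I where "I \<rho> = (\<integral>\<^sup>+ t. total_variation (\<lambda>x. u (x, t)) (ball xo \<rho>) \<partial>lebesgue_on {to - \<rho>..to})" for \<rho>
  define L where "L \<rho> = ennreal (\<rho> / measure lebesgue (cylinder (0::'a) 0 1 \<rho>)) * I \<rho>" for \<rho>
  \<comment> \<open>The cylinder has volume \<open>\<kappa> * \<rho> ^ DIM('a) * \<rho>\<close>, so
    the normalising factor is the reciprocal of the volume of the ball.\<close>
  have L: "L \<rho> = ennreal (1 / (\<kappa> * \<rho> ^ DIM('a))) * I \<rho>" if "0 < \<rho>" for \<rho>
    using that unfolding L_def measure_cylinder[OF that] \<kappa>_def by simp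
  have u: "DG_subsolution E T \<gamma> u" "DG_subsolution E T \<gamma> (\<lambda>z. - u z)"
    using DG_imp_subsolution assms by auto
  interpret DG_subsolution E T \<gamma> u by (rule u)
  obtain r0 where r0: "0 < r0" "cball xo r0 \<subseteq> E"
    using assms(1,5) open_contains_cball by blast
  define r1 where "r1 = min r0 (min (to / 2) ((T - to) / 2))"
  have r1: "0 < r1" "cball xo r1 \<subseteq> E" "0 < to - r1" "to + r1 < T"
  proof -
    show "0 < r1" unfolding r1_def using r0 assms(5) by auto
    have r10: "r1 \<le> r0" and *: "r1 \<le> to / 2" "r1 \<le> (T - to) / 2" unfolding r1_def by linarith+
    show "0 < to - r1" "to + r1 < T" using * assms(5) by (auto simp: field_simps)
    show "cball xo r1 \<subseteq> E" using r0(2) subset_cball[OF r10, of xo] by blast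
  qed
  let ?K = "cball xo r1 \<times> {to - r1..to + r1}"
  have "compact ?K" by (intro compact_Times) auto
  moreover have KD: "?K \<subseteq> E \<times> {0<..<T}" using r1 by auto
  ultimately have Kinf: "u \<in> Linf ?K" using assms(4) unfolding Linf_loc_def by blast
  then obtain M0 where M0: "AE z in lebesgue_on ?K. \<bar>u z\<bar> \<le> M0" unfolding Linf_def by blast
  define M where "M = max M0 1"
  have M: "0 < M" "AE z in lebesgue_on ?K. \<bar>u z\<bar> \<le> M"
    using M0 unfolding M_def by (auto elim!: eventually_mono)
  have ballK: "ball (xo, to) r1 \<subseteq> ?K"
  proof
    fix z assume "z \<in> ball (xo, to) r1"
    then have "dist xo (fst z) < r1" "dist to (snd z) < r1"
      using dist_fst_le[of "(xo, to)" z] dist_snd_le[of "(xo, to)" z] by auto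
    then show "z \<in> ?K" by (auto simp: mem_Times_iff dist_real_def)
  qed
  have um: "u \<in> borel_measurable (lebesgue_on (ball (xo, to) r))" if "r \<le> r1" for r
  proof -
    have sub: "ball (xo, to) r \<subseteq> ?K" using ballK subset_ball[OF that, of "(xo, to)"] by blast
    have "u \<in> borel_measurable (lebesgue_on ?K)" using Kinf unfolding Linf_def by blast
    then show ?thesis by (rule measurable_restrict_mono) (rule sub)
  qed
  have "ess_continuous_at u (xo, to) \<longleftrightarrow> Limsup (at_right 0) L = 0"
  proof
    assume cont: "ess_continuous_at u (xo, to)"
    have le: "Limsup (at_right 0) L \<le> ennreal d" if d: "0 < d" for d :: real
    proof -
      \<comment> \<open>For \<open>e \<le> 1\<close> one has
        \<open>4 * e + e\<^sup>2 \<le> 5 * e\<close>, which makes the variation estimate linear in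
        the oscillation with slope \<open>A\<close>.\<close>
      define A where "A = \<gamma> * 5 * (2 * 2 ^ DIM('a))"
      have A: "0 < A" unfolding A_def using assms(3) by simp
      define e where "e = min 1 (d / A)"
      have e: "0 < e" "e \<le> 1" "e * A \<le> d" unfolding e_def using d A by (auto simp: min_def field_simps)
      have "\<forall>\<^sub>F r in at_right 0. ess_osc u (ball (xo, to) r) < ereal e"
        using cont e(1) unfolding ess_continuous_at_def by (intro order_tendstoD(2)) auto
      then obtain b where b: "0 < b" "\<And>r. 0 < r \<Longrightarrow> r < b \<Longrightarrow> ess_osc u (ball (xo, to) r) < ereal e"
        unfolding eventually_at_right_field by blast
      define r where "r = min (b / 2) r1"
      have r: "0 < r" "r < b" "r \<le> r1" unfolding r_def using b r1 by auto
      obtain m where m: "AE z in lebesgue_on (ball (xo, to) r). m \<le> u z \<and> u z \<le> m + e"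
        using ess_osc_lessE[OF r(1) b(2)[OF r(1,2)]] by blast
      have "L \<rho> \<le> ennreal d" if \<rho>: "0 < \<rho>" "\<rho> < r / 4" for \<rho>
      proof -
        \<comment> \<open>Distances in space and in time are each below \<open>2 * \<rho>\<close>,
          so their sum is below \<open>r\<close> because \<open>\<rho> < r / 4\<close>.\<close>
        have sub: "ball xo (2 * \<rho>) \<times> {to - 2 * \<rho><..to} \<subseteq> ball (xo, to) r"
        proof
          fix z assume z: "z \<in> ball xo (2 * \<rho>) \<times> {to - 2 * \<rho><..to}"
          have "dist (xo, to) z \<le> dist (xo, to) (fst z, to) + dist (fst z, to) z" by (rule dist_triangle)
          also have "\<dots> = dist xo (fst z) + dist to (snd z)" by (cases z) (simp add: dist_Pair_Pair)
          also have "\<dots> < r" using z \<rho> by (auto simp: dist_real_def)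
          finally show "z \<in> ball (xo, to) r" by simp
        qed
        have bd: "AE z in lebesgue_on (ball xo (2 * \<rho>) \<times> {to - 2 * \<rho><..to}). m \<le> u z \<and> u z \<le> m + e"
          by (rule AE_lebesgue_on_subset[OF m sub cylinder_lebesgue]) simp
        have "2 * \<rho> \<le> r1" using \<rho> r by linarith
        then have E2: "cball xo (2 * \<rho>) \<subseteq> E" using r1(2) subset_cball[of "2 * \<rho>" r1 xo] by blast
        have "I \<rho> \<le> ennreal (\<gamma> * (4 * e + e\<^sup>2) * (2 * 2 ^ DIM('a)) * (\<kappa> * \<rho> ^ DIM('a)))"
          unfolding I_def \<kappa>_def
          by (rule total_variation_integral_le[OF \<rho>(1) E2 _ _ _ bd]) (use \<rho> r r1 e in auto)
        also have "\<dots> \<le> ennreal (d * (\<kappa> * \<rho> ^ DIM('a)))"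
        proof (intro ennreal_leI mult_right_mono)
          have "4 * e + e\<^sup>2 \<le> 5 * e" using e by (simp add: power2_eq_square mult_left_le)
          then have "\<gamma> * (4 * e + e\<^sup>2) * (2 * 2 ^ DIM('a)) \<le> \<gamma> * (5 * e) * (2 * 2 ^ DIM('a))"
            using assms(3) by (intro mult_right_mono mult_left_mono) auto
          also have "\<dots> = e * A" unfolding A_def by simp
          finally show "\<gamma> * (4 * e + e\<^sup>2) * (2 * 2 ^ DIM('a)) \<le> d" using e(3) by linarith
        qed (use \<kappa> \<rho> in simp)
        finally have "L \<rho> \<le> ennreal (1 / (\<kappa> * \<rho> ^ DIM('a))) * ennreal (d * (\<kappa> * \<rho> ^ DIM('a)))"
          unfolding L[OF \<rho>(1)] by (rule mult_left_mono) simp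
        also have "\<dots> = ennreal (1 / (\<kappa> * \<rho> ^ DIM('a)) * (d * (\<kappa> * \<rho> ^ DIM('a))))"
          by (rule ennreal_mult[symmetric]) (use \<kappa> \<rho> d in auto)
        also have "1 / (\<kappa> * \<rho> ^ DIM('a)) * (d * (\<kappa> * \<rho> ^ DIM('a))) = d" using \<kappa> \<rho> by simp
        finally show ?thesis .
      qed
      then show ?thesis
        by (intro Limsup_bounded) (auto simp: eventually_at_right_field intro!: exI[of _ "r / 4"] r)
    qed
    have "Limsup (at_right 0) L \<le> 0"
      by (rule ennreal_le_epsilon) (simp add: le)
    then show "Limsup (at_right 0) L = 0" by simp
  next
    assume lim0: "Limsup (at_right 0) L = 0"
    have lim: "\<forall>\<^sub>F \<rho> in at_right 0. I \<rho> \<le> ennreal (\<eta> * \<rho> ^ DIM('a))" if \<eta>: "0 < \<eta>" for \<eta>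
    proof -
      have "\<forall>\<^sub>F \<rho> in at_right 0. L \<rho> < ennreal (\<eta> / \<kappa>)"
        by (rule Limsup_lessD) (use lim0 \<eta> \<kappa> in simp)
      then show ?thesis using eventually_at_right_less[of "0::real"]
      proof eventually_elim
        fix \<rho> :: real assume *: "L \<rho> < ennreal (\<eta> / \<kappa>)" and \<rho>: "0 < \<rho>"
        have P: "0 < \<kappa> * \<rho> ^ DIM('a)" using \<kappa> \<rho> by simp
        have "ennreal (\<kappa> * \<rho> ^ DIM('a)) * ennreal (1 / (\<kappa> * \<rho> ^ DIM('a))) = ennreal (\<kappa> * \<rho> ^ DIM('a) * (1 / (\<kappa> * \<rho> ^ DIM('a))))"
          by (rule ennreal_mult[symmetric]) (use P in auto)
        also have "\<kappa> * \<rho> ^ DIM('a) * (1 / (\<kappa> * \<rho> ^ DIM('a))) = 1" using \<kappa> \<rho> by simp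
        finally have "I \<rho> = ennreal (\<kappa> * \<rho> ^ DIM('a)) * L \<rho>"
          unfolding L[OF \<rho>] by (simp add: mult.assoc[symmetric])
        also have "\<dots> \<le> ennreal (\<kappa> * \<rho> ^ DIM('a)) * ennreal (\<eta> / \<kappa>)"
          using * by (intro mult_left_mono) auto
        also have "\<dots> = ennreal (\<kappa> * \<rho> ^ DIM('a) * (\<eta> / \<kappa>))"
          by (rule ennreal_mult[symmetric]) (use P \<eta> \<kappa> in auto)
        also have "\<kappa> * \<rho> ^ DIM('a) * (\<eta> / \<kappa>) = \<eta> * \<rho> ^ DIM('a)" using \<kappa> by simp
        finally show "I \<rho> \<le> ennreal (\<eta> * \<rho> ^ DIM('a))" .
      qed
    qed
    show "ess_continuous_at u (xo, to)"
      unfolding ess_continuous_at_def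
    proof (rule order_tendstoI)
      fix a :: ereal assume "a < 0"
      have "\<forall>\<^sub>F r in at_right (0::real). 0 < r" by (rule eventually_at_right_less)
      then show "\<forall>\<^sub>F r in at_right 0. a < ess_osc u (ball (xo, to) r)"
        by eventually_elim (use \<open>a < 0\<close> ess_osc_nonneg less_le_trans in blast)
    next
      fix a :: ereal assume "0 < a"
      then obtain d where "0 < ereal d" "ereal d < a" using ereal_dense2[of 0 a] by auto
      then have d: "0 < d" "ereal d < a" by auto
      \<comment> \<open>The resulting distance \<open>2 * (d / 8)\<close> to a constant doubles in
        the oscillation, which is then at most \<open>d / 2\<close>.\<close>
      have "0 < d / 8" using d by simp
      from DG_oscillation_small[OF u r1 M lim[unfolded I_def] this]
      obtain r c where r: "0 < r" and c: "AE z in lebesgue_on (ball (xo, to) r). \<bar>u z - c\<bar> \<le> 2 * (d / 8)"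
        by blast
      have "ess_osc u (ball (xo, to) r') < a" if r': "0 < r'" "r' < min r r1" for r'
      proof -
        have sub: "ball (xo, to) r' \<subseteq> ball (xo, to) r" using r' by (intro subset_ball) simp
        have "AE z in lebesgue_on (ball (xo, to) r'). \<bar>u z - c\<bar> \<le> 2 * (d / 8)"
          by (rule AE_lebesgue_on_subset[OF c sub]) auto
        from ess_osc_le[OF um this] have "ess_osc u (ball (xo, to) r') \<le> ereal (2 * (2 * (d / 8)))"
          using r' by simp
        also have "\<dots> \<le> ereal d" using d by simp
        also note d(2)
        finally show ?thesis .
      qed
      then show "\<forall>\<^sub>F r in at_right 0. ess_osc u (ball (xo, to) r) < a"
        using r r1(1) by (auto simp: eventually_at_right_field intro!: exI[of _ "min r r1"])
    qed
  qed
  then show ?thesis unfolding L_def I_def .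
qed

end
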